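(* Let $d\ge 1$, $H\in(\tfrac12,1)$, $T>0$, and assume $\beta\in\big(2H-1,\ d\wedge(2H+1)\big)$. Let $u=(u(t,x))_{t\in[0,T],x\in\mathbb R^d}$ be the mild solution of the linear stochastic wave equation with zero initial conditions driven by the fractional-colored noise $W$ with Hurst index $H$ and Riesz spatial covariance of parameter $\beta$ (as defined in the context). Then for every $x\in\mathbb R^d$ and every $\delta\in\big(0,\frac{2H+1-\beta}{2}\big)$, the map $t\mapsto u(t,x)$, $t\in[0,T]$, is (up to modification) almost surely H\"older continuous of order $\delta$.
   Context: Fourier transform convention: $\mathcal F\varphi(\xi)=\int_{\mathbb R^d}e^{-i\xi\cdot x}\varphi(x)\,dx$. Let $\mu(d\xi)=|\xi|^{-d+\beta}d\xi$ on $\mathbb R^d$, $0<\beta<d$, and let $f$ be the Fourier transform of $\mu$ in $\mathcal S'(\mathbb R^d)$, i.e. $\int f\varphi\,dx=\int\mathcal F\varphi\,d\mu$ for $\varphi\in\mathcal S(\mathbb R^d)$ (the Riesz kernel, a constant multiple of $|x|^{-\beta}$). Let $R_H(t,s)=\frac12(t^{2H}+s^{2H}-|t-s|^{2H})$ and $\alpha_H=H(2H-1)$. The noise $W=\{W_t(A):t\ge0,\ A\subset\mathbb R^d \text{ bounded Borel}\}$ is a centered Gaussian family with covariance $\mathbf E(W_t(A)W_s(B))=R_H(t,s)\int_A\int_B f(x-y)\,dx\,dy$. The Hilbert space $\mathcal{HP}$ is the completion of the linear span of the functions $1_{[0,t]\times A}$ for the inner product $\langle\varphi,\psi\rangle_{\mathcal{HP}}=\alpha_H\int_{\mathbb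 R^d}\int_0^\infty\int_0^\infty\mathcal F\varphi(r,\cdot)(\xi)\overline{\mathcal F\psi(v,\cdot)(\xi)}|r-v|^{2H-2}\,dr\,dv\,\mu(d\xi)$, and $1_{[0,t]\times A}\mapsto W_t(A)$ extends to an isometry $\varphi\mapsto W(\varphi)=\int_0^\infty\int_{\mathbb R^d}\varphi\,dW$ from $\mathcal{HP}$ into $L^2(\Omega)$. The stochastic wave equation is $\partial_t^2u=\Delta u+\dot W$ on $(0,\infty)\times\mathbb R^d$, $u(0,\cdot)=0$, $\partial_tu(0,\cdot)=0$. Let $G_1$ be the fundamental solution of $u_{tt}-\Delta u=0$, with $\mathcal FG_1(t,\cdot)(\xi)=\sin(t|\xi|)/|\xi|$. The (mild) solution is the centered Gaussian process $u(t,x)=\int_0^t\int_{\mathbb R^d}G_1(t-s,x-y)\,W(ds,dy)$, i.e. $u(t,x)=W(g_{t,x})$ with $g_{t,x}=G_1(t-\cdot,x-\cdot)1_{[0,t]}$; it is well defined for $\beta\in(0,d\wedge(2H+1))$. Equivalently, $u$ is centered Gaussian with $$\mathbf E[u(t,x)u(s,y)]=\alpha_H\int_{\mathbb R^d}\mu(d\xi)\,e^{-i\xi\cdot(x-y)}\int_0^t\int_0^s\frac{\sin((t-r)|\xi|)\,\sin((s-v)|\xi|)}{|\xi|^2}\,|r-v|^{2H-2}\,dv\,dr .$$ *)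

theory Defs
  imports "HOL-Probability.Probability"
begin

definition fourier :: "('a::euclidean_space \<Rightarrow> complex) \<Rightarrow> 'a \<Rightarrow> complex" where
  "fourier \<phi> \<xi> = (LINT x|lborel. exp (- (\<i> * of_real (\<xi> \<bullet> x))) * \<phi> x)"

text \<open>Unfolding the coinduction: all iterated partial derivatives of a Schwartz function exist,
  are Frechet differentiable everywhere, and decay faster than every power of the norm.\<close>

coinductive schwartz :: "('a::euclidean_space \<Rightarrow> complex) \<Rightarrow> bool" where
  "\<lbrakk>\<And>x. \<phi> differentiable (at x);
    \<And>k. bounded (range (\<lambda>x. norm x ^ k *\<^sub>R \<phi> x));
    \<And>b. b \<in> Basis \<Longrightarrow> schwartz (\<lambda>x. frechet_derivative \<phi> (at x) b)\<rbrakk>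
   \<Longrightarrow> schwartz \<phi>"

definition riesz_measure :: "real \<Rightarrow> 'a::euclidean_space measure" where
  "riesz_measure \<beta> = density lborel (\<lambda>\<xi>. ennreal (norm \<xi> powr (- real DIM('a) + \<beta>)))"

text \<open>The Fourier transform of \<open>\<mu>\<close> in the sense of tempered distributions is the function \<open>f\<close>.
  Integrability against all Schwartz functions (hence local integrability) is what makes
  \<open>f\<close> define a tempered distribution.\<close>

definition is_tempered_fourier_of :: "('a::euclidean_space \<Rightarrow> real) \<Rightarrow> 'a measure \<Rightarrow> bool" where
  "is_tempered_fourier_of f \<mu> \<longleftrightarrow>
     f \<in> borel_measurable borel \<and>
     (\<forall>\<phi>. schwartz \<phi> \<longrightarrow>
        integrable lborel (\<lambda>x. of_real (f x) * \<phi> x) \<and>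
        (LINT x|lborel. of_real (f x) * \<phi> x) = (LINT \<xi>|\<mu>. fourier \<phi> \<xi>))"

text \<open>A centered Gaussian variable may be degenerate.\<close>

definition centered_gaussian :: "'w measure \<Rightarrow> ('w \<Rightarrow> real) \<Rightarrow> bool" where
  "centered_gaussian M X \<longleftrightarrow>
     X \<in> borel_measurable M \<and>
     ((AE \<omega> in M. X \<omega> = 0) \<or>
      (\<exists>\<sigma>>0. distributed M lborel X (\<lambda>x. ennreal (normal_density 0 \<sigma> x))))"

definition centered_gaussian_family ::
    "'w measure \<Rightarrow> 'i set \<Rightarrow> ('i \<Rightarrow> 'w \<Rightarrow> real) \<Rightarrow> bool" where
  "centered_gaussian_family M I X \<longleftrightarrow>
     (\<forall>J c. finite J \<and> J \<subseteq> I \<longrightarrow> centered_gaussian M (\<lambda>\<omega>. \<Sum>i\<in>J. c i * X i \<omega>))"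

definition fbm_cov :: "real \<Rightarrow> real \<Rightarrow> real \<Rightarrow> real" where
  "fbm_cov H t s = (t powr (2 * H) + s powr (2 * H) - \<bar>t - s\<bar> powr (2 * H)) / 2"

definition noise_index :: "(real \<times> 'a::euclidean_space set) set" where
  "noise_index = {(t, A). 0 \<le> t \<and> A \<in> sets borel \<and> bounded A}"

definition fractional_colored_noise ::
    "'w measure \<Rightarrow> real \<Rightarrow> ('a::euclidean_space \<Rightarrow> real) \<Rightarrow> (real \<Rightarrow> 'a set \<Rightarrow> 'w \<Rightarrow> real) \<Rightarrow> bool" where
  "fractional_colored_noise M H f W \<longleftrightarrow>
     centered_gaussian_family M noise_index (\<lambda>(t, A). W t A) \<and>
     (\<forall>(t, A) \<in> noise_index. \<forall>(s, B) \<in> noise_index.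
        (LINT \<omega>|M. W t A \<omega> * W s B \<omega>) =
          fbm_cov H t s * (LINT x:A|lborel. (LINT y:B|lborel. f (x - y))))"

text \<open>The list of triples \<open>(c, t, A)\<close> stands for the linear combination of the indicators of
  \<open>[0,t] \<times> A\<close> with coefficients \<open>c\<close>.\<close>

type_synonym 'a elem = "(real \<times> real \<times> 'a set) list"

definition valid_elem :: "'a::euclidean_space elem \<Rightarrow> bool" where
  "valid_elem es \<longleftrightarrow> (\<forall>(c, t, A) \<in> set es. (t, A) \<in> noise_index)"

definition elem_fun :: "'a elem \<Rightarrow> real \<Rightarrow> 'a \<Rightarrow> real" where
  "elem_fun es r x = (\<Sum>(c, t, A)\<leftarrow>es. c * indicator {0..t} r * indicator A x)"

definition elem_integral ::
    "(real \<Rightarrow> 'a set \<Rightarrow> 'w \<Rightarrow> real) \<Rightarrow> 'a elem \<Rightarrow> 'w \<Rightarrow> real" where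
  "elem_integral W es \<omega> = (\<Sum>(c, t, A)\<leftarrow>es. c * W t A \<omega>)"

text \<open>Elements of the Hilbert space \<open>\<H>\<P>\<close> need not be functions of the space variable (the wave kernel
  is not one in high dimension), so they are represented by their spatial Fourier transforms
  \<open>\<Phi> r \<xi>\<close>, the only way in which they enter the inner product.  The two time integrals are
  evaluated before the one over \<open>\<xi>\<close>: for \<open>\<beta> \<ge> 2\<close> the triple integral for the wave kernel does not
  converge absolutely.\<close>

definition hp_density ::
    "real \<Rightarrow> (real \<Rightarrow> 'a \<Rightarrow> complex) \<Rightarrow> (real \<Rightarrow> 'a \<Rightarrow> complex) \<Rightarrow> 'a \<Rightarrow> complex" where
  "hp_density H \<Phi> \<Psi> \<xi> =
     (LINT v:{0..}|lborel. (LINT r:{0..}|lborel.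
        \<Phi> r \<xi> * cnj (\<Psi> v \<xi>) * of_real (\<bar>r - v\<bar> powr (2 * H - 2))))"

definition hp_inner ::
    "real \<Rightarrow> real \<Rightarrow> (real \<Rightarrow> 'a::euclidean_space \<Rightarrow> complex) \<Rightarrow> (real \<Rightarrow> 'a \<Rightarrow> complex) \<Rightarrow> complex" where
  "hp_inner H \<beta> \<Phi> \<Psi> =
     of_real (H * (2 * H - 1)) * (LINT \<xi>|riesz_measure \<beta>. hp_density H \<Phi> \<Psi> \<xi>)"

text \<open>Convergence in the norm of \<open>\<H>\<P>\<close>; integrability is required because the Lebesgue integral
  of a non-integrable function is 0 by convention.\<close>

definition hp_tendsto ::
    "real \<Rightarrow> real \<Rightarrow> (nat \<Rightarrow> real \<Rightarrow> 'a::euclidean_space \<Rightarrow> complex) \<Rightarrow> (real \<Rightarrow> 'a \<Rightarrow> complex) \<Rightarrow> bool" where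
  "hp_tendsto H \<beta> \<Phi> \<Psi> \<longleftrightarrow>
     (\<forall>n. integrable (riesz_measure \<beta>)
        (hp_density H (\<lambda>r \<xi>. \<Phi> n r \<xi> - \<Psi> r \<xi>) (\<lambda>r \<xi>. \<Phi> n r \<xi> - \<Psi> r \<xi>))) \<and>
     (\<lambda>n. hp_inner H \<beta> (\<lambda>r \<xi>. \<Phi> n r \<xi> - \<Psi> r \<xi>) (\<lambda>r \<xi>. \<Phi> n r \<xi> - \<Psi> r \<xi>)) \<longlonglongrightarrow> 0"

text \<open>\<open>Y = W(\<psi>)\<close> almost surely, where \<open>\<psi>\<close> is the element of \<open>\<H>\<P>\<close> with spatial Fourier transform
  \<open>\<Psi>\<close> and \<open>W(\<psi>)\<close> is given by the extension of \<open>1\<^bsub>[0,t] \<times> A\<^esub> \<mapsto> W\<^sub>t(A)\<close> to an isometry on the completion: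
  \<open>\<psi>\<close> is the limit of elementary functions, and \<open>Y\<close> the limit in mean square of their integrals.\<close>

definition is_wiener_integral ::
    "'w measure \<Rightarrow> real \<Rightarrow> real \<Rightarrow> (real \<Rightarrow> 'a::euclidean_space set \<Rightarrow> 'w \<Rightarrow> real) \<Rightarrow>
     (real \<Rightarrow> 'a \<Rightarrow> complex) \<Rightarrow> ('w \<Rightarrow> real) \<Rightarrow> bool" where
  "is_wiener_integral M H \<beta> W \<Psi> Y \<longleftrightarrow>
     Y \<in> borel_measurable M \<and>
     (\<exists>es :: nat \<Rightarrow> 'a elem.
        (\<forall>n. valid_elem (es n)) \<and>
        hp_tendsto H \<beta> (\<lambda>n r. fourier (\<lambda>x. of_real (elem_fun (es n) r x))) \<Psi> \<and>
        (\<lambda>n. \<integral>\<^sup>+\<omega>. ennreal ((elem_integral W (es n) \<omega> - Y \<omega>)\<^sup>2) \<partial>M) \<longlonglongrightarrow> 0)"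

text \<open>The spatial Fourier transform of the fundamental solution \<open>G\<close> of the wave equation at time \<open>t\<close>,
  and that of \<open>(r, y) \<mapsto> G(t - r, x - y)\<close> on \<open>0 \<le> r \<le> t\<close>; the latter uses that
  \<open>G(t - r, \<cdot>)\<close> is even.\<close>

definition fourier_wave :: "real \<Rightarrow> 'a::euclidean_space \<Rightarrow> complex" where
  "fourier_wave t \<xi> = of_real (sin (t * norm \<xi>) / norm \<xi>)"

definition fourier_wave_kernel :: "real \<Rightarrow> 'a::euclidean_space \<Rightarrow> real \<Rightarrow> 'a \<Rightarrow> complex" where
  "fourier_wave_kernel t x r \<xi> =
     indicator {0..t} r * exp (- (\<i> * of_real (\<xi> \<bullet> x))) * fourier_wave (t - r) \<xi>"

definition is_mild_wave_solution ::
    "'w measure \<Rightarrow> real \<Rightarrow> real \<Rightarrow> real \<Rightarrow> (real \<Rightarrow> 'a::euclidean_space set \<Rightarrow> 'w \<Rightarrow> real) \<Rightarrow>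
     (real \<Rightarrow> 'a \<Rightarrow> 'w \<Rightarrow> real) \<Rightarrow> bool" where
  "is_mild_wave_solution M H \<beta> T W u \<longleftrightarrow>
     (\<forall>t\<in>{0..T}. \<forall>x. is_wiener_integral M H \<beta> W (fourier_wave_kernel t x) (u t x))"

definition is_modification ::
    "'w measure \<Rightarrow> real set \<Rightarrow> (real \<Rightarrow> 'w \<Rightarrow> real) \<Rightarrow> (real \<Rightarrow> 'w \<Rightarrow> real) \<Rightarrow> bool" where
  "is_modification M I v u \<longleftrightarrow>
     (\<forall>t\<in>I. v t \<in> borel_measurable M \<and> (AE \<omega> in M. v t \<omega> = u t \<omega>))"

definition hoelder_on :: "real \<Rightarrow> real set \<Rightarrow> (real \<Rightarrow> real) \<Rightarrow> bool" where
  "hoelder_on \<delta> I g \<longleftrightarrow> (\<exists>C. \<forall>s\<in>I. \<forall>t\<in>I. \<bar>g t - g s\<bar> \<le> C * \<bar>t - s\<bar> powr \<delta>)"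

end

theory Submission
  imports Defs
begin

text \<open>Everything rests on one variance estimate,
\<open>E (u t x - u s x)\<^sup>2 \<le> C * \<bar>t - s\<bar> powr (2 * H + 1 - \<beta>)\<close> for \<open>s, t \<in> {0..T}\<close>. The increment is a limit in
mean square of centered Gaussian variables, whose even moments are powers of their variances, so the
estimate gives \<open>P (e \<le> \<bar>u t x - u s x\<bar>) \<le> C * \<bar>t - s\<bar> powr (k * (2 * H + 1 - \<beta>)) / e ^ (2 * k)\<close>
for every \<open>k\<close> (\<open>wave_increment_tail\<close>). If \<open>2 * \<delta> < 2 * H + 1 - \<beta>\<close>, a large \<open>k\<close> makes
\<open>k * (2 * H + 1 - \<beta>) - 2 * k * \<delta>\<close> exceed 1, and this is what the chaining argument of Kolmogorov and
Chentsov asks for (\<open>kolmogorov_chentsov_weak_type\<close>).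

The variance estimate is proved frequency by frequency. Fix \<open>\<xi>\<close> with \<open>\<rho> = norm \<xi>\<close> and put
\<open>h = t - s\<close>. As a function of the time \<open>r\<close>, the spatial Fourier transform of the difference of the two
wave kernels is, up to a phase, a sine wave of frequency \<open>\<rho>\<close> on each of \<open>{0..s}\<close> and \<open>{s..t}\<close>, of
amplitude at most \<open>2 * min h (1 / \<rho>)\<close>. Pairing it with \<open>\<bar>r - v\<bar> powr (2 * H - 2)\<close> costs a factor
\<open>\<rho> powr (1 - 2 * H)\<close> only: within distance \<open>1 / \<rho>\<close> of the singularity this is the size of the integral of
the kernel, and further away the oscillation takes over (\<open>potential_bound\<close>). So the quadratic form is
at most a constant times \<open>\<rho> powr (1 - 2 * H) * (min h (1 / \<rho>))\<^sup>2\<close> (\<open>wave_increment_bound\<close>). The integral of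
this against \<open>\<rho> powr (\<beta> - d)\<close> converges at 0 because \<open>2 * H - 1 < \<beta>\<close> and at infinity because
\<open>\<beta> < 2 * H + 1\<close>, and by homogeneity it is a multiple of \<open>h powr (2 * H + 1 - \<beta>)\<close>
(\<open>riesz_measure_increment_bound\<close>).

Two facts connect this computation with the solution. The solution is only known through elementary
approximations, so the estimate has to pass from the wave kernels to the approximating elementary
integrands; this needs a triangle inequality for the form, that is, its positive semidefiniteness
(\<open>kernel_form_nonneg\<close>), which holds because \<open>\<bar>x\<bar> powr p\<close> is a mixture of triangle functions and a
triangle function is the overlap of two translated intervals. And the variance of an elementary integral
is given by the noise in terms of \<open>f\<close>, not of its spectral measure. The two agree
(\<open>elementary_isometry\<close>) as soon as the double integral of \<open>f (x - y)\<close> over \<open>A \<times> B\<close> is the integral of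
\<open>\<F>1\<^sub>A\<close> times the conjugate of \<open>\<F>1\<^sub>B\<close> for bounded Borel sets
(\<open>fourier_energy_identity\<close>). Indicators are not Schwartz functions, so \<open>f\<close> is tested on translated
Gaussians, the result is averaged over the translations, and the width of the Gaussians is sent to 0.\<close>

section \<open>A Kolmogorov-Chentsov theorem under tail bounds\<close>

lemma geometric_increments_lim:
  fixes a :: "nat \<Rightarrow> real"
  assumes r: "0 \<le> r" "r < 1"
    and step: "\<And>n. n \<ge> N \<Longrightarrow> \<bar>a (Suc n) - a n\<bar> \<le> r ^ n"
  shows "a \<longlonglongrightarrow> lim a" and "\<And>n. n \<ge> N \<Longrightarrow> \<bar>lim a - a n\<bar> \<le> r ^ n / (1 - r)"
proof -
  have tele: "\<bar>a m - a n\<bar> \<le> (r ^ n - r ^ m) / (1 - r)" if "N \<le> n" "n \<le> m" for n m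
    using that(2)
  proof (induction m rule: dec_induct)
    case base
    then show ?case by simp
  next
    case (step m)
    have "\<bar>a (Suc m) - a n\<bar> \<le> \<bar>a (Suc m) - a m\<bar> + \<bar>a m - a n\<bar>" by linarith
    also have "\<dots> \<le> r ^ m + (r ^ n - r ^ m) / (1 - r)"
      using step assms(3)[of m] that(1) by (intro add_mono) auto
    also have "\<dots> = (r ^ n - r ^ Suc m) / (1 - r)"
      using r by (simp add: field_simps)
    finally show ?case .
  qed
  have bound: "\<bar>a m - a n\<bar> \<le> r ^ n / (1 - r)" if "N \<le> n" "n \<le> m" for n m
  proof -
    have "(r ^ n - r ^ m) / (1 - r) \<le> r ^ n / (1 - r)"
      using r by (intro divide_right_mono) auto
    then show ?thesis using tele[OF that] by linarith
  qed
  have to0: "(\<lambda>n. r ^ n / (1 - r)) \<longlonglongrightarrow> 0"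
    using r by (auto intro!: tendsto_divide_zero LIMSEQ_power_zero)
  have "Cauchy a"
  proof (rule metric_CauchyI)
    fix e :: real assume "0 < e"
    then have "\<forall>\<^sub>F n in sequentially. r ^ n / (1 - r) < e / 2"
      using order_tendstoD(2)[OF to0, of "e / 2"] by simp
    then obtain n0 where n0: "\<And>n. n \<ge> n0 \<Longrightarrow> r ^ n / (1 - r) < e / 2"
      by (auto simp: eventually_sequentially)
    define k where "k = max N n0"
    have "dist (a m) (a n) < e" if "m \<ge> k" "n \<ge> k" for m n
    proof -
      have "\<bar>a m - a k\<bar> < e / 2" "\<bar>a n - a k\<bar> < e / 2"
        using order.strict_trans1[OF bound[of k m] n0[of k]]
          order.strict_trans1[OF bound[of k n] n0[of k]] that by (simp_all add: k_def)
      then show ?thesis unfolding dist_real_def by linarith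
    qed
    then show "\<exists>M. \<forall>m\<ge>M. \<forall>n\<ge>M. dist (a m) (a n) < e" by blast
  qed
  then have "convergent a" by (simp add: Cauchy_convergent_iff)
  then show lim: "a \<longlonglongrightarrow> lim a" by (simp add: convergent_LIMSEQ_iff)
  fix n assume n: "n \<ge> N"
  have "(\<lambda>m. \<bar>a m - a n\<bar>) \<longlonglongrightarrow> \<bar>lim a - a n\<bar>"
    by (intro tendsto_intros lim)
  then show "\<bar>lim a - a n\<bar> \<le> r ^ n / (1 - r)"
    by (rule LIMSEQ_le_const2) (use bound n in blast)
qed

definition dyadic_index :: "real \<Rightarrow> nat \<Rightarrow> real \<Rightarrow> nat" where
  "dyadic_index T n t = nat \<lfloor>t / T * 2 ^ n\<rfloor>"

definition dyadic_point :: "real \<Rightarrow> nat \<Rightarrow> nat \<Rightarrow> real" where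
  "dyadic_point T n i = T * real i / 2 ^ n"

abbreviation dyadic_floor :: "real \<Rightarrow> nat \<Rightarrow> real \<Rightarrow> real" where
  "dyadic_floor T n t \<equiv> dyadic_point T n (dyadic_index T n t)"

lemma dyadic_index_bounds:
  assumes "0 < T" "t \<in> {0..T}"
  shows "real (dyadic_index T n t) \<le> t / T * 2 ^ n" "t / T * 2 ^ n < real (dyadic_index T n t) + 1"
proof -
  have "0 \<le> t / T * 2 ^ n" using assms by auto
  then have "real (dyadic_index T n t) = of_int \<lfloor>t / T * 2 ^ n\<rfloor>"
    unfolding dyadic_index_def by (metis of_int_of_nat_eq int_nat_eq zero_le_floor)
  then show "real (dyadic_index T n t) \<le> t / T * 2 ^ n" "t / T * 2 ^ n < real (dyadic_index T n t) + 1"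
    by linarith+
qed

lemma dyadic_index_le:
  assumes "0 < T" "t \<in> {0..T}"
  shows "dyadic_index T n t \<le> 2 ^ n"
proof -
  have "t / T * 2 ^ n \<le> 1 * 2 ^ n"
    using assms by (intro mult_right_mono) auto
  then have "real (dyadic_index T n t) \<le> 2 ^ n"
    using dyadic_index_bounds(1)[OF assms, of n] by linarith
  then show ?thesis by (metis of_nat_le_iff of_nat_numeral of_nat_power)
qed

lemma dyadic_point_in: "0 < T \<Longrightarrow> i \<le> 2 ^ n \<Longrightarrow> dyadic_point T n i \<in> {0..T}"
proof -
  assume "0 < T" "i \<le> 2 ^ n"
  then have "real i \<le> 2 ^ n" by (metis of_nat_le_iff of_nat_numeral of_nat_power)
  then show ?thesis using \<open>0 < T\<close> by (auto simp: dyadic_point_def field_simps)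
qed

lemma dyadic_floor_dist:
  assumes "0 < T" "t \<in> {0..T}"
  shows "\<bar>t - dyadic_floor T n t\<bar> \<le> T / 2 ^ n"
proof -
  have "dyadic_floor T n t \<le> t" "t \<le> dyadic_floor T n t + T / 2 ^ n"
    using dyadic_index_bounds[OF assms, of n] assms
    by (auto simp: dyadic_point_def field_simps)
  then show ?thesis by linarith
qed

lemma dyadic_point_refine: "dyadic_point T n i = dyadic_point T (Suc n) (2 * i)"
  by (simp add: dyadic_point_def)

text \<open>Two points at distance about \<open>T / 2 ^ n\<close> lie in the same cell of level \<open>n\<close> or in adjacent ones, so their values
differ by at most one increment of level \<open>n\<close> and two geometric tails of finer increments. Points too
far apart for level \<open>N\<close> are compared through the finitely many values on the grid of that level; they only
affect the constant.\<close>

lemma dyadic_increments_hoelder: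
  fixes g :: "real \<Rightarrow> real"
  assumes T: "0 < T" and \<delta>: "0 < \<delta>"
    and incr: "\<And>n i. n \<ge> N \<Longrightarrow> i < 2 ^ n \<Longrightarrow>
      \<bar>g (dyadic_point T n (Suc i)) - g (dyadic_point T n i)\<bar> \<le> (2 powr - \<delta>) ^ n"
  shows "hoelder_on \<delta> {0..T} (\<lambda>t. lim (\<lambda>n. g (dyadic_floor T n t)))"
    and "\<And>t. t \<in> {0..T} \<Longrightarrow> (\<lambda>n. g (dyadic_floor T n t)) \<longlonglongrightarrow> lim (\<lambda>n. g (dyadic_floor T n t))"
proof -
  define r where "r = 2 powr - \<delta>"
  define v where "v t = lim (\<lambda>n. g (dyadic_floor T n t))" for t
  have r: "0 < r" "r < 1"
    using \<delta> by (auto simp: r_def powr_less_one)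
  \<comment> \<open>rounding down at two successive levels gives equal or neighbouring points of the finer grid\<close>
  have step: "\<bar>g (dyadic_floor T (Suc n) t) - g (dyadic_floor T n t)\<bar> \<le> r ^ n"
    if t: "t \<in> {0..T}" and n: "n \<ge> N" for t n
  proof -
    let ?i = "dyadic_index T n t" and ?j = "dyadic_index T (Suc n) t"
    define y where "y = t / T * 2 ^ n"
    have "real ?j \<le> 2 * y" "2 * y < real ?j + 1"
      using dyadic_index_bounds[OF T t, of "Suc n"] by (auto simp: mult_ac y_def)
    moreover have "real ?i \<le> y" "y < real ?i + 1"
      using dyadic_index_bounds[OF T t, of n] by (auto simp: y_def)
    ultimately have "real ?j < 2 * real ?i + 2" "2 * real ?i < real ?j + 1"
      by linarith+
    then have "?j = 2 * ?i \<or> ?j = Suc (2 * ?i)" by linarith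
    then show ?thesis
    proof
      assume "?j = 2 * ?i"
      then show ?thesis using r by (simp add: dyadic_point_refine[of T n])
    next
      assume j: "?j = Suc (2 * ?i)"
      then have "2 * ?i < 2 ^ Suc n" using dyadic_index_le[OF T t, of "Suc n"] by linarith
      then have "\<bar>g (dyadic_floor T (Suc n) t) - g (dyadic_floor T n t)\<bar> \<le> r ^ Suc n"
        using incr[of "Suc n" "2 * ?i"] n j by (simp add: dyadic_point_refine[of T n] r_def)
      also have "\<dots> \<le> r ^ n" using r by (intro power_decreasing) auto
      finally show ?thesis .
    qed
  qed
  note lims = geometric_increments_lim[OF less_imp_le[OF r(1)] r(2) step]
  show "(\<lambda>n. g (dyadic_floor T n t)) \<longlonglongrightarrow> lim (\<lambda>n. g (dyadic_floor T n t))"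
    if "t \<in> {0..T}" for t
    by (rule lims(1)) (use that in auto)
  have near: "\<bar>v t - g (dyadic_floor T n t)\<bar> \<le> r ^ n / (1 - r)" if "t \<in> {0..T}" "n \<ge> N" for t n
    unfolding v_def by (rule lims(2)) (use that in auto)
  define c where "c = 2 / (1 - r) + 1"
  define B where "B = (\<Sum>i\<le>2 ^ N. \<bar>g (dyadic_point T N i)\<bar>)"
  define K where "K = max (c * (2 / T) powr \<delta>) ((2 / (1 - r) * r ^ N + 2 * B) * (2 ^ N / T) powr \<delta>)"
  have c: "c \<ge> 0" using r by (auto simp: c_def)
  have fine: "\<bar>v t - v s\<bar> \<le> c * r ^ n"
    if st: "s \<in> {0..T}" "t \<in> {0..T}" "s \<le> t" and n: "n \<ge> N" and ts: "t - s \<le> T / 2 ^ n" for s t n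
  proof -
    let ?i = "dyadic_index T n s" and ?j = "dyadic_index T n t"
    have "t / T * 2 ^ n - s / T * 2 ^ n \<le> 1" using ts T by (simp add: field_simps)
    then have "real ?j < real ?i + 2"
      using dyadic_index_bounds[OF T st(1), of n] dyadic_index_bounds[OF T st(2), of n] by linarith
    moreover have "s / T * 2 ^ n \<le> t / T * 2 ^ n"
      using st T by (intro mult_right_mono divide_right_mono) auto
    then have "real ?i < real ?j + 1"
      using dyadic_index_bounds[OF T st(1), of n] dyadic_index_bounds[OF T st(2), of n] by linarith
    ultimately have "?j = ?i \<or> ?j = Suc ?i" by linarith
    then have "\<bar>g (dyadic_floor T n t) - g (dyadic_floor T n s)\<bar> \<le> r ^ n"
    proof
      assume "?j = ?i"
      then show ?thesis using r by simp
    next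
      assume j: "?j = Suc ?i"
      then have "?i < 2 ^ n" using dyadic_index_le[OF T st(2), of n] by linarith
      then show ?thesis using incr[of n ?i] n j by (simp add: r_def)
    qed
    moreover have "\<bar>v t - v s\<bar> \<le> \<bar>v t - g (dyadic_floor T n t)\<bar> + \<bar>v s - g (dyadic_floor T n s)\<bar>
        + \<bar>g (dyadic_floor T n t) - g (dyadic_floor T n s)\<bar>" by linarith
    ultimately have "\<bar>v t - v s\<bar> \<le> r ^ n / (1 - r) + r ^ n / (1 - r) + r ^ n"
      using near[OF st(1) n] near[OF st(2) n] by linarith
    also have "\<dots> = c * r ^ n" by (simp add: c_def algebra_simps add_divide_distrib)
    finally show ?thesis .
  qed
  have main: "\<bar>v t - v s\<bar> \<le> K * (t - s) powr \<delta>"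
    if st: "s \<in> {0..T}" "t \<in> {0..T}" "s < t" for s t
  proof (cases "t - s \<le> T / 2 ^ N")
    case True
    have "(\<lambda>n. T / 2 ^ Suc n) \<longlonglongrightarrow> 0"
      by real_asymp
    then have "\<forall>\<^sub>F n in sequentially. T / 2 ^ Suc n < t - s"
      using st by (intro order_tendstoD(2)) auto
    then obtain n1 where "n1 \<ge> N" "T / 2 ^ Suc n1 < t - s"
      by (auto simp: eventually_sequentially) (meson le_cases order_trans)
    then have ex: "\<exists>n. n \<ge> N \<and> T / 2 ^ Suc n < t - s" by blast
    \<comment> \<open>the level with \<open>T / 2 ^ Suc n < t - s \<le> T / 2 ^ n\<close>\<close>
    define n where "n = (LEAST n. n \<ge> N \<and> T / 2 ^ Suc n < t - s)"
    have n: "n \<ge> N" "T / 2 ^ Suc n < t - s"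
      using LeastI_ex[OF ex] by (auto simp: n_def)
    have ts: "t - s \<le> T / 2 ^ n"
    proof (cases "n = N")
      case False
      then obtain k where k: "n = Suc k" "k \<ge> N" using n(1) by (cases n) auto
      then show ?thesis
        using not_less_Least[of k "\<lambda>n. n \<ge> N \<and> T / 2 ^ Suc n < t - s"] by (auto simp: n_def)
    qed (use True in simp)
    have "1 / 2 ^ n = 2 powr (- real n)"
      by (simp add: powr_minus_divide powr_realpow)
    then have "r ^ n = (1 / 2 ^ n) powr \<delta>"
      by (simp add: r_def powr_powr powr_power mult_ac)
    also have "\<dots> \<le> (2 / T * (t - s)) powr \<delta>"
      using n(2) T \<delta> by (intro powr_mono2) (auto simp: field_simps)
    also have "\<dots> = (2 / T) powr \<delta> * (t - s) powr \<delta>"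
      using T st by (intro powr_mult) 
    finally have "c * r ^ n \<le> c * ((2 / T) powr \<delta> * (t - s) powr \<delta>)"
      using c by (intro mult_left_mono)
    also have "\<dots> \<le> K * (t - s) powr \<delta>"
      by (auto simp: K_def mult.assoc[symmetric] intro!: mult_right_mono)
    finally show ?thesis
      using fine[OF st(1,2) _ n(1) ts] st by linarith
  next
    case False
    have gB: "\<bar>g (dyadic_floor T N t)\<bar> \<le> B" if "t \<in> {0..T}" for t
      unfolding B_def using dyadic_index_le[OF T that, of N]
      by (intro member_le_sum[where f = "\<lambda>i. \<bar>g (dyadic_point T N i)\<bar>"]) auto
    have "1 = 1 powr \<delta>" by simp
    also have "\<dots> \<le> (2 ^ N / T * (t - s)) powr \<delta>"
      using False T \<delta> by (intro powr_mono2) (auto simp: field_simps)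
    also have "\<dots> = (2 ^ N / T) powr \<delta> * (t - s) powr \<delta>"
      using T st by (intro powr_mult) 
    finally have one: "1 \<le> (2 ^ N / T) powr \<delta> * (t - s) powr \<delta>" .
    have B0: "0 \<le> B" by (auto simp: B_def intro: sum_nonneg)
    have "\<bar>v t - v s\<bar> \<le> 2 / (1 - r) * r ^ N + 2 * B"
      using near[OF st(1), of N] near[OF st(2), of N] gB[OF st(1)] gB[OF st(2)] by simp
    also have "\<dots> = (2 / (1 - r) * r ^ N + 2 * B) * 1" by simp
    also have "\<dots> \<le> (2 / (1 - r) * r ^ N + 2 * B) * ((2 ^ N / T) powr \<delta> * (t - s) powr \<delta>)"
      using one r B0 by (intro mult_left_mono) auto
    also have "\<dots> \<le> K * (t - s) powr \<delta>"
      by (auto simp: K_def mult.assoc[symmetric] intro!: mult_right_mono)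
    finally show ?thesis .
  qed
  have "\<bar>v t - v s\<bar> \<le> K * \<bar>t - s\<bar> powr \<delta>" if "s \<in> {0..T}" "t \<in> {0..T}" for s t
  proof -
    consider "s < t" | "t < s" | "s = t" by linarith
    then show ?thesis
      using main[of s t] main[of t s] that by cases (auto simp: abs_minus_commute)
  qed
  then show "hoelder_on \<delta> {0..T} (\<lambda>t. lim (\<lambda>n. g (dyadic_floor T n t)))"
    unfolding hoelder_on_def v_def by blast
qed

text \<open>Of the \<open>2 ^ n\<close> increments over the cells of level \<open>n\<close>, the probability that one exceeds \<open>2 powr (- \<delta> * n)\<close> is of order
\<open>2 powr (n * (1 + p * \<delta> - q))\<close>, which is summable; by Borel-Cantelli almost every path satisfies the
hypothesis of the preceding lemma from some random level on. The modification is the limit along the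
dyadic points below \<open>t\<close>, and a second use of Borel-Cantelli, for the pairs formed by \<open>t\<close> and these points, identifies it
with \<open>u t\<close>. The hypothesis bounds tail probabilities and not moments because such bounds survive
limits in probability.\<close>

theorem kolmogorov_chentsov_weak_type:
  fixes u :: "real \<Rightarrow> 'w \<Rightarrow> real"
  assumes "prob_space M" and T: "0 < T" and \<delta>: "0 < \<delta>" and C: "0 \<le> C" and p: "0 < p"
    and q: "1 + p * \<delta> < q"
    and meas: "\<And>t. t \<in> {0..T} \<Longrightarrow> u t \<in> borel_measurable M"
    and tail: "\<And>s t e. s \<in> {0..T} \<Longrightarrow> t \<in> {0..T} \<Longrightarrow> 0 < e \<Longrightarrow>
      measure M {\<omega> \<in> space M. e \<le> \<bar>u t \<omega> - u s \<omega>\<bar>} \<le> C * \<bar>t - s\<bar> powr q / e powr p"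
  shows "\<exists>v. is_modification M {0..T} v u \<and> (AE \<omega> in M. hoelder_on \<delta> {0..T} (\<lambda>t. v t \<omega>))"
proof -
  interpret prob_space M by fact
  define r where "r = 2 powr - \<delta>"
  \<comment> \<open>the tail bound for a pair at distance \<open>T / 2 ^ n\<close> is a multiple of \<open>\<theta> ^ n\<close>, and a level has \<open>2 ^ n\<close> such pairs\<close>
  define \<theta> where "\<theta> = 2 powr (p * \<delta> - q)"
  have r: "0 < r" "r < 1"
    using \<delta> by (auto simp: r_def powr_less_one)
  have \<theta>: "0 < \<theta>" "2 * \<theta> < 1"
  proof -
    have "2 * \<theta> = 2 powr (1 + (p * \<delta> - q))" by (subst powr_add) (simp add: \<theta>_def)
    also have "\<dots> < 1" using q by (intro powr_less_one) auto
    finally show "2 * \<theta> < 1" .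
  qed (simp add: \<theta>_def)
  have scale: "C * (T / 2 ^ n) powr q / (r ^ n) powr p = C * T powr q * \<theta> ^ n" for n
  proof -
    have "(2 ^ n) powr q = 2 powr (real n * q)"
      by (simp add: powr_powr powr_realpow[symmetric])
    moreover have "(T / 2 ^ n) powr q = T powr q / (2 ^ n) powr q"
      using T by (intro powr_divide)
    ultimately have "(T / 2 ^ n) powr q = T powr q * 2 powr (- (real n * q))"
      by (simp add: powr_minus_divide)
    moreover have "(r ^ n) powr p = 2 powr (- (real n * \<delta> * p))"
      by (simp add: r_def powr_powr powr_power mult_ac)
    ultimately have "(T / 2 ^ n) powr q / (r ^ n) powr p =
        T powr q * (2 powr (- (real n * q)) * 2 powr (real n * \<delta> * p))"
      by (simp add: powr_minus divide_inverse)
    also have "2 powr (- (real n * q)) * 2 powr (real n * \<delta> * p) = \<theta> ^ n"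
      by (simp add: \<theta>_def powr_add[symmetric] powr_realpow[symmetric] powr_powr algebra_simps)
    finally show ?thesis by (simp only: times_divide_eq_right[symmetric] mult.assoc)
  qed
  define E where "E s t n = {\<omega> \<in> space M. r ^ n \<le> \<bar>u t \<omega> - u s \<omega>\<bar>}" for s t n
  have E_meas[measurable]: "E s t n \<in> sets M" if "s \<in> {0..T}" "t \<in> {0..T}" for s t n
    unfolding E_def using meas[OF that(1)] meas[OF that(2)] by measurable
  have E_le: "measure M (E s t n) \<le> C * T powr q * \<theta> ^ n"
    if st: "s \<in> {0..T}" "t \<in> {0..T}" "\<bar>t - s\<bar> \<le> T / 2 ^ n" for s t n
  proof -
    have "measure M (E s t n) \<le> C * \<bar>t - s\<bar> powr q / (r ^ n) powr p"
      unfolding E_def using st r by (intro tail) auto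
    also have "\<dots> \<le> C * (T / 2 ^ n) powr q / (r ^ n) powr p"
    proof (intro divide_right_mono mult_left_mono powr_mono2)
      show "0 \<le> q" using q mult_pos_pos[OF p \<delta>] by linarith
    qed (use st C in auto)
    finally show ?thesis by (simp add: scale)
  qed
  define A where "A n = (\<Union>i<2 ^ n. E (dyadic_point T n i) (dyadic_point T n (Suc i)) n)" for n
  have A_meas: "A n \<in> sets M" for n
    unfolding A_def using T by (auto intro!: sets.finite_UN E_meas dyadic_point_in)
  have A_le: "measure M (A n) \<le> C * T powr q * (2 * \<theta>) ^ n" for n
  proof -
    have "measure M (A n) \<le> (\<Sum>i<2 ^ n. measure M (E (dyadic_point T n i) (dyadic_point T n (Suc i)) n))"
      unfolding A_def using T
      by (intro finite_measure_subadditive_finite) (auto intro!: E_meas dyadic_point_in)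
    also have "\<dots> \<le> (\<Sum>i<(2::nat) ^ n. C * T powr q * \<theta> ^ n)"
      using T by (intro sum_mono E_le dyadic_point_in)
        (auto simp: dyadic_point_def field_simps)
    also have "\<dots> = C * T powr q * (2 * \<theta>) ^ n"
      by (simp add: power_mult_distrib mult_ac)
    finally show ?thesis .
  qed
  have "AE \<omega> in M. \<forall>\<^sub>F n in sequentially. \<omega> \<in> space M - A n"
  proof (rule borel_cantelli_AE1)
    have "summable (\<lambda>n. C * T powr q * (2 * \<theta>) ^ n)"
      using \<theta> by (intro summable_mult summable_geometric) auto
    then show "summable (\<lambda>n. measure M (A n))"
      by (rule summable_comparison_test[rotated]) (use A_le in auto)
  qed (auto simp: A_meas emeasure_eq_measure)
  then have AE_reg: "AE \<omega> in M. \<exists>N. \<forall>n\<ge>N. \<forall>i<2 ^ n.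
      \<bar>u (dyadic_point T n (Suc i)) \<omega> - u (dyadic_point T n i) \<omega>\<bar> \<le> r ^ n"
  proof eventually_elim
    case (elim \<omega>)
    then obtain N where "\<And>n. n \<ge> N \<Longrightarrow> \<omega> \<in> space M - A n"
      by (auto simp: eventually_sequentially)
    then show ?case by (intro exI[of _ N]) (force simp: A_def E_def)
  qed
  define v where "v t \<omega> = lim (\<lambda>n. u (dyadic_floor T n t) \<omega>)" for t \<omega>
  have v_meas: "v t \<in> borel_measurable M" if "t \<in> {0..T}" for t
    unfolding v_def using that T
    by (intro borel_measurable_lim_metric meas dyadic_point_in dyadic_index_le) auto
  have v_eq: "AE \<omega> in M. v t \<omega> = u t \<omega>" if t: "t \<in> {0..T}" for t
  proof -
    have df: "dyadic_floor T n t \<in> {0..T}" for n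
      using T t by (intro dyadic_point_in dyadic_index_le) auto
    have "AE \<omega> in M. \<forall>\<^sub>F n in sequentially. \<omega> \<in> space M - E (dyadic_floor T n t) t n"
    proof (rule borel_cantelli_AE1)
      show "E (dyadic_floor T n t) t n \<in> sets M" for n
        using df t by (rule E_meas)
      have "measure M (E (dyadic_floor T n t) t n) \<le> C * T powr q * \<theta> ^ n" for n
        using df t dyadic_floor_dist[OF T t, of n] by (intro E_le)
      moreover have "summable (\<lambda>n. C * T powr q * \<theta> ^ n)"
        using \<theta> by (intro summable_mult summable_geometric) auto
      ultimately show "summable (\<lambda>n. measure M (E (dyadic_floor T n t) t n))"
        by (intro summable_comparison_test[of "\<lambda>n. measure M (E (dyadic_floor T n t) t n)"] exI[of _ 0] allI impI)
          (simp_all del: summable_cmult_iff)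
    qed (auto simp: emeasure_eq_measure)
    then show ?thesis
    proof eventually_elim
      case (elim \<omega>)
      have "(\<lambda>n. u (dyadic_floor T n t) \<omega> - u t \<omega>) \<longlonglongrightarrow> 0"
      proof (rule tendsto_rabs_zero_cancel, rule tendsto_sandwich[of "\<lambda>_. 0" _ _ "\<lambda>n. r ^ n"])
        show "\<forall>\<^sub>F n in sequentially. \<bar>u (dyadic_floor T n t) \<omega> - u t \<omega>\<bar> \<le> r ^ n"
          using elim by eventually_elim (auto simp: E_def abs_minus_commute)
      qed (use r in \<open>auto intro!: LIMSEQ_power_zero\<close>)
      then have "(\<lambda>n. u (dyadic_floor T n t) \<omega>) \<longlonglongrightarrow> u t \<omega>"
        by (simp add: LIM_zero_iff)
      then show ?case unfolding v_def by (rule limI)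
    qed
  qed
  have "AE \<omega> in M. hoelder_on \<delta> {0..T} (\<lambda>t. v t \<omega>)"
    using AE_reg
  proof eventually_elim
    case (elim \<omega>)
    then obtain N where N: "\<forall>n\<ge>N. \<forall>i<2 ^ n.
        \<bar>u (dyadic_point T n (Suc i)) \<omega> - u (dyadic_point T n i) \<omega>\<bar> \<le> (2 powr - \<delta>) ^ n"
      unfolding r_def by blast
    show ?case unfolding v_def
      by (rule dyadic_increments_hoelder(1)[OF T \<delta>, of N "\<lambda>t. u t \<omega>"]) (use N in auto)
  qed
  then show ?thesis
    using v_meas v_eq by (intro exI[of _ v]) (simp add: is_modification_def)
qed

section \<open>The singular kernel and its bilinear form\<close>

lemma (in pair_sigma_finite) integrable_pair_mult:
  fixes f :: "'a \<Rightarrow> 'c::{real_normed_field, banach, second_countable_topology}" and g :: "'b \<Rightarrow> 'c"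
  assumes f: "integrable M1 f" and g: "integrable M2 g"
  shows "integrable (M1 \<Otimes>\<^sub>M M2) (\<lambda>(x, y). f x * g y)"
proof (rule Fubini_integrable)
  note [measurable] = borel_measurable_integrable[OF f] borel_measurable_integrable[OF g]
  show "(\<lambda>(x, y). f x * g y) \<in> borel_measurable (M1 \<Otimes>\<^sub>M M2)" by measurable
  show "integrable M1 (\<lambda>x. LINT y|M2. norm (case (x, y) of (x, y) \<Rightarrow> f x * g y))"
    using f by (simp add: norm_mult)
  show "AE x in M1. integrable M2 (\<lambda>y. case (x, y) of (x, y) \<Rightarrow> f x * g y)"
    using g by simp
qed

text \<open>The odd primitive of \<open>\<bar>x\<bar> powr p\<close>, for \<open>p > - 1\<close>. The two truncations make it visibly continuous at the
singularity 0.\<close>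

definition abs_powr_primitive :: "real \<Rightarrow> real \<Rightarrow> real" where
  "abs_powr_primitive p x = (max x 0 powr (p + 1) - max (- x) 0 powr (p + 1)) / (p + 1)"

lemma abs_powr_primitive_minus [simp]: "abs_powr_primitive p (- x) = - abs_powr_primitive p x"
  by (simp add: abs_powr_primitive_def diff_divide_distrib)

lemma abs_powr_primitive_nonneg_arg: "0 \<le> x \<Longrightarrow> abs_powr_primitive p x = x powr (p + 1) / (p + 1)"
  by (simp add: abs_powr_primitive_def max_def)

lemma continuous_abs_powr_primitive:
  assumes "-1 < p"
  shows "continuous_on A (abs_powr_primitive p)"
proof -
  have "continuous_on A (\<lambda>x. (max x 0 powr (p + 1) - max (- x) 0 powr (p + 1)) / (p + 1))"
    using assms by (intro continuous_intros continuous_on_powr') auto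
  then show ?thesis unfolding abs_powr_primitive_def[abs_def] .
qed

lemma abs_powr_primitive_deriv:
  assumes "-1 < p" "x \<noteq> 0"
  shows "(abs_powr_primitive p has_real_derivative \<bar>x\<bar> powr p) (at x)"
proof -
  consider "x > 0" | "x < 0" using assms by linarith
  then show ?thesis
  proof cases
    case 1
    have "((\<lambda>x. x powr (p + 1) / (p + 1)) has_real_derivative \<bar>x\<bar> powr p) (at x)"
      using 1 assms by (auto intro!: derivative_eq_intros)
    then show ?thesis
      by (rule has_field_derivative_transform_within_open[of _ _ _ "{0<..}"])
        (use 1 in \<open>auto simp: abs_powr_primitive_nonneg_arg\<close>)
  next
    case 2
    have "((\<lambda>x. - ((- x) powr (p + 1) / (p + 1))) has_real_derivative \<bar>x\<bar> powr p) (at x)"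
      using 2 assms by (auto intro!: derivative_eq_intros)
    then show ?thesis
      by (rule has_field_derivative_transform_within_open[of _ _ _ "{..<0}"])
        (use 2 in \<open>auto simp: abs_powr_primitive_def max_def\<close>)
  qed
qed

lemma has_integral_abs_powr:
  assumes "-1 < p" "a \<le> b"
  shows "((\<lambda>r. \<bar>r - v\<bar> powr p) has_integral
    abs_powr_primitive p (b - v) - abs_powr_primitive p (a - v)) {a..b}"
proof (rule fundamental_theorem_of_calculus_interior_strong[of "{v}"])
  show "continuous_on {a..b} (\<lambda>r. abs_powr_primitive p (r - v))"
    by (intro continuous_on_compose2[OF continuous_abs_powr_primitive[OF assms(1), of UNIV]]
        continuous_intros) auto
  fix r assume r: "r \<in> {a<..<b} - {v}"
  have "((\<lambda>r. abs_powr_primitive p (r - v)) has_real_derivative \<bar>r - v\<bar> powr p) (at r)"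
    using DERIV_chain'[OF DERIV_diff[OF DERIV_ident DERIV_const] abs_powr_primitive_deriv[OF assms(1), of "r - v"]] r
    by simp
  then show "((\<lambda>r. abs_powr_primitive p (r - v)) has_vector_derivative \<bar>r - v\<bar> powr p) (at r)"
    by (simp add: has_real_derivative_iff_has_vector_derivative)
qed (use assms in auto)

lemma
  assumes "-1 < p" "a \<le> b"
  shows nn_integral_abs_powr: "(\<integral>\<^sup>+r. ennreal (indicator {a..b} r * \<bar>r - v\<bar> powr p) \<partial>lborel) =
      ennreal (abs_powr_primitive p (b - v) - abs_powr_primitive p (a - v))"
    and set_integrable_abs_powr: "set_integrable lborel {a..b} (\<lambda>r. \<bar>r - v\<bar> powr p)"
    and set_integral_abs_powr: "(LINT r:{a..b}|lborel. \<bar>r - v\<bar> powr p) =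
      abs_powr_primitive p (b - v) - abs_powr_primitive p (a - v)"
proof -
  have eq: "(\<lambda>r. indicator {a..b} r * \<bar>r - v\<bar> powr p) = (\<lambda>r. if r \<in> {a..b} then \<bar>r - v\<bar> powr p else 0)"
    by (auto simp: indicator_def)
  show nn: "(\<integral>\<^sup>+r. ennreal (indicator {a..b} r * \<bar>r - v\<bar> powr p) \<partial>lborel) =
      ennreal (abs_powr_primitive p (b - v) - abs_powr_primitive p (a - v))"
  proof (rule nn_integral_has_integral_lborel)
    show "((\<lambda>r. indicator {a..b} r * \<bar>r - v\<bar> powr p) has_integral
        abs_powr_primitive p (b - v) - abs_powr_primitive p (a - v)) UNIV"
      unfolding eq has_integral_restrict_UNIV by (rule has_integral_abs_powr[OF assms])
  qed auto
  have nonneg: "0 \<le> abs_powr_primitive p (b - v) - abs_powr_primitive p (a - v)"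
    by (rule has_integral_nonneg[OF has_integral_abs_powr[OF assms, of v]]) auto
  have "has_bochner_integral lborel (\<lambda>r. indicator {a..b} r * \<bar>r - v\<bar> powr p)
      (abs_powr_primitive p (b - v) - abs_powr_primitive p (a - v))"
    by (rule has_bochner_integral_nn_integral) (use nn nonneg in auto)
  then show "set_integrable lborel {a..b} (\<lambda>r. \<bar>r - v\<bar> powr p)"
    and "(LINT r:{a..b}|lborel. \<bar>r - v\<bar> powr p) =
      abs_powr_primitive p (b - v) - abs_powr_primitive p (a - v)"
    by (auto simp: set_integrable_def set_lebesgue_integral_def has_bochner_integral_iff)
qed

text \<open>The covariance of fractional Brownian motion is a double primitive of the kernel: integrating
\<open>\<bar>r - v\<bar> powr (2 * H - 2)\<close> twice gives second differences of \<open>\<bar>x\<bar> powr (2 * H)\<close>, with the factor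
\<open>H * (2 * H - 1)\<close> absorbing the exponents.\<close>

lemma fbm_cov_integral:
  assumes H: "1 / 2 < H" and "0 \<le> t" "0 \<le> s"
  shows "H * (2 * H - 1) * (LINT v:{0..s}|lborel. LINT r:{0..t}|lborel. \<bar>r - v\<bar> powr (2 * H - 2)) =
    fbm_cov H t s"
proof -
  define p where "p = 2 * H - 2"
  have p: "-1 < p" "p + 2 = 2 * H" "p + 1 = 2 * H - 1" using H by (auto simp: p_def)
  \<comment> \<open>a primitive in \<open>v\<close> of the inner integral; it is differentiable except perhaps at 0 and \<open>t\<close>\<close>
  define F where "F v = (\<bar>v\<bar> powr (p + 2) - \<bar>v - t\<bar> powr (p + 2)) / ((p + 1) * (p + 2))" for v
  have der: "((\<lambda>v. \<bar>v\<bar> powr (p + 2) / ((p + 1) * (p + 2))) has_real_derivative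
      abs_powr_primitive p v) (at v)" if v0: "v \<noteq> 0" for v
  proof -
    consider "v > 0" | "v < 0" using v0 by linarith
    then show ?thesis
    proof cases
      case 1
      have "((\<lambda>x. x powr (p + 2) / ((p + 1) * (p + 2))) has_real_derivative abs_powr_primitive p v) (at v)"
        using 1 p(1) by (auto intro!: derivative_eq_intros simp: abs_powr_primitive_nonneg_arg add.commute)
      then show ?thesis
        by (rule has_field_derivative_transform_within_open[of _ _ _ "{0<..}"]) (use 1 in auto)
    next
      case 2
      have "((\<lambda>x. (- x) powr (p + 2) / ((p + 1) * (p + 2))) has_real_derivative abs_powr_primitive p v) (at v)"
        using 2 p(1) by (auto intro!: derivative_eq_intros simp: abs_powr_primitive_def max_def add.commute)
      then show ?thesis
        by (rule has_field_derivative_transform_within_open[of _ _ _ "{..<0}"]) (use 2 in auto)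
    qed
  qed
  have hi: "((\<lambda>v. abs_powr_primitive p (t - v) - abs_powr_primitive p (0 - v)) has_integral F s - F 0) {0..s}"
  proof (rule fundamental_theorem_of_calculus_interior_strong[of "{0, t}"])
    show "continuous_on {0..s} F"
      unfolding F_def[abs_def] using p(1) by (intro continuous_intros continuous_on_powr') auto
    fix v assume v: "v \<in> {0<..<s} - {0, t}"
    have "((\<lambda>v. \<bar>v - t\<bar> powr (p + 2) / ((p + 1) * (p + 2))) has_real_derivative
      abs_powr_primitive p (v - t)) (at v)"
      using DERIV_chain'[OF DERIV_diff[OF DERIV_ident DERIV_const] der[of "v - t"]] v by simp
    then have "(F has_real_derivative (abs_powr_primitive p v - abs_powr_primitive p (v - t))) (at v)"
      unfolding F_def[abs_def] diff_divide_distrib using v by (intro DERIV_diff der) auto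
    moreover have "abs_powr_primitive p (t - v) = - abs_powr_primitive p (v - t)"
      using abs_powr_primitive_minus[of p "v - t"] by simp
    ultimately show "(F has_vector_derivative abs_powr_primitive p (t - v) - abs_powr_primitive p (0 - v)) (at v)"
      by (simp add: has_real_derivative_iff_has_vector_derivative)
  qed (use assms in auto)
  have "set_integrable lborel {0..s} (\<lambda>v. abs_powr_primitive p (t - v) - abs_powr_primitive p (0 - v))"
    using p(1) by (intro borel_integrable_atLeastAtMost' continuous_intros
        continuous_on_compose2[OF continuous_abs_powr_primitive[of p UNIV]]) auto
  then have "(LINT v:{0..s}|lborel. abs_powr_primitive p (t - v) - abs_powr_primitive p (0 - v)) = F s - F 0"
    using hi by (simp add: set_borel_integral_eq_integral integral_unique)
  then have "(LINT v:{0..s}|lborel. LINT r:{0..t}|lborel. \<bar>r - v\<bar> powr p) = F s - F 0"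
    using p(1) assms by (simp add: set_integral_abs_powr)
  also have "F s - F 0 = (s powr (2 * H) + t powr (2 * H) - \<bar>t - s\<bar> powr (2 * H)) / ((2 * H - 1) * (2 * H))"
    using assms(2,3) by (simp add: F_def p(2,3) abs_minus_commute[of s t] diff_divide_distrib add_divide_distrib)
  finally have *: "(LINT v:{0..s}|lborel. LINT r:{0..t}|lborel. \<bar>r - v\<bar> powr p) =
    (s powr (2 * H) + t powr (2 * H) - \<bar>t - s\<bar> powr (2 * H)) / ((2 * H - 1) * (2 * H))" .
  have "H * (2 * H - 1) * (X / ((2 * H - 1) * (2 * H))) = X / 2" for X
    using H by (simp add: field_simps)
  then show ?thesis
    unfolding p_def[symmetric] * fbm_cov_def by (simp only: add.commute)
qed

text \<open>With \<open>p = 2 * H - 2\<close> this is the density of the inner product of the noise space at a fixed frequency.\<close>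

definition kernel_form :: "real \<Rightarrow> (real \<Rightarrow> complex) \<Rightarrow> (real \<Rightarrow> complex) \<Rightarrow> complex" where
  "kernel_form p g h = (LINT v:{0..}|lborel. (LINT r:{0..}|lborel.
     g r * cnj (h v) * of_real (\<bar>r - v\<bar> powr p)))"

text \<open>Only the values on the half-line matter, since the form does not see the others.\<close>

definition bounded_supp :: "(real \<Rightarrow> complex) \<Rightarrow> bool" where
  "bounded_supp g \<longleftrightarrow> g \<in> borel_measurable borel \<and>
     (\<exists>B M. \<forall>r\<ge>0. norm (g r) \<le> B * indicator {0..M} r)"

lemma bounded_suppI:
  "g \<in> borel_measurable borel \<Longrightarrow> (\<And>r. 0 \<le> r \<Longrightarrow> norm (g r) \<le> B * indicator {0..M} r) \<Longrightarrow> bounded_supp g"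
  unfolding bounded_supp_def by blast

lemma bounded_suppE:
  assumes "bounded_supp g"
  obtains B M where "0 \<le> B" "0 \<le> M" "\<And>r. 0 \<le> r \<Longrightarrow> norm (g r) \<le> B * indicator {0..M} r"
proof -
  obtain B M where BM: "\<And>r. 0 \<le> r \<Longrightarrow> norm (g r) \<le> B * indicator {0..M} r"
    using assms unfolding bounded_supp_def by blast
  have "norm (g r) \<le> \<bar>B\<bar> * indicator {0..\<bar>M\<bar>} r" if "0 \<le> r" for r
    using BM[OF that] by (cases "r \<le> M") (auto simp: that)
  then show ?thesis by (intro that[of "\<bar>B\<bar>" "\<bar>M\<bar>"]) auto
qed

lemma bounded_supp_measurable [measurable_dest]: "bounded_supp g \<Longrightarrow> g \<in> borel_measurable borel"
  by (simp add: bounded_supp_def)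

lemma bounded_supp_0 [simp, intro]: "bounded_supp (\<lambda>_. 0)"
  by (rule bounded_suppI[of _ 0 0]) auto

lemma bounded_supp_scale [intro]:
  assumes "bounded_supp g"
  shows "bounded_supp (\<lambda>r. c * g r)"
proof -
  obtain B M where "\<And>r. 0 \<le> r \<Longrightarrow> norm (g r) \<le> B * indicator {0..M} r"
    using bounded_suppE[OF assms] by metis
  then show ?thesis
    using assms by (intro bounded_suppI[of _ "norm c * B" M])
      (auto simp: norm_mult mult.assoc intro!: mult_left_mono bounded_supp_measurable)
qed

lemma bounded_supp_add [intro]:
  assumes "bounded_supp g" "bounded_supp h"
  shows "bounded_supp (\<lambda>r. g r + h r)"
proof -
  obtain B M where g: "0 \<le> B" "\<And>r. 0 \<le> r \<Longrightarrow> norm (g r) \<le> B * indicator {0..M} r"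
    using bounded_suppE[OF assms(1)] by metis
  obtain B' M' where h: "0 \<le> B'" "\<And>r. 0 \<le> r \<Longrightarrow> norm (h r) \<le> B' * indicator {0..M'} r"
    using bounded_suppE[OF assms(2)] by metis
  have "norm (g r + h r) \<le> (B + B') * indicator {0..max M M'} r" if "0 \<le> r" for r
  proof -
    have "norm (g r + h r) \<le> B * indicator {0..M} r + B' * indicator {0..M'} r"
      using g(2)[OF that] h(2)[OF that] norm_triangle_ineq[of "g r" "h r"] by linarith
    also have "\<dots> \<le> (B + B') * indicator {0..max M M'} r"
      using g(1) h(1) by (auto simp: indicator_def)
    finally show ?thesis .
  qed
  then show ?thesis
    using bounded_supp_measurable[OF assms(1)] bounded_supp_measurable[OF assms(2)]
    by (intro bounded_suppI[of _ "B + B'" "max M M'"]) auto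
qed

lemma bounded_supp_diff [intro]:
  assumes "bounded_supp g" "bounded_supp h"
  shows "bounded_supp (\<lambda>r. g r - h r)"
  using bounded_supp_add[OF assms(1) bounded_supp_scale[OF assms(2), of "-1"]] by simp

lemma bounded_supp_indicator [intro]: "bounded_supp (indicator {0..t})"
  by (rule bounded_suppI[of _ 1 t]) (auto simp: indicator_def)

text \<open>The integrand of the form on the product space. It is absolutely integrable there, so that the form
inherits linearity from the product integral.\<close>

definition pair_kernel :: "real \<Rightarrow> (real \<Rightarrow> complex) \<Rightarrow> (real \<Rightarrow> complex) \<Rightarrow> real \<times> real \<Rightarrow> complex" where
  "pair_kernel p g h = (\<lambda>(v, r). indicator {0..} v *\<^sub>R indicator {0..} r *\<^sub>R
     (g r * cnj (h v) * of_real (\<bar>r - v\<bar> powr p)))"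

lemma pair_kernel_measurable [measurable]:
  "bounded_supp g \<Longrightarrow> bounded_supp h \<Longrightarrow> pair_kernel p g h \<in> borel_measurable (lborel \<Otimes>\<^sub>M lborel)"
proof -
  assume "bounded_supp g" "bounded_supp h"
  then have [measurable]: "g \<in> borel_measurable borel" "h \<in> borel_measurable borel"
    by (simp_all add: bounded_supp_def)
  have [measurable]: "cnj \<in> borel_measurable borel"
    by (intro borel_measurable_continuous_onI continuous_intros)
  show ?thesis unfolding pair_kernel_def by measurable
qed

lemma nn_integral_square_abs_powr:
  assumes "-1 < p" "0 \<le> M"
  shows "(\<integral>\<^sup>+v. \<integral>\<^sup>+r. ennreal (indicator {0..M} v * (indicator {0..M} r * \<bar>r - v\<bar> powr p)) \<partial>lborel \<partial>lborel) < \<infinity>"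
proof -
  have "(\<integral>\<^sup>+r. ennreal (indicator {0..M} v * (indicator {0..M} r * \<bar>r - v\<bar> powr p)) \<partial>lborel)
      \<le> ennreal (2 * M powr (p + 1) / (p + 1)) * indicator {0..M} v" for v
  proof (cases "v \<in> {0..M}")
    case True
    have "(\<integral>\<^sup>+r. ennreal (indicator {0..M} v * (indicator {0..M} r * \<bar>r - v\<bar> powr p)) \<partial>lborel)
        = ennreal (abs_powr_primitive p (M - v) - abs_powr_primitive p (0 - v))"
      using True nn_integral_abs_powr[OF assms, of v] by simp
    also have "abs_powr_primitive p (M - v) - abs_powr_primitive p (0 - v) =
        ((M - v) powr (p + 1) + v powr (p + 1)) / (p + 1)"
      using True by (simp add: abs_powr_primitive_nonneg_arg add_divide_distrib)
    also have "\<dots> \<le> 2 * M powr (p + 1) / (p + 1)"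
    proof (intro divide_right_mono)
      have "(M - v) powr (p + 1) \<le> M powr (p + 1)" "v powr (p + 1) \<le> M powr (p + 1)"
        using True assms by (auto intro!: powr_mono2)
      then show "(M - v) powr (p + 1) + v powr (p + 1) \<le> 2 * M powr (p + 1)" by linarith
    qed (use assms in auto)
    finally show ?thesis using True by (simp add: ennreal_leI)
  qed auto
  then have "(\<integral>\<^sup>+v. \<integral>\<^sup>+r. ennreal (indicator {0..M} v * (indicator {0..M} r * \<bar>r - v\<bar> powr p)) \<partial>lborel \<partial>lborel)
      \<le> (\<integral>\<^sup>+v. ennreal (2 * M powr (p + 1) / (p + 1)) * indicator {0..M} v \<partial>lborel)"
    by (rule nn_integral_mono)
  also have "\<dots> < \<infinity>"
    using assms by (simp add: nn_integral_cmult_indicator ennreal_mult_less_top)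
  finally show ?thesis .
qed

lemma pair_kernel_integrable:
  assumes p: "-1 < p" and g: "bounded_supp g" and h: "bounded_supp h"
  shows "integrable (lborel \<Otimes>\<^sub>M lborel) (pair_kernel p g h)"
proof -
  obtain B M where B: "0 \<le> B" "0 \<le> M" "\<And>r. 0 \<le> r \<Longrightarrow> norm (g r) \<le> B * indicator {0..M} r"
    using bounded_suppE[OF g] by metis
  obtain B' M' where B': "0 \<le> B'" "0 \<le> M'" "\<And>r. 0 \<le> r \<Longrightarrow> norm (h r) \<le> B' * indicator {0..M'} r"
    using bounded_suppE[OF h] by metis
  define N where "N = max M M'"
  define D where "D = (\<lambda>(v, r). B * B' * (indicator {0..N} v * (indicator {0..N} r * \<bar>r - v\<bar> powr p)) :: real)"
  define D0 :: "real \<times> real \<Rightarrow> real" where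
    "D0 = (\<lambda>(v, r). indicator {0..N} v * (indicator {0..N} r * \<bar>r - v\<bar> powr p))"
  have D0_meas [measurable]: "D0 \<in> borel_measurable (lborel \<Otimes>\<^sub>M lborel)"
    unfolding D0_def by measurable
  have "integrable (lborel \<Otimes>\<^sub>M lborel) D0"
  proof (rule integrableI_bounded)
    have "(\<integral>\<^sup>+z. ennreal (norm (D0 z)) \<partial>(lborel \<Otimes>\<^sub>M lborel))
        = (\<integral>\<^sup>+v. \<integral>\<^sup>+r. ennreal (indicator {0..N} v * (indicator {0..N} r * \<bar>r - v\<bar> powr p)) \<partial>lborel \<partial>lborel)"
      by (subst lborel.nn_integral_fst[symmetric]) (auto simp: D0_def)
    also have "\<dots> < \<infinity>" using B by (intro nn_integral_square_abs_powr p) (auto simp: N_def)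
    finally show "(\<integral>\<^sup>+z. ennreal (norm (D0 z)) \<partial>(lborel \<Otimes>\<^sub>M lborel)) < \<infinity>" .
  qed measurable
  then have "integrable (lborel \<Otimes>\<^sub>M lborel) (\<lambda>z. B * B' * D0 z)"
    by simp
  also have "(\<lambda>z. B * B' * D0 z) = D" by (auto simp: D_def D0_def)
  finally have "integrable (lborel \<Otimes>\<^sub>M lborel) D" .
  then show ?thesis
  proof (rule Bochner_Integration.integrable_bound)
    have "norm (pair_kernel p g h (v, r)) \<le> norm (D (v, r))" for v r
    proof (cases "0 \<le> v \<and> 0 \<le> r")
      case True
      have "norm (pair_kernel p g h (v, r)) = norm (g r) * norm (h v) * \<bar>r - v\<bar> powr p"
        using True by (simp add: pair_kernel_def norm_mult)
      also have "\<dots> \<le> (B * indicator {0..M} r) * (B' * indicator {0..M'} v) * \<bar>r - v\<bar> powr p"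
        using True B B' by (intro mult_right_mono mult_mono) auto
      also have "\<dots> \<le> D (v, r)"
        using B B' by (auto simp: D_def N_def indicator_def)
      finally show ?thesis by simp
    qed (auto simp: pair_kernel_def)
    then show "AE z in lborel \<Otimes>\<^sub>M lborel. norm (pair_kernel p g h z) \<le> norm (D z)"
      by (intro AE_I2) (auto simp: split_paired_all)
  qed (use g h in measurable)
qed

lemma kernel_form_eq:
  assumes p: "-1 < p" and g: "bounded_supp g" and h: "bounded_supp h"
  shows "kernel_form p g h = integral\<^sup>L (lborel \<Otimes>\<^sub>M lborel) (pair_kernel p g h)"
  unfolding lborel_pair.integral_fst'[OF pair_kernel_integrable[OF assms], symmetric]
  by (simp add: kernel_form_def pair_kernel_def set_lebesgue_integral_def del: scaleR_scaleR)

lemma kernel_form_add_left: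
  assumes "-1 < p" "bounded_supp g" "bounded_supp g'" "bounded_supp h"
  shows "kernel_form p (\<lambda>r. g r + g' r) h = kernel_form p g h + kernel_form p g' h"
proof -
  have "pair_kernel p (\<lambda>r. g r + g' r) h = (\<lambda>z. pair_kernel p g h z + pair_kernel p g' h z)"
    by (auto simp: pair_kernel_def fun_eq_iff algebra_simps scaleR_add_right)
  then show ?thesis
    using assms by (simp add: kernel_form_eq bounded_supp_add pair_kernel_integrable)
qed

lemma kernel_form_add_right:
  assumes "-1 < p" "bounded_supp g" "bounded_supp h" "bounded_supp h'"
  shows "kernel_form p g (\<lambda>r. h r + h' r) = kernel_form p g h + kernel_form p g h'"
proof -
  have "pair_kernel p g (\<lambda>r. h r + h' r) = (\<lambda>z. pair_kernel p g h z + pair_kernel p g h' z)"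
    by (auto simp: pair_kernel_def fun_eq_iff algebra_simps scaleR_add_right)
  then show ?thesis
    using assms by (simp add: kernel_form_eq bounded_supp_add pair_kernel_integrable)
qed

lemma kernel_form_scale_left:
  assumes "-1 < p" "bounded_supp g" "bounded_supp h"
  shows "kernel_form p (\<lambda>r. c * g r) h = c * kernel_form p g h"
proof -
  have "pair_kernel p (\<lambda>r. c * g r) h = (\<lambda>z. c * pair_kernel p g h z)"
    by (auto simp: pair_kernel_def fun_eq_iff algebra_simps)
  then show ?thesis
    using assms by (simp add: kernel_form_eq bounded_supp_scale)
qed

lemma kernel_form_scale_right:
  assumes "-1 < p" "bounded_supp g" "bounded_supp h"
  shows "kernel_form p g (\<lambda>r. c * h r) = cnj c * kernel_form p g h"
proof -
  have "pair_kernel p g (\<lambda>r. c * h r) = (\<lambda>z. cnj c * pair_kernel p g h z)"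
    by (auto simp: pair_kernel_def fun_eq_iff algebra_simps)
  then show ?thesis
    using assms by (simp add: kernel_form_eq bounded_supp_scale)
qed

section \<open>Positive semidefiniteness of the form\<close>

text \<open>The triangle function of \<open>r - v\<close> is the length of the overlap of two intervals of length \<open>a\<close> attached to \<open>r\<close> and \<open>v\<close>. It is
thus an integral of products of a function of \<open>r\<close> with the same function of \<open>v\<close>, which is why it is a positive
semidefinite kernel.\<close>

lemma triangle_overlap:
  fixes r v a :: real
  shows "(\<integral>\<^sup>+w. ennreal (indicator {r..r + a} w * indicator {v..v + a} w) \<partial>lborel) = ennreal (max 0 (a - \<bar>r - v\<bar>))"
    and "(LINT w|lborel. indicator {r..r + a} w * indicator {v..v + a} w :: real) = max 0 (a - \<bar>r - v\<bar>)"
    and "integrable lborel (\<lambda>w. indicator {r..r + a} w * indicator {v..v + a} w :: real)"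
proof -
  have eq: "(\<lambda>w. indicator {r..r + a} w * indicator {v..v + a} w :: real) =
      indicator {max r v..min (r + a) (v + a)}"
    by (intro ext) (simp add: indicator_def)
  have len: "max 0 (a - \<bar>r - v\<bar>) =
      (if max r v \<le> min (r + a) (v + a) then min (r + a) (v + a) - max r v else 0)"
    by (simp add: max_def min_def abs_if)
  show "(\<integral>\<^sup>+w. ennreal (indicator {r..r + a} w * indicator {v..v + a} w) \<partial>lborel) = ennreal (max 0 (a - \<bar>r - v\<bar>))"
    unfolding fun_cong[OF eq] len ennreal_indicator
    by (subst nn_integral_indicator) (simp_all only: emeasure_lborel_Icc_eq, auto)
  show "(LINT w|lborel. indicator {r..r + a} w * indicator {v..v + a} w :: real) = max 0 (a - \<bar>r - v\<bar>)"
    unfolding eq len by (simp add: measure_def emeasure_lborel_Icc_eq)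
  show "integrable lborel (\<lambda>w. indicator {r..r + a} w * indicator {v..v + a} w :: real)"
    unfolding eq by (simp add: emeasure_lborel_Icc_eq)
qed

text \<open>The integral is homogeneous of degree \<open>p\<close> in \<open>x\<close>, hence a multiple of \<open>x powr p\<close>; it converges at infinity because
\<open>p < 0\<close> and starts at \<open>l = x > 0\<close>.\<close>

lemma triangle_mixture:
  assumes p: "p < 0" and x: "0 < x"
  shows "(\<integral>\<^sup>+l. ennreal (indicator {0..} l * (l powr (p - 2) * max 0 (l - x))) \<partial>lborel) =
      ennreal (x powr p / (- p * (1 - p)))"
proof -
  have 1: "((\<lambda>l. l powr (p - 1)) has_integral - (x powr p) / p) {x..}"
    using has_integral_powr_to_inf[of "p - 1" x] p x by simp
  have 2: "((\<lambda>l. l powr (p - 2)) has_integral - (x powr (p - 1)) / (p - 1)) {x..}"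
    using has_integral_powr_to_inf[of "p - 2" x] p x by simp
  have "((\<lambda>l. l powr (p - 1) - x * l powr (p - 2)) has_integral
      - (x powr p) / p - x * (- (x powr (p - 1)) / (p - 1))) {x..}"
    by (intro has_integral_diff has_integral_mult_right 1 2)
  also have "x * (- (x powr (p - 1)) / (p - 1)) = - (x powr p) / (p - 1)"
    using x by (simp add: powr_diff)
  also have "- (x powr p) / p - - (x powr p) / (p - 1) = x powr p / (- p * (1 - p))"
    using p by (simp add: field_simps)
  finally have "((\<lambda>l. l powr (p - 2) * max 0 (l - x)) has_integral x powr p / (- p * (1 - p))) {x..}"
    by (rule has_integral_eq[rotated])
      (use x in \<open>auto simp: max_def right_diff_distrib powr_diff power2_eq_square powr_numeral field_simps\<close>)
  then have *: "((\<lambda>l. l powr (p - 2) * max 0 (l - x)) has_integral x powr p / (- p * (1 - p))) {0..}"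
    by (rule has_integral_on_superset) (use x in auto)
  show "(\<integral>\<^sup>+l. ennreal (indicator {0..} l * (l powr (p - 2) * max 0 (l - x))) \<partial>lborel) =
      ennreal (x powr p / (- p * (1 - p)))"
  proof (rule nn_integral_has_integral_lborel)
    have eq: "(\<lambda>l. indicator {0..} l * (l powr (p - 2) * max 0 (l - x))) =
      (\<lambda>l. if l \<in> {0..} then l powr (p - 2) * max 0 (l - x) else 0)"
      by (auto simp: indicator_def)
    show "((\<lambda>l. indicator {0..} l * (l powr (p - 2) * max 0 (l - x))) has_integral x powr p / (- p * (1 - p))) UNIV"
      unfolding eq has_integral_restrict_UNIV by (rule *)
  qed auto
qed

definition pair_prod :: "(real \<Rightarrow> complex) \<Rightarrow> real \<times> real \<Rightarrow> complex" where
  "pair_prod g = (\<lambda>(v, r). indicator {0..} v *\<^sub>R indicator {0..} r *\<^sub>R (g r * cnj (g v)))"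

lemma pair_kernel_pair_prod:
  "pair_kernel p g g z = \<bar>snd z - fst z\<bar> powr p *\<^sub>R pair_prod g z"
  by (cases z) (simp add: pair_kernel_def pair_prod_def scaleR_conv_of_real)

lemma bounded_supp_integrable:
  assumes "bounded_supp g"
  shows "integrable lborel (\<lambda>r. indicator {0..} r *\<^sub>R g r)"
proof -
  obtain B M where B: "\<And>r. 0 \<le> r \<Longrightarrow> norm (g r) \<le> B * indicator {0..M} r"
    using bounded_suppE[OF assms] by metis
  note [measurable] = bounded_supp_measurable[OF assms]
  show ?thesis
  proof (rule Bochner_Integration.integrable_bound[of _ "\<lambda>r. B * indicator {0..M} r"])
    show "AE r in lborel. norm (indicator {0..} r *\<^sub>R g r) \<le> norm (B * indicator {0..M} r)"
    proof (intro AE_I2)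
      fix r show "norm (indicator {0..} r *\<^sub>R g r) \<le> norm (B * indicator {0..M} r)"
        using B[of r] by (cases "0 \<le> r") auto
    qed
  qed (auto simp: emeasure_lborel_Icc_eq)
qed

lemma pair_prod_measurable [measurable]:
  assumes "bounded_supp g"
  shows "pair_prod g \<in> borel_measurable (lborel \<Otimes>\<^sub>M lborel)"
proof -
  note [measurable] = bounded_supp_measurable[OF assms]
  have [measurable]: "cnj \<in> borel_measurable borel"
    by (intro borel_measurable_continuous_onI continuous_intros)
  show ?thesis unfolding pair_prod_def by measurable
qed

lemma pair_prod_integrable:
  assumes "bounded_supp g"
  shows "integrable (lborel \<Otimes>\<^sub>M lborel) (pair_prod g)"
proof -
  have "integrable (lborel \<Otimes>\<^sub>M lborel) (\<lambda>(v, r). cnj (indicator {0..} v *\<^sub>R g v) * (indicator {0..} r *\<^sub>R g r))"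
    by (intro lborel_pair.integrable_pair_mult bounded_supp_integrable[OF assms] integrable_cnj)
  also have "(\<lambda>(v, r). cnj (indicator {0..} v *\<^sub>R g v) * (indicator {0..} r *\<^sub>R g r)) = pair_prod g"
    by (auto simp: pair_prod_def fun_eq_iff indicator_def)
  finally show ?thesis .
qed

text \<open>By Fubini the form becomes the integral over \<open>w\<close> of \<open>(norm (L w))\<^sup>2\<close>, where \<open>L w\<close> is the integral of \<open>g\<close> over an
interval of length \<open>a\<close> ending at \<open>w\<close>.\<close>

lemma triangle_form_nonneg:
  assumes g: "bounded_supp g" and a: "0 \<le> a"
  shows "0 \<le> Re (LINT z|(lborel \<Otimes>\<^sub>M lborel). max 0 (a - \<bar>snd z - fst z\<bar>) *\<^sub>R pair_prod g z)"
proof -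
  let ?L2 = "lborel \<Otimes>\<^sub>M lborel :: (real \<times> real) measure"
  interpret P: pair_sigma_finite ?L2 "lborel :: real measure"
    by unfold_locales
  define b where "b l r w = (indicator {r..r + l} w :: real)" for l r w :: real
  have b_meas [measurable]: "(\<lambda>z. b a (f z) (g z)) \<in> borel_measurable N"
    if [measurable]: "f \<in> borel_measurable N" "g \<in> borel_measurable N" for f g and N :: "'z measure"
  proof -
    have "(\<lambda>z. b a (f z) (g z)) = (\<lambda>z. indicator {z. f z \<le> g z \<and> g z \<le> f z + a} z)"
      by (auto simp: b_def indicator_def)
    also have "\<dots> = (\<lambda>z. if f z \<le> g z \<and> g z \<le> f z + a then 1 else 0)" by (auto simp: indicator_def)
    also have "\<dots> \<in> borel_measurable N" by measurable
    finally show ?thesis .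
  qed
  note [measurable] = pair_prod_measurable[OF g]
  define F where "F = (\<lambda>(z, w). (b a (snd z) w * b a (fst z) w) *\<^sub>R pair_prod g z)"
  have F_meas [measurable]: "F \<in> borel_measurable (?L2 \<Otimes>\<^sub>M lborel)"
    unfolding F_def by measurable
  have intw: "(\<integral>\<^sup>+w. ennreal (norm (F (z, w))) \<partial>lborel) = ennreal (norm (pair_prod g z) * max 0 (a - \<bar>snd z - fst z\<bar>))" for z
  proof -
    have "(\<integral>\<^sup>+w. ennreal (norm (F (z, w))) \<partial>lborel) =
        (\<integral>\<^sup>+w. ennreal (norm (pair_prod g z)) * ennreal (indicator {snd z..snd z + a} w * indicator {fst z..fst z + a} w) \<partial>lborel)"
      by (intro nn_integral_cong) (auto simp: F_def b_def abs_mult ennreal_mult[symmetric] mult_ac)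
    also have "\<dots> = ennreal (norm (pair_prod g z)) * ennreal (max 0 (a - \<bar>snd z - fst z\<bar>))"
      by (subst nn_integral_cmult) (auto simp: triangle_overlap)
    finally show ?thesis by (subst ennreal_mult) auto
  qed
  have F_int: "integrable (?L2 \<Otimes>\<^sub>M lborel) F"
  proof (rule integrableI_bounded)
    have "(\<integral>\<^sup>+y. ennreal (norm (F y)) \<partial>(?L2 \<Otimes>\<^sub>M lborel)) = (\<integral>\<^sup>+z. \<integral>\<^sup>+w. ennreal (norm (F (z, w))) \<partial>lborel \<partial>?L2)"
      by (subst lborel.nn_integral_fst[symmetric]) auto
    also have "\<dots> \<le> (\<integral>\<^sup>+z. ennreal a * ennreal (norm (pair_prod g z)) \<partial>?L2)"
      unfolding intw using a
      by (intro nn_integral_mono) (auto simp: ennreal_mult[symmetric] mult.commute[of a] intro!: ennreal_leI mult_left_mono)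
    also have "\<dots> = ennreal a * (\<integral>\<^sup>+z. ennreal (norm (pair_prod g z)) \<partial>?L2)"
      by (intro nn_integral_cmult) measurable
    also have "\<dots> < \<infinity>"
      using pair_prod_integrable[OF g] by (auto simp: integrable_iff_bounded ennreal_mult_less_top)
    finally show "(\<integral>\<^sup>+y. ennreal (norm (F y)) \<partial>(?L2 \<Otimes>\<^sub>M lborel)) < \<infinity>" .
  qed measurable
  define L where "L w = (LINT r|lborel. b a r w *\<^sub>R indicator {0..} r *\<^sub>R g r)" for w
  have L_int: "integrable lborel (\<lambda>r. b a r w *\<^sub>R indicator {0..} r *\<^sub>R g r)" for w
  proof (rule Bochner_Integration.integrable_bound[OF bounded_supp_integrable[OF g]])
    note [measurable] = bounded_supp_measurable[OF g]
    show "(\<lambda>r. b a r w *\<^sub>R indicator {0..} r *\<^sub>R g r) \<in> borel_measurable lborel" by measurable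
  qed (auto simp: b_def indicator_def)
  have "(LINT z|?L2. max 0 (a - \<bar>snd z - fst z\<bar>) *\<^sub>R pair_prod g z) = (LINT z|?L2. LINT w|lborel. F (z, w))"
    by (intro Bochner_Integration.integral_cong)
      (auto simp: F_def b_def triangle_overlap(2,3))
  also have "\<dots> = (LINT w|lborel. LINT z|?L2. F (z, w))"
    using P.Fubini_integral[of "\<lambda>z w. F (z, w)"] F_int by simp
  also have "\<dots> = (LINT w|lborel. cnj (L w) * L w)"
  proof (intro Bochner_Integration.integral_cong refl)
    fix w
    have "(LINT z|?L2. F (z, w)) = (LINT z|?L2. (case z of (v, r) \<Rightarrow>
        cnj (b a v w *\<^sub>R indicator {0..} v *\<^sub>R g v) * (b a r w *\<^sub>R indicator {0..} r *\<^sub>R g r)))"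
      by (intro Bochner_Integration.integral_cong) (auto simp: F_def pair_prod_def b_def indicator_def)
    also have "\<dots> = (LINT v|lborel. LINT r|lborel. cnj (b a v w *\<^sub>R indicator {0..} v *\<^sub>R g v) * (b a r w *\<^sub>R indicator {0..} r *\<^sub>R g r))"
      using lborel_pair.integral_fst'[OF lborel_pair.integrable_pair_mult[OF integrable_cnj[OF L_int[of w]] L_int[of w]]]
      by simp
    also have "\<dots> = cnj (L w) * L w"
      using L_int[of w] by (simp only: integral_mult_right_zero integral_mult_left_zero Bochner_Integration.integral_cnj L_def)
    finally show "(LINT z|?L2. F (z, w)) = cnj (L w) * L w" .
  qed
  also have "\<dots> = (LINT w|lborel. complex_of_real ((norm (L w))\<^sup>2))"
    by (intro Bochner_Integration.integral_cong refl) (simp only: complex_norm_square mult.commute)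
  also have "\<dots> = complex_of_real (LINT w|lborel. (norm (L w))\<^sup>2)"
    by (rule integral_complex_of_real)
  finally show ?thesis by (auto intro!: integral_nonneg)
qed

text \<open>The kernel is a mixture, with positive weights, of triangle functions. The mixture is infinite on the
diagonal, where \<open>0 powr p = 0\<close>, so the two agree almost everywhere only.\<close>

lemma kernel_form_nonneg:
  assumes p: "-1 < p" "p < 0" and g: "bounded_supp g"
  shows "0 \<le> Re (kernel_form p g g)"
proof -
  let ?L2 = "lborel \<Otimes>\<^sub>M lborel :: (real \<times> real) measure"
  interpret P: pair_sigma_finite ?L2 "lborel :: real measure"
    by unfold_locales
  note [measurable] = pair_prod_measurable[OF g]
  define c where "c = - p * (1 - p)"
  have c: "c > 0" using p by (auto simp: c_def intro!: mult_neg_pos)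
  define h where "h l z = indicator {0..} l * (l powr (p - 2) * max 0 (l - \<bar>snd z - fst z\<bar>))" for l :: real and z :: "real \<times> real"
  have h0: "0 \<le> h l z" for l z by (simp add: h_def)
  have h_meas[measurable]: "(\<lambda>(z, l). h l z) \<in> borel_measurable (?L2 \<Otimes>\<^sub>M lborel)"
    unfolding h_def by measurable
  have h_meas'[measurable]: "(\<lambda>l. h l z) \<in> borel_measurable lborel" for z
    unfolding h_def by measurable
  have mix: "(\<integral>\<^sup>+l. ennreal (h l z) \<partial>lborel) = ennreal (\<bar>snd z - fst z\<bar> powr p / c)"
    if "fst z \<noteq> snd z" for z
    unfolding h_def c_def by (rule triangle_mixture) (use p that in auto)
  define F where "F = (\<lambda>(z, l). h l z *\<^sub>R pair_prod g z)"
  have F_meas [measurable]: "F \<in> borel_measurable (?L2 \<Otimes>\<^sub>M lborel)"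
    unfolding F_def case_prod_beta by measurable
  have off_diag: "AE z in ?L2. fst z \<noteq> snd z"
  proof -
    have "AE z in ?L2. (\<lambda>(v, r). v \<noteq> r) z"
    proof (rule lborel_pair.AE_pair_measure)
      show "AE v in lborel. AE r in lborel. (case (v, r) of (v, r) \<Rightarrow> v \<noteq> r)"
        using AE_lborel_singleton by (auto simp: eq_commute)
      show "{z \<in> space ?L2. case z of (v, r) \<Rightarrow> v \<noteq> r} \<in> sets ?L2"
        unfolding case_prod_beta by (intro borel_measurable_neq) measurable
    qed
    then show ?thesis by (simp add: case_prod_beta)
  qed
  have F_int: "integrable (?L2 \<Otimes>\<^sub>M lborel) F"
  proof (rule integrableI_bounded)
    have "(\<integral>\<^sup>+y. ennreal (norm (F y)) \<partial>(?L2 \<Otimes>\<^sub>M lborel)) = (\<integral>\<^sup>+z. \<integral>\<^sup>+l. ennreal (norm (F (z, l))) \<partial>lborel \<partial>?L2)"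
      by (subst lborel.nn_integral_fst[symmetric]) auto
    also have "\<dots> = (\<integral>\<^sup>+z. ennreal (norm ((1 / c) *\<^sub>R pair_kernel p g g z)) \<partial>?L2)"
    proof (rule nn_integral_cong_AE, use off_diag in eventually_elim)
      fix z :: "real \<times> real" assume z: "fst z \<noteq> snd z"
      have "(\<integral>\<^sup>+l. ennreal (norm (F (z, l))) \<partial>lborel) = (\<integral>\<^sup>+l. ennreal (norm (pair_prod g z)) * ennreal (h l z) \<partial>lborel)"
        by (intro nn_integral_cong) (auto simp: F_def h0 ennreal_mult[symmetric] mult.commute)
      also have "\<dots> = ennreal (norm (pair_prod g z)) * ennreal (\<bar>snd z - fst z\<bar> powr p / c)"
        by (subst nn_integral_cmult) (auto simp: mix[OF z])
      also have "\<dots> = ennreal (norm ((1 / c) *\<^sub>R pair_kernel p g g z))"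
        using c by (simp add: pair_kernel_pair_prod ennreal_mult[symmetric] mult_ac)
      finally show "(\<integral>\<^sup>+l. ennreal (norm (F (z, l))) \<partial>lborel) = ennreal (norm ((1 / c) *\<^sub>R pair_kernel p g g z))" .
    qed
    also have "\<dots> < \<infinity>"
      using integrable_scaleR_right[OF pair_kernel_integrable[OF p(1) g g], of "1 / c"]
      by (simp add: integrable_iff_bounded)
    finally show "(\<integral>\<^sup>+y. ennreal (norm (F y)) \<partial>(?L2 \<Otimes>\<^sub>M lborel)) < \<infinity>" .
  qed measurable
  have mix': "(LINT l|lborel. h l z) = \<bar>snd z - fst z\<bar> powr p / c" if "fst z \<noteq> snd z" for z
    using mix[OF that] c h0 by (intro integral_eq_nn_integral[THEN trans]) auto
  have "kernel_form p g g = (LINT z|?L2. pair_kernel p g g z)"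
    by (rule kernel_form_eq[OF p(1) g g])
  also have "\<dots> = (LINT z|?L2. c *\<^sub>R (LINT l|lborel. F (z, l)))"
  proof (rule integral_cong_AE)
    show "AE z in ?L2. pair_kernel p g g z = c *\<^sub>R (LINT l|lborel. F (z, l))"
      using off_diag
    proof eventually_elim
      fix z :: "real \<times> real" assume z: "fst z \<noteq> snd z"
      have "integrable lborel (\<lambda>l. h l z)"
        using h0 by (intro integrableI_nonneg) (auto simp: mix[OF z])
      then have "(LINT l|lborel. F (z, l)) = (LINT l|lborel. h l z) *\<^sub>R pair_prod g z"
        unfolding F_def by simp
      then show "pair_kernel p g g z = c *\<^sub>R (LINT l|lborel. F (z, l))"
        using c by (simp add: mix'[OF z] pair_kernel_pair_prod)
    qed
  qed (use g in measurable)
  also have "\<dots> = c *\<^sub>R (LINT z|?L2. LINT l|lborel. F (z, l))"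
    by simp
  also have "(LINT z|?L2. LINT l|lborel. F (z, l)) = (LINT l|lborel. LINT z|?L2. F (z, l))"
    using P.Fubini_integral[of "\<lambda>z l. F (z, l)"] F_int by simp
  finally have eq: "Re (kernel_form p g g) = c * Re (LINT l|lborel. LINT z|?L2. F (z, l))"
    by simp
  have int: "integrable lborel (\<lambda>l. LINT z|?L2. F (z, l))"
    by (rule P.integrable_snd[of "\<lambda>z l. F (z, l)"]) (use F_int in simp)
  have "Re (LINT l|lborel. LINT z|?L2. F (z, l)) = (LINT l|lborel. Re (LINT z|?L2. F (z, l)))"
    using int by simp
  also have "\<dots> \<ge> 0"
  proof (rule Bochner_Integration.integral_nonneg)
    fix l :: real
    show "0 \<le> Re (LINT z|?L2. F (z, l))"
    proof (cases "0 \<le> l")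
      case True
      then have "(LINT z|?L2. F (z, l)) = l powr (p - 2) *\<^sub>R (LINT z|?L2. max 0 (l - \<bar>snd z - fst z\<bar>) *\<^sub>R pair_prod g z)"
        unfolding integral_scaleR_right[symmetric] F_def h_def by simp
      then show ?thesis
        using triangle_form_nonneg[OF g True] by simp
    qed (simp add: F_def h_def)
  qed
  finally show ?thesis unfolding eq using c by simp
qed

text \<open>The parallelogram identity: the right-hand side exceeds the left-hand side by the value of the form at
\<open>g + h\<close>.\<close>

lemma kernel_form_diff_le:
  assumes p: "-1 < p" "p < 0" and g: "bounded_supp g" and h: "bounded_supp h"
  shows "Re (kernel_form p (\<lambda>r. g r - h r) (\<lambda>r. g r - h r)) \<le>
    2 * Re (kernel_form p g g) + 2 * Re (kernel_form p h h)"
proof -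
  have s: "bounded_supp (\<lambda>r. c * h r)" "bounded_supp (\<lambda>r. g r + c * h r)" for c
    using g h by auto
  have exp: "kernel_form p (\<lambda>r. g r + c * h r) (\<lambda>r. g r + c * h r) = kernel_form p g g
      + c * kernel_form p h g + cnj c * kernel_form p g h + c * cnj c * kernel_form p h h" for c
    using g h s p by (simp add: kernel_form_add_left kernel_form_add_right kernel_form_scale_left
        kernel_form_scale_right algebra_simps)
  have "0 \<le> Re (kernel_form p (\<lambda>r. g r + 1 * h r) (\<lambda>r. g r + 1 * h r))"
    by (rule kernel_form_nonneg[OF p s(2)])
  moreover have "kernel_form p (\<lambda>r. g r - h r) (\<lambda>r. g r - h r) =
      kernel_form p (\<lambda>r. g r + (- 1) * h r) (\<lambda>r. g r + (- 1) * h r)" by simp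
  ultimately show ?thesis
    unfolding exp by simp
qed

section \<open>Oscillation and the increments of the wave kernel\<close>

text \<open>By the second mean value theorem the integral is a combination of two integrals of \<open>f\<close> alone, with the end
values of the weight as coefficients.\<close>

lemma monotone_weight_integral_bound:
  fixes f \<phi> :: "real \<Rightarrow> real"
  assumes f: "f integrable_on {c..d}" "c \<le> d"
    and mono: "(\<forall>x\<in>{c..d}. \<forall>y\<in>{c..d}. x \<le> y \<longrightarrow> \<phi> x \<le> \<phi> y) \<or>
      (\<forall>x\<in>{c..d}. \<forall>y\<in>{c..d}. x \<le> y \<longrightarrow> \<phi> y \<le> \<phi> x)"
    and \<phi>: "\<And>x. x \<in> {c..d} \<Longrightarrow> \<bar>\<phi> x\<bar> \<le> \<Phi>"
    and m: "\<And>x y. c \<le> x \<Longrightarrow> x \<le> y \<Longrightarrow> y \<le> d \<Longrightarrow> \<bar>integral {x..y} f\<bar> \<le> m"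
  shows "\<bar>integral {c..d} (\<lambda>x. \<phi> x * f x)\<bar> \<le> 2 * \<Phi> * m"
proof -
  have incr: "\<bar>integral {c..d} (\<lambda>x. \<psi> x * f x)\<bar> \<le> 2 * \<Phi> * m"
    if "\<forall>x\<in>{c..d}. \<forall>y\<in>{c..d}. x \<le> y \<longrightarrow> \<psi> x \<le> \<psi> y"
      and \<psi>: "\<And>x. x \<in> {c..d} \<Longrightarrow> \<bar>\<psi> x\<bar> \<le> \<Phi>" for \<psi>
  proof -
    have \<psi>_mono: "\<psi> x \<le> \<psi> y" if "c \<le> x" "x \<le> y" "y \<le> d" for x y
      using \<open>\<forall>x\<in>{c..d}. \<forall>y\<in>{c..d}. x \<le> y \<longrightarrow> \<psi> x \<le> \<psi> y\<close> that by auto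
    obtain z where z: "z \<in> {c..d}" "integral {c..d} (\<lambda>x. \<psi> x * f x) =
        \<psi> c * integral {c..z} f + \<psi> d * integral {z..d} f"
      using second_mean_value_theorem[where g = \<psi>, OF f \<psi>_mono] by blast
    have "\<bar>\<psi> c * integral {c..z} f\<bar> \<le> \<Phi> * m" "\<bar>\<psi> d * integral {z..d} f\<bar> \<le> \<Phi> * m"
      unfolding abs_mult using z f \<psi>[of c] \<psi>[of d] m[of c z] m[of z d] by (auto intro!: mult_mono)
    then show ?thesis unfolding z(2) by linarith
  qed
  from mono show ?thesis
  proof
    assume "\<forall>x\<in>{c..d}. \<forall>y\<in>{c..d}. x \<le> y \<longrightarrow> \<phi> y \<le> \<phi> x"
    then have "\<bar>integral {c..d} (\<lambda>x. - \<phi> x * f x)\<bar> \<le> 2 * \<Phi> * m"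
      using \<phi> by (intro incr) auto
    then show ?thesis by simp
  qed (use \<phi> in \<open>auto intro: incr\<close>)
qed

lemma kernel_mult_integrable:
  fixes g :: "real \<Rightarrow> real"
  assumes "-1 < p" "continuous_on {a..b} g"
  shows "set_integrable lborel {a..b} (\<lambda>r. g r * \<bar>r - v\<bar> powr p)"
proof (cases "a \<le> b")
  case True
  have "bounded (g ` {a..b})" by (intro compact_imp_bounded compact_continuous_image assms) auto
  then obtain B where "\<forall>y\<in>g ` {a..b}. norm y \<le> B"
    unfolding bounded_iff by blast
  then have B: "\<And>r. r \<in> {a..b} \<Longrightarrow> \<bar>g r\<bar> \<le> B" by auto
  show ?thesis
    unfolding set_integrable_def
  proof (rule Bochner_Integration.integrable_bound)
    show "integrable lborel (\<lambda>r. B * (indicator {a..b} r *\<^sub>R \<bar>r - v\<bar> powr p))"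
      using set_integrable_abs_powr[OF assms(1) True, of v] by (simp add: set_integrable_def)
    have "(\<lambda>r. indicator {a..b} r *\<^sub>R g r) \<in> borel_measurable borel"
      using assms(2) by (intro borel_measurable_continuous_on_indicator) auto
    then have "(\<lambda>r. (indicator {a..b} r *\<^sub>R g r) * \<bar>r - v\<bar> powr p) \<in> borel_measurable lborel"
      by measurable
    then show "(\<lambda>r. indicator {a..b} r *\<^sub>R (g r * \<bar>r - v\<bar> powr p)) \<in> borel_measurable lborel"
      by (simp add: mult.assoc)
    show "AE r in lborel. norm (indicator {a..b} r *\<^sub>R (g r * \<bar>r - v\<bar> powr p))
        \<le> norm (B * (indicator {a..b} r *\<^sub>R \<bar>r - v\<bar> powr p))"
    proof (intro AE_I2)
      fix r
      show "norm (indicator {a..b} r *\<^sub>R (g r * \<bar>r - v\<bar> powr p))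
        \<le> norm (B * (indicator {a..b} r *\<^sub>R \<bar>r - v\<bar> powr p))"
        using B[of r] by (cases "r \<in> {a..b}") (auto simp: abs_mult intro!: mult_right_mono)
    qed
  qed
qed (simp add: set_integrable_def)

text \<open>Within distance \<open>\<eta>\<close> of \<open>v\<close> only the size of \<open>g\<close> is used, and the singularity is integrable. Beyond that distance the
kernel is monotone on either side of \<open>v\<close> and at most \<open>\<eta> powr p\<close>, and the cancellation in \<open>g\<close>, measured by \<open>m\<close>, takes
over. The bound does not depend on the length of \<open>{a..b}\<close>.\<close>

lemma potential_bound:
  fixes g :: "real \<Rightarrow> real"
  assumes p: "-1 < p" "p < 0" and \<eta>: "0 < \<eta>" and ab: "a \<le> b"
    and g: "continuous_on {a..b} g"
    and G: "\<And>r. r \<in> {a..b} \<Longrightarrow> \<bar>g r\<bar> \<le> G"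
    and m: "\<And>c d. a \<le> c \<Longrightarrow> c \<le> d \<Longrightarrow> d \<le> b \<Longrightarrow> \<bar>integral {c..d} g\<bar> \<le> m"
  shows "\<bar>LINT r:{a..b}|lborel. g r * \<bar>r - v\<bar> powr p\<bar> \<le>
    2 * G * \<eta> powr (p + 1) / (p + 1) + 4 * m * \<eta> powr p"
proof -
  define k where "k r = g r * \<bar>r - v\<bar> powr p" for r
  have k: "set_integrable lborel {c..d} k" if "a \<le> c" "d \<le> b" for c d
    unfolding k_def using that by (intro kernel_mult_integrable p continuous_on_subset[OF g]) auto
  have G0: "0 \<le> G" using G[of a] ab by auto
  have m0: "0 \<le> m" using m[of a a] ab by auto
  have far: "\<bar>LINT r:{c..d}|lborel. k r\<bar> \<le> 2 * m * \<eta> powr p"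
    if cd: "a \<le> c" "d \<le> b" "d \<le> v - \<eta> \<or> v + \<eta> \<le> c" for c d
  proof (cases "c \<le> d")
    case True
    have "\<bar>integral {c..d} (\<lambda>r. \<bar>r - v\<bar> powr p * g r)\<bar> \<le> 2 * (\<eta> powr p) * m"
    proof (rule monotone_weight_integral_bound[OF _ True])
      show "g integrable_on {c..d}"
        using cd by (intro integrable_continuous_real continuous_on_subset[OF g]) auto
      show "\<bar>\<bar>r - v\<bar> powr p\<bar> \<le> \<eta> powr p" if "r \<in> {c..d}" for r
        using that cd p \<eta> by (auto intro!: powr_mono2')
      show "\<bar>integral {x..y} g\<bar> \<le> m" if "c \<le> x" "x \<le> y" "y \<le> d" for x y
        using that cd by (intro m) auto
      show "(\<forall>x\<in>{c..d}. \<forall>y\<in>{c..d}. x \<le> y \<longrightarrow> \<bar>x - v\<bar> powr p \<le> \<bar>y - v\<bar> powr p) \<or>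
        (\<forall>x\<in>{c..d}. \<forall>y\<in>{c..d}. x \<le> y \<longrightarrow> \<bar>y - v\<bar> powr p \<le> \<bar>x - v\<bar> powr p)"
        using cd(3)
      proof
        assume "d \<le> v - \<eta>"
        then have "\<bar>x - v\<bar> powr p \<le> \<bar>y - v\<bar> powr p" if "x \<in> {c..d}" "y \<in> {c..d}" "x \<le> y" for x y
          using that p \<eta> by (intro powr_mono2') auto
        then show ?thesis by blast
      next
        assume "v + \<eta> \<le> c"
        then have "\<bar>y - v\<bar> powr p \<le> \<bar>x - v\<bar> powr p" if "x \<in> {c..d}" "y \<in> {c..d}" "x \<le> y" for x y
          using that p \<eta> by (intro powr_mono2') auto
        then show ?thesis by blast
      qed
    qed
    moreover have "(LINT r:{c..d}|lborel. k r) = integral {c..d} (\<lambda>r. \<bar>r - v\<bar> powr p * g r)"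
      using set_borel_integral_eq_integral(2)[OF k[OF cd(1,2)]] by (simp add: k_def[abs_def] mult.commute)
    ultimately show ?thesis by (simp add: mult_ac)
  qed (use m0 in \<open>simp add: set_lebesgue_integral_def\<close>)
  have near: "\<bar>LINT r:{c..d}|lborel. k r\<bar> \<le> 2 * G * \<eta> powr (p + 1) / (p + 1)"
    if cd: "a \<le> c" "d \<le> b" "v - \<eta> \<le> c" "d \<le> v + \<eta>" for c d
  proof -
    have "norm (LINT r:{c..d}|lborel. k r) \<le> (LINT r:{v - \<eta>..v + \<eta>}|lborel. G * \<bar>r - v\<bar> powr p)"
      unfolding set_lebesgue_integral_def
    proof (rule Bochner_Integration.integral_norm_bound_integral)
      show "integrable lborel (\<lambda>r. indicator {c..d} r *\<^sub>R k r)"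
        using k[OF cd(1,2)] by (simp add: set_integrable_def)
      show "integrable lborel (\<lambda>r. indicator {v - \<eta>..v + \<eta>} r *\<^sub>R (G * \<bar>r - v\<bar> powr p))"
        using set_integrable_abs_powr[OF p(1), of "v - \<eta>" "v + \<eta>" v] \<eta>
        by (auto simp: set_integrable_def mult.left_commute)
      show "norm (indicator {c..d} r *\<^sub>R k r) \<le> indicator {v - \<eta>..v + \<eta>} r *\<^sub>R (G * \<bar>r - v\<bar> powr p)" for r
        using G[of r] cd G0 by (auto simp: k_def abs_mult indicator_def intro!: mult_right_mono)
    qed
    also have "\<dots> = G * (abs_powr_primitive p \<eta> - abs_powr_primitive p (- \<eta>))"
      using set_integral_abs_powr[OF p(1), of "v - \<eta>" "v + \<eta>" v] \<eta> by simp
    also have "\<dots> = 2 * G * \<eta> powr (p + 1) / (p + 1)"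
      using \<eta> by (simp add: abs_powr_primitive_nonneg_arg)
    finally show ?thesis by simp
  qed
  \<comment> \<open>the window around \<open>v\<close>, clipped to \<open>{a..b}\<close>; each of the three pieces may be empty\<close>
  define x where "x = max a (min b (v - \<eta>))"
  define y where "y = max a (min b (v + \<eta>))"
  have xy: "a \<le> x" "x \<le> y" "y \<le> b" using ab \<eta> by (auto simp: x_def y_def)
  have split: "(LINT r:{a..b}|lborel. k r) = (LINT r:{a..x}|lborel. k r)
      + (LINT r:{x..y}|lborel. k r) + (LINT r:{y..b}|lborel. k r)"
  proof -
    have eq: "(LINT r:{c..d}|lborel. k r) = integral {c..d} k" if "a \<le> c" "d \<le> b" for c d
      using set_borel_integral_eq_integral(2)[OF k[OF that]] .
    have int: "k integrable_on {a..b}"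
      using set_borel_integral_eq_integral(1)[OF k[of a b]] by simp
    have "integral {a..x} k + integral {x..b} k = integral {a..b} k"
      using xy ab int by (intro Henstock_Kurzweil_Integration.integral_combine) auto
    moreover have "integral {x..y} k + integral {y..b} k = integral {x..b} k"
      using xy by (intro Henstock_Kurzweil_Integration.integral_combine integrable_on_subinterval[OF int]) auto
    ultimately show ?thesis using xy by (simp add: eq)
  qed
  have "\<bar>LINT r:{a..x}|lborel. k r\<bar> \<le> 2 * m * \<eta> powr p"
  proof (cases "v - \<eta> < a")
    case True
    then have "x = a" using ab by (auto simp: x_def)
    moreover have "(LINT r:{a..a}|lborel. k r) = 0"
      using set_borel_integral_eq_integral(2)[OF k[of a a]] ab by simp
    ultimately show ?thesis using m0 by simp
  qed (use xy in \<open>intro far, auto simp: x_def\<close>)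
  moreover have "\<bar>LINT r:{y..b}|lborel. k r\<bar> \<le> 2 * m * \<eta> powr p"
  proof (cases "b < v + \<eta>")
    case True
    then have "y = b" using ab by (auto simp: y_def)
    moreover have "(LINT r:{b..b}|lborel. k r) = 0"
      using set_borel_integral_eq_integral(2)[OF k[of b b]] ab by simp
    ultimately show ?thesis using m0 by simp
  qed (use xy in \<open>intro far, auto simp: y_def\<close>)
  moreover have "\<bar>LINT r:{x..y}|lborel. k r\<bar> \<le> 2 * G * \<eta> powr (p + 1) / (p + 1)"
  proof (cases "x < y")
    case True
    then show ?thesis using xy by (intro near) (auto simp: x_def y_def)
  next
    case False
    then have "y = x" using xy by simp
    moreover have "(LINT r:{x..x}|lborel. k r) = 0"
      using set_borel_integral_eq_integral(2)[OF k[of x x]] xy by simp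
    ultimately show ?thesis using G0 p by simp
  qed
  ultimately show ?thesis unfolding k_def[symmetric] split by (simp add: mult_ac)
qed

lemma integral_sin_affine_bound:
  fixes \<rho> \<theta> c d :: real
  assumes "0 < \<rho>" "c \<le> d"
  shows "\<bar>integral {c..d} (\<lambda>r. sin (\<rho> * r + \<theta>))\<bar> \<le> 2 / \<rho>"
proof -
  have "((\<lambda>r. sin (\<rho> * r + \<theta>)) has_integral (- cos (\<rho> * d + \<theta>) / \<rho> - - cos (\<rho> * c + \<theta>) / \<rho>)) {c..d}"
    using assms by (intro fundamental_theorem_of_calculus[where f = "\<lambda>r. - cos (\<rho> * r + \<theta>) / \<rho>"])
      (auto intro!: derivative_eq_intros simp: has_real_derivative_iff_has_vector_derivative[symmetric])
  then have "integral {c..d} (\<lambda>r. sin (\<rho> * r + \<theta>)) = (cos (\<rho> * c + \<theta>) - cos (\<rho> * d + \<theta>)) / \<rho>"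
    by (simp add: integral_unique diff_divide_distrib)
  moreover have "\<bar>cos (\<rho> * c + \<theta>) - cos (\<rho> * d + \<theta>)\<bar> \<le> 2"
    using abs_cos_le_one[of "\<rho> * c + \<theta>"] abs_cos_le_one[of "\<rho> * d + \<theta>"] by linarith
  ultimately show ?thesis using assms by (simp add: divide_right_mono)
qed

text \<open>On \<open>{0..s}\<close> the difference of the two sines is a single cosine of the same frequency with amplitude at most
\<open>2 * min (t - s) (1 / norm \<xi>)\<close>, and on \<open>{s..t}\<close> only one sine is left, which is at most \<open>min (t - s) (1 / norm \<xi>)\<close>. In both
cases integrals over subintervals gain a factor \<open>2 / norm \<xi>\<close> over the amplitude, so \<open>potential_bound\<close> with
\<open>\<eta> = 1 / norm \<xi>\<close> balances its two terms. The phase has modulus 1 and cancels; the outer integral is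
estimated by the length \<open>t\<close> of the support.\<close>

lemma wave_increment_bound:
  fixes x :: "'a::euclidean_space"
  assumes H: "1 / 2 < H" "H < 1" and st: "0 \<le> s" "s \<le> t" and \<xi>: "\<xi> \<noteq> 0"
  shows "norm (kernel_form (2 * H - 2)
      (\<lambda>r. fourier_wave_kernel t x r \<xi> - fourier_wave_kernel s x r \<xi>)
      (\<lambda>r. fourier_wave_kernel t x r \<xi> - fourier_wave_kernel s x r \<xi>)) \<le>
    6 * (2 / (2 * H - 1) + 8) * t * norm \<xi> powr (1 - 2 * H) * (min (t - s) (1 / norm \<xi>))\<^sup>2"
proof -
  define p where "p = 2 * H - 2"
  have p: "-1 < p" "p < 0" using H by (auto simp: p_def)
  define \<rho> where "\<rho> = norm \<xi>"
  have \<rho>: "0 < \<rho>" using \<xi> by (simp add: \<rho>_def)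
  define \<mu> where "\<mu> = min (t - s) (1 / \<rho>)"
  have \<mu>: "0 \<le> \<mu>" "\<mu> \<le> t - s" "\<mu> \<le> 1 / \<rho>" using st \<rho> by (auto simp: \<mu>_def)
  define \<kappa> where "\<kappa> r = indicator {0..t} r * (sin ((t - r) * \<rho>) / \<rho>) -
      indicator {0..s} r * (sin ((s - r) * \<rho>) / \<rho>)" for r
  define e where "e = exp (- (\<i> * of_real (\<xi> \<bullet> x)))"
  have ne: "norm e = 1" by (simp add: e_def)
  define C where "C = 2 / (p + 1) + 8"
  have C: "0 \<le> C" using p by (simp add: C_def)
  have k: "fourier_wave_kernel t x r \<xi> - fourier_wave_kernel s x r \<xi> = e * of_real (\<kappa> r)" for r
    by (simp add: fourier_wave_kernel_def fourier_wave_def \<kappa>_def e_def \<rho>_def indicator_def algebra_simps)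
  have sin_le: "\<bar>sin y / \<rho>\<bar> \<le> \<mu>" if "0 \<le> y" "y \<le> (t - s) * \<rho>" for y
  proof -
    have "\<bar>sin y\<bar> \<le> (t - s) * \<rho>" using abs_sin_x_le_abs_x[of y] that by linarith
    then show ?thesis using \<rho> abs_sin_le_one[of y] by (auto simp: \<mu>_def field_simps)
  qed
  have diff_eq: "sin ((t - r) * \<rho>) / \<rho> - sin ((s - r) * \<rho>) / \<rho> =
      2 * (sin ((t - s) * \<rho> / 2) / \<rho>) * cos ((t + s - 2 * r) * \<rho> / 2)" for r
    unfolding diff_divide_distrib[symmetric] sin_diff_sin by (simp add: algebra_simps)
  have half: "\<bar>sin ((t - s) * \<rho> / 2) / \<rho>\<bar> \<le> \<mu>"
    using st \<rho> by (intro sin_le) auto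
  have \<kappa>_le: "\<bar>\<kappa> v\<bar> \<le> 2 * \<mu> * indicator {0..t} v" for v
  proof -
    consider "v \<in> {0..s}" | "v \<in> {s<..t}" | "v \<notin> {0..t}" using st by fastforce
    then show ?thesis
    proof cases
      case 1
      then have "\<kappa> v = 2 * (sin ((t - s) * \<rho> / 2) / \<rho>) * cos ((t + s - 2 * v) * \<rho> / 2)"
        using st by (simp add: \<kappa>_def diff_eq)
      then have "\<bar>\<kappa> v\<bar> \<le> 2 * \<mu> * 1"
        using half abs_cos_le_one \<mu> by (simp only: abs_mult) (intro mult_mono, auto)
      then show ?thesis using 1 st by simp
    next
      case 2
      then have "\<kappa> v = sin ((t - v) * \<rho>) / \<rho>" using st by (simp add: \<kappa>_def)
      moreover have "\<bar>sin ((t - v) * \<rho>) / \<rho>\<bar> \<le> \<mu>"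
        using 2 \<rho> by (intro sin_le) (auto intro!: mult_right_mono)
      ultimately show ?thesis using 2 st \<mu> by simp
    next
      case 3
      then show ?thesis using st by (auto simp: \<kappa>_def)
    qed
  qed
  define J where "J v = (LINT r:{0..}|lborel. \<kappa> r * \<bar>r - v\<bar> powr p)" for v
  have J_le: "\<bar>J v\<bar> \<le> 3 * C * \<mu> * \<rho> powr (1 - 2 * H)" for v
  proof -
    have pow: "(1 / \<rho>) powr (p + 1) = \<rho> powr (1 - 2 * H)" "(1 / \<rho>) powr p = \<rho> * \<rho> powr (1 - 2 * H)"
    proof -
      show 1: "(1 / \<rho>) powr (p + 1) = \<rho> powr (1 - 2 * H)"
        using \<rho> by (simp add: powr_divide powr_minus_divide[symmetric] p_def)
      have "(1 / \<rho>) powr (p + 1) = (1 / \<rho>) powr p * (1 / \<rho>)"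
        using \<rho> by (subst powr_add) simp
      then show "(1 / \<rho>) powr p = \<rho> * \<rho> powr (1 - 2 * H)" using \<rho> 1 by (simp add: field_simps)
    qed
    have pot: "\<bar>LINT r:{a..b}|lborel. g r * \<bar>r - v\<bar> powr p\<bar> \<le> C * G * \<rho> powr (1 - 2 * H)"
      if "a \<le> b" "continuous_on {a..b} g" "\<And>r. r \<in> {a..b} \<Longrightarrow> \<bar>g r\<bar> \<le> G"
        "\<And>c d. a \<le> c \<Longrightarrow> c \<le> d \<Longrightarrow> d \<le> b \<Longrightarrow> \<bar>integral {c..d} g\<bar> \<le> 2 * G / \<rho>" for a b G and g :: "real \<Rightarrow> real"
    proof -
      have "\<bar>LINT r:{a..b}|lborel. g r * \<bar>r - v\<bar> powr p\<bar> \<le>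
          2 * G * (1 / \<rho>) powr (p + 1) / (p + 1) + 4 * (2 * G / \<rho>) * (1 / \<rho>) powr p"
        using p \<rho> that by (intro potential_bound) auto
      also have "\<dots> = C * G * \<rho> powr (1 - 2 * H)"
        unfolding pow using \<rho> by (simp add: C_def algebra_simps)
      finally show ?thesis .
    qed
    let ?g1 = "\<lambda>r. sin ((t - r) * \<rho>) / \<rho>" and ?g0 = "\<lambda>r. sin ((s - r) * \<rho>) / \<rho>"
    have cont: "continuous_on A ?g1" "continuous_on A ?g0" for A
      using \<rho> by (auto intro!: continuous_intros)
    note int1 = kernel_mult_integrable[OF p(1) cont(1)]
    note int0 = kernel_mult_integrable[OF p(1) cont(2)]
    have "J v = (LINT r:{0..t}|lborel. ?g1 r * \<bar>r - v\<bar> powr p) - (LINT r:{0..s}|lborel. ?g0 r * \<bar>r - v\<bar> powr p)"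
    proof -
      have eq: "indicator {0..} r *\<^sub>R (\<kappa> r * \<bar>r - v\<bar> powr p) =
          indicator {0..t} r *\<^sub>R (?g1 r * \<bar>r - v\<bar> powr p) - indicator {0..s} r *\<^sub>R (?g0 r * \<bar>r - v\<bar> powr p)" for r
        by (simp add: \<kappa>_def indicator_def left_diff_distrib)
      show ?thesis
        unfolding J_def set_lebesgue_integral_def eq
        using int1[of 0 t v] int0[of 0 s v] unfolding set_integrable_def
        by (rule Bochner_Integration.integral_diff)
    qed
    also have "(LINT r:{0..t}|lborel. ?g1 r * \<bar>r - v\<bar> powr p) =
        (LINT r:{0..s}|lborel. ?g1 r * \<bar>r - v\<bar> powr p) + (LINT r:{s..t}|lborel. ?g1 r * \<bar>r - v\<bar> powr p)"
      using st unfolding set_borel_integral_eq_integral(2)[OF int1]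
      by (intro Henstock_Kurzweil_Integration.integral_combine[symmetric]
          set_borel_integral_eq_integral(1)[OF int1])
    also have "\<dots> - (LINT r:{0..s}|lborel. ?g0 r * \<bar>r - v\<bar> powr p) =
        (LINT r:{0..s}|lborel. (?g1 r - ?g0 r) * \<bar>r - v\<bar> powr p) + (LINT r:{s..t}|lborel. ?g1 r * \<bar>r - v\<bar> powr p)"
      using set_integral_diff(2)[OF int1[of 0 s v] int0[of 0 s v]] by (simp add: left_diff_distrib)
    finally have J: "J v = (LINT r:{0..s}|lborel. (?g1 r - ?g0 r) * \<bar>r - v\<bar> powr p)
        + (LINT r:{s..t}|lborel. ?g1 r * \<bar>r - v\<bar> powr p)" .
    have "\<bar>LINT r:{s..t}|lborel. ?g1 r * \<bar>r - v\<bar> powr p\<bar> \<le> C * \<mu> * \<rho> powr (1 - 2 * H)"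
    proof (rule pot[OF st(2) cont(1)])
      show g1_le: "\<bar>?g1 r\<bar> \<le> \<mu>" if "r \<in> {s..t}" for r
        using that \<rho> by (intro sin_le) (auto intro!: mult_right_mono)
      \<comment> \<open>if \<open>t - s \<le> 1 / \<rho>\<close> there is no oscillation to exploit, but the interval itself is shorter than \<open>1 / \<rho>\<close>\<close>
      show "\<bar>integral {c..d} ?g1\<bar> \<le> 2 * \<mu> / \<rho>" if cd: "s \<le> c" "c \<le> d" "d \<le> t" for c d
      proof (cases "t - s \<le> 1 / \<rho>")
        case True
        have "\<bar>integral {c..d} ?g1\<bar> \<le> \<mu> * (d - c)"
          unfolding real_norm_def[symmetric] using cd g1_le
          by (intro integral_bound cont) auto
        also have "\<dots> \<le> \<mu> * (1 / \<rho>)" using cd True \<mu> by (intro mult_left_mono) auto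
        also have "\<dots> \<le> 2 * \<mu> / \<rho>" using \<mu> \<rho> by (simp add: field_simps)
        finally show ?thesis .
      next
        case False
        then have \<mu>': "\<mu> = 1 / \<rho>" by (simp add: \<mu>_def)
        have "(t - r) * \<rho> = - (\<rho> * r + (- t * \<rho>))" for r by (simp add: algebra_simps)
        then have "?g1 = (\<lambda>r. - (1 / \<rho>) * sin (\<rho> * r + (- t * \<rho>)))"
          by (simp only: sin_minus) simp
        then have "integral {c..d} ?g1 = - (1 / \<rho>) * integral {c..d} (\<lambda>r. sin (\<rho> * r + (- t * \<rho>)))"
          by (simp only: integral_mult_right)
        then have "\<bar>integral {c..d} ?g1\<bar> = (1 / \<rho>) * \<bar>integral {c..d} (\<lambda>r. sin (\<rho> * r + (- t * \<rho>)))\<bar>"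
          using \<rho> by (simp add: abs_mult)
        also have "\<dots> \<le> (1 / \<rho>) * (2 / \<rho>)"
          using \<rho> cd by (intro mult_left_mono integral_sin_affine_bound) auto
        finally show ?thesis by (simp add: \<mu>' mult_ac)
      qed
    qed
    moreover have "\<bar>LINT r:{0..s}|lborel. (?g1 r - ?g0 r) * \<bar>r - v\<bar> powr p\<bar> \<le> C * (2 * \<mu>) * \<rho> powr (1 - 2 * H)"
    proof (rule pot[OF st(1)])
      show "continuous_on {0..s} (\<lambda>r. ?g1 r - ?g0 r)" by (intro continuous_on_diff cont)
      show "\<bar>?g1 r - ?g0 r\<bar> \<le> 2 * \<mu>" for r
      proof -
        have "\<bar>?g1 r - ?g0 r\<bar> \<le> 2 * \<mu> * 1"
          unfolding diff_eq using half abs_cos_le_one \<mu> by (simp only: abs_mult) (intro mult_mono, auto)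
        then show ?thesis by simp
      qed
      show "\<bar>integral {c..d} (\<lambda>r. ?g1 r - ?g0 r)\<bar> \<le> 2 * (2 * \<mu>) / \<rho>" if cd: "c \<le> d" for c d
      proof -
        let ?A = "2 * (sin ((t - s) * \<rho> / 2) / \<rho>)" and ?\<theta> = "pi / 2 - (t + s) * \<rho> / 2"
        have "?g1 r - ?g0 r = ?A * sin (\<rho> * r + ?\<theta>)" for r
        proof -
          have "pi / 2 - (t + s - 2 * r) * \<rho> / 2 = \<rho> * r + ?\<theta>"
            by (simp add: field_simps)
          then have "cos ((t + s - 2 * r) * \<rho> / 2) = sin (\<rho> * r + ?\<theta>)"
            using cos_sin_eq[of "(t + s - 2 * r) * \<rho> / 2"] by (simp only: of_real_eq_id id_apply)
          then show ?thesis unfolding diff_eq by simp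
        qed
        then have "integral {c..d} (\<lambda>r. ?g1 r - ?g0 r) = ?A * integral {c..d} (\<lambda>r. sin (\<rho> * r + ?\<theta>))"
          by (simp only: integral_mult_right)
        then have "\<bar>integral {c..d} (\<lambda>r. ?g1 r - ?g0 r)\<bar> = \<bar>?A\<bar> * \<bar>integral {c..d} (\<lambda>r. sin (\<rho> * r + ?\<theta>))\<bar>"
          by (simp only: abs_mult)
        also have "\<dots> \<le> (2 * \<mu>) * (2 / \<rho>)"
          using \<rho> cd half \<mu> by (intro mult_mono integral_sin_affine_bound) auto
        finally show ?thesis by simp
      qed
    qed
    ultimately have "\<bar>J v\<bar> \<le> C * (2 * \<mu>) * \<rho> powr (1 - 2 * H) + C * \<mu> * \<rho> powr (1 - 2 * H)"
      unfolding J by linarith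
    then show ?thesis by (simp add: algebra_simps)
  qed
  have inner: "(LINT r:{0..}|lborel. (e * of_real (\<kappa> r)) * cnj (e * of_real (\<kappa> v)) * of_real (\<bar>r - v\<bar> powr p))
      = of_real (\<kappa> v * J v)" for v
  proof -
    have "e * cnj e = 1" using complex_norm_square[of e] ne by simp
    then have "(LINT r:{0..}|lborel. (e * of_real (\<kappa> r)) * cnj (e * of_real (\<kappa> v)) * of_real (\<bar>r - v\<bar> powr p)) =
        (LINT r:{0..}|lborel. complex_of_real (\<kappa> v * (\<kappa> r * \<bar>r - v\<bar> powr p)))"
      by (intro set_lebesgue_integral_cong) (auto simp: algebra_simps)
    also have "\<dots> = (LINT r|lborel. complex_of_real (\<kappa> v * (indicator {0..} r *\<^sub>R (\<kappa> r * \<bar>r - v\<bar> powr p))))"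
      unfolding set_lebesgue_integral_def
      by (intro Bochner_Integration.integral_cong) (auto simp: indicator_def)
    also have "\<dots> = of_real (\<kappa> v * J v)"
      by (simp only: integral_complex_of_real integral_mult_right_zero J_def set_lebesgue_integral_def)
    finally show ?thesis .
  qed
  have "norm (kernel_form p (\<lambda>r. e * of_real (\<kappa> r)) (\<lambda>r. e * of_real (\<kappa> r)))
      \<le> (LINT v|lborel. indicator {0..t} v * (2 * \<mu> * (3 * C * \<mu> * \<rho> powr (1 - 2 * H))))"
    unfolding kernel_form_def inner
    unfolding set_lebesgue_integral_def
  proof (cases "integrable lborel (\<lambda>v. indicator {0..} v *\<^sub>R complex_of_real (\<kappa> v * J v))")
    case True
    then show "norm (LINT v|lborel. indicator {0..} v *\<^sub>R complex_of_real (\<kappa> v * J v))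
      \<le> (LINT v|lborel. indicator {0..t} v * (2 * \<mu> * (3 * C * \<mu> * \<rho> powr (1 - 2 * H))))"
    proof (rule Bochner_Integration.integral_norm_bound_integral)
      show "norm (indicator {0..} v *\<^sub>R complex_of_real (\<kappa> v * J v)) \<le>
          indicator {0..t} v * (2 * \<mu> * (3 * C * \<mu> * \<rho> powr (1 - 2 * H)))" for v
      proof -
        have "norm (indicator {0..} v *\<^sub>R complex_of_real (\<kappa> v * J v)) \<le> \<bar>\<kappa> v\<bar> * \<bar>J v\<bar>"
          by (auto simp: abs_mult indicator_def norm_mult)
        also have "\<dots> \<le> (2 * \<mu> * indicator {0..t} v) * (3 * C * \<mu> * \<rho> powr (1 - 2 * H))"
          using \<mu> by (intro mult_mono \<kappa>_le J_le) auto
        finally show ?thesis by (simp add: mult_ac)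
      qed
    qed (auto intro!: integrable_mult_left simp: emeasure_lborel_Icc_eq)
  qed (use \<mu> C st in \<open>simp add: not_integrable_integral_eq\<close>)
  also have "\<dots> = 6 * C * t * \<rho> powr (1 - 2 * H) * \<mu>\<^sup>2"
    using st by (simp add: power2_eq_square mult_ac)
  finally show ?thesis
    unfolding k p_def[symmetric] by (simp add: C_def \<rho>_def[symmetric] \<mu>_def p_def algebra_simps)
qed

section \<open>Radial integrals against the Riesz measure\<close>

text \<open>The integrand is \<open>h\<^sup>2 * s powr (\<gamma> - 1)\<close> up to \<open>s = 1 / h\<close> and \<open>s powr (\<gamma> - 3)\<close> from there on.\<close>

lemma nn_integral_truncated_powr:
  fixes h \<gamma> :: real
  assumes \<gamma>: "0 < \<gamma>" "\<gamma> < 2" and h: "0 < h"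
  shows "(\<integral>\<^sup>+s. ennreal (indicator {0..} s * (s powr (\<gamma> - 1) * (min h (1 / s))\<^sup>2)) \<partial>lborel) \<le>
    ennreal (h powr (2 - \<gamma>) * (1 / \<gamma> + 1 / (2 - \<gamma>)))"
proof -
  have "(\<integral>\<^sup>+s. ennreal (indicator {0..} s * (s powr (\<gamma> - 1) * (min h (1 / s))\<^sup>2)) \<partial>lborel) \<le>
    (\<integral>\<^sup>+s. ennreal (h\<^sup>2) * ennreal (indicator {0..1/h} s * \<bar>s - 0\<bar> powr (\<gamma> - 1)) +
      ennreal (indicator {1/h..} s * s powr (\<gamma> - 3)) \<partial>lborel)"
  proof (rule nn_integral_mono)
    fix s :: real
    consider "s < 0" | "0 \<le> s" "s \<le> 1 / h" | "1 / h < s" by linarith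
    then show "ennreal (indicator {0..} s * (s powr (\<gamma> - 1) * (min h (1 / s))\<^sup>2)) \<le>
      ennreal (h\<^sup>2) * ennreal (indicator {0..1/h} s * \<bar>s - 0\<bar> powr (\<gamma> - 1)) +
      ennreal (indicator {1/h..} s * s powr (\<gamma> - 3))"
    proof cases
      case 2
      have "(min h (1 / s))\<^sup>2 \<le> h\<^sup>2" using 2 h by (intro power_mono) auto
      then have "s powr (\<gamma> - 1) * (min h (1 / s))\<^sup>2 \<le> h\<^sup>2 * s powr (\<gamma> - 1)"
        by (subst mult.commute) (intro mult_right_mono, auto)
      then have "ennreal (indicator {0..} s * (s powr (\<gamma> - 1) * (min h (1 / s))\<^sup>2)) \<le>
          ennreal (h\<^sup>2) * ennreal (indicator {0..1/h} s * \<bar>s - 0\<bar> powr (\<gamma> - 1))"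
        using 2 by (simp add: ennreal_mult[symmetric] ennreal_leI)
      then show ?thesis by (rule order_trans) simp
    next
      case 3
      then have s: "0 < s" using h by (meson less_trans zero_less_divide_1_iff)
      have "(min h (1 / s))\<^sup>2 \<le> (1 / s)\<^sup>2" using s h by (intro power_mono) auto
      then have "s powr (\<gamma> - 1) * (min h (1 / s))\<^sup>2 \<le> s powr (\<gamma> - 1) * (1 / s)\<^sup>2"
        by (intro mult_left_mono) auto
      also have "\<dots> = s powr (\<gamma> - 3)"
      proof -
        have "s powr (\<gamma> - 3) = s powr ((\<gamma> - 1) - 2)" by simp
        also have "\<dots> = s powr (\<gamma> - 1) / s powr 2" by (rule powr_diff)
        also have "\<dots> = s powr (\<gamma> - 1) * (1 / s)\<^sup>2" using s by (simp add: powr_numeral power_divide)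
        finally show ?thesis by simp
      qed
      finally have "ennreal (indicator {0..} s * (s powr (\<gamma> - 1) * (min h (1 / s))\<^sup>2)) \<le>
          ennreal (indicator {1/h..} s * s powr (\<gamma> - 3))"
        using 3 s by (simp add: ennreal_leI)
      then show ?thesis by (rule order_trans) simp
    qed simp
  qed
  also have "\<dots> = (\<integral>\<^sup>+s. ennreal (h\<^sup>2) * ennreal (indicator {0..1/h} s * \<bar>s - 0\<bar> powr (\<gamma> - 1)) \<partial>lborel) +
      (\<integral>\<^sup>+s. ennreal (indicator {1/h..} s * s powr (\<gamma> - 3)) \<partial>lborel)"
    by (rule nn_integral_add) auto
  also have "(\<integral>\<^sup>+s. ennreal (h\<^sup>2) * ennreal (indicator {0..1/h} s * \<bar>s - 0\<bar> powr (\<gamma> - 1)) \<partial>lborel) =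
      ennreal (h\<^sup>2) * ennreal ((1 / h) powr \<gamma> / \<gamma>)"
    using \<gamma> h nn_integral_abs_powr[of "\<gamma> - 1" 0 "1 / h" 0]
    by (subst nn_integral_cmult) (auto simp: abs_powr_primitive_def max_def)
  also have "(\<integral>\<^sup>+s. ennreal (indicator {1/h..} s * s powr (\<gamma> - 3)) \<partial>lborel) = ennreal ((1 / h) powr (\<gamma> - 2) / (2 - \<gamma>))"
  proof (rule nn_integral_has_integral_lborel)
    have eq: "(\<lambda>s. indicator {1/h..} s * s powr (\<gamma> - 3)) = (\<lambda>s. if s \<in> {1/h..} then s powr (\<gamma> - 3) else 0)"
      by (auto simp: indicator_def)
    have "- ((1 / h) powr (\<gamma> - 3 + 1)) / (\<gamma> - 3 + 1) = (1 / h) powr (\<gamma> - 2) / (2 - \<gamma>)"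
      using \<gamma> by (simp add: field_simps)
    moreover have "((\<lambda>s. s powr (\<gamma> - 3)) has_integral - ((1 / h) powr (\<gamma> - 3 + 1)) / (\<gamma> - 3 + 1)) {1/h..}"
      using has_integral_powr_to_inf[of "\<gamma> - 3" "1 / h"] \<gamma> h by simp
    ultimately show "((\<lambda>s. indicator {1/h..} s * s powr (\<gamma> - 3)) has_integral (1 / h) powr (\<gamma> - 2) / (2 - \<gamma>)) UNIV"
      unfolding eq has_integral_restrict_UNIV by simp
  qed auto
  also have "ennreal (h\<^sup>2) * ennreal ((1 / h) powr \<gamma> / \<gamma>) + ennreal ((1 / h) powr (\<gamma> - 2) / (2 - \<gamma>)) =
      ennreal (h\<^sup>2 * ((1 / h) powr \<gamma> / \<gamma>) + (1 / h) powr (\<gamma> - 2) / (2 - \<gamma>))"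
    using \<gamma> by (simp add: ennreal_mult[symmetric] ennreal_plus[symmetric] del: ennreal_plus)
  also have "h\<^sup>2 * ((1 / h) powr \<gamma> / \<gamma>) + (1 / h) powr (\<gamma> - 2) / (2 - \<gamma>) = h powr (2 - \<gamma>) * (1 / \<gamma> + 1 / (2 - \<gamma>))"
  proof -
    have "h\<^sup>2 * (1 / h) powr \<gamma> = h powr (2 - \<gamma>)"
      using h by (simp add: powr_diff powr_divide powr_numeral)
    moreover have "(1 / h) powr (\<gamma> - 2) = h powr (2 - \<gamma>)"
      using h by (simp add: powr_divide powr_minus_divide[symmetric])
    ultimately show ?thesis by (simp add: distrib_left)
  qed
  finally show ?thesis .
qed

text \<open>A layer-cake argument takes the place of polar coordinates. Let \<open>w s\<close> be the integrand at radius \<open>s\<close> divided by \<open>s\<close>. As \<open>w\<close>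
is decreasing and doubling, the integrand at \<open>\<xi>\<close> is at most a constant times the integral of \<open>w\<close> over
\<open>{norm \<xi>..}\<close>, in fact over \<open>{norm \<xi>..2 * norm \<xi>}\<close>. Exchanging the integrations replaces \<open>\<xi>\<close> by the volume of the ball
of radius \<open>s\<close>, and what is left is the one-dimensional integral above.\<close>

lemma radial_integral_bound:
  fixes \<gamma> :: real
  assumes \<gamma>: "0 < \<gamma>" "\<gamma> < 2"
  shows "\<exists>K\<ge>0. \<forall>h>0. (\<integral>\<^sup>+\<xi>. ennreal (norm \<xi> powr (\<gamma> - real DIM('a)) * (min h (1 / norm \<xi>))\<^sup>2)
    \<partial>(lborel :: 'a::euclidean_space measure)) \<le> ennreal (K * h powr (2 - \<gamma>))"
proof -
  define d where "d = real DIM('a)"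
  have d: "1 \<le> d" using DIM_positive[where 'a = 'a] by (simp add: d_def Suc_leI)
  define V where "V = unit_ball_vol d"
  have V: "0 \<le> V" by (simp add: V_def d_def)
  define c where "c = 2 powr (\<gamma> - d - 1) / 4"
  have c: "0 < c" by (simp add: c_def)
  have "(\<integral>\<^sup>+\<xi>. ennreal (norm \<xi> powr (\<gamma> - d) * (min h (1 / norm \<xi>))\<^sup>2) \<partial>(lborel :: 'a measure)) \<le>
    ennreal (V / c * (1 / \<gamma> + 1 / (2 - \<gamma>)) * h powr (2 - \<gamma>))" if h: "0 < h" for h
  proof -
    define w where "w s = s powr (\<gamma> - d - 1) * (min h (1 / s))\<^sup>2" for s
    have w0: "0 \<le> w s" for s by (simp add: w_def)
    have w_meas [measurable]: "w \<in> borel_measurable borel" unfolding w_def by measurable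
    define Z where "Z = {z :: 'a \<times> real. norm (fst z) \<le> snd z}"
    have Z [measurable]: "Z \<in> sets (lborel \<Otimes>\<^sub>M lborel)"
    proof -
      have "Z = {z \<in> space (lborel \<Otimes>\<^sub>M lborel). norm (fst z) \<le> snd z}"
        by (simp add: Z_def space_pair_measure)
      also have "\<dots> \<in> sets (lborel \<Otimes>\<^sub>M lborel)" by measurable
      finally show ?thesis .
    qed
    have lower: "ennreal (norm \<xi> powr (\<gamma> - d) * (min h (1 / norm \<xi>))\<^sup>2) \<le>
        ennreal (1 / c) * (\<integral>\<^sup>+s. ennreal (w s) * indicator Z (\<xi>, s) \<partial>lborel)" for \<xi> :: 'a
    proof (cases "\<xi> = 0")
      case False
      define \<rho> where "\<rho> = norm \<xi>"
      have \<rho>: "0 < \<rho>" using False by (simp add: \<rho>_def)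
      have w2: "c * (\<rho> powr (\<gamma> - d) * (min h (1 / \<rho>))\<^sup>2) \<le> w (2 * \<rho>) * \<rho>"
      proof -
        have "min h (1 / \<rho>) / 2 \<le> min h (1 / (2 * \<rho>))" using h \<rho> by (auto simp: min_def field_simps)
        then have "(min h (1 / \<rho>) / 2)\<^sup>2 \<le> (min h (1 / (2 * \<rho>)))\<^sup>2"
          using h \<rho> by (intro power_mono) auto
        then have "(min h (1 / \<rho>))\<^sup>2 / 4 \<le> (min h (1 / (2 * \<rho>)))\<^sup>2"
          by (simp add: power_divide)
        then have "(2 * \<rho>) powr (\<gamma> - d - 1) * \<rho> * ((min h (1 / \<rho>))\<^sup>2 / 4) \<le>
            (2 * \<rho>) powr (\<gamma> - d - 1) * \<rho> * (min h (1 / (2 * \<rho>)))\<^sup>2"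
          using \<rho> by (intro mult_left_mono) auto
        moreover have eq: "(2 * \<rho>) powr (\<gamma> - d - 1) * \<rho> = 2 powr (\<gamma> - d - 1) * \<rho> powr (\<gamma> - d)"
        proof -
          have "\<rho> powr (\<gamma> - d) = \<rho> powr ((\<gamma> - d - 1) + 1)" by simp
          also have "\<dots> = \<rho> powr (\<gamma> - d - 1) * \<rho>" using \<rho> by (subst powr_add) simp
          finally show ?thesis using \<rho> by (simp add: powr_mult)
        qed
        moreover have "c * (\<rho> powr (\<gamma> - d) * (min h (1 / \<rho>))\<^sup>2) =
            (2 * \<rho>) powr (\<gamma> - d - 1) * \<rho> * ((min h (1 / \<rho>))\<^sup>2 / 4)"
          unfolding eq by (simp add: c_def)
        moreover have "w (2 * \<rho>) * \<rho> = (2 * \<rho>) powr (\<gamma> - d - 1) * \<rho> * (min h (1 / (2 * \<rho>)))\<^sup>2"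
          by (simp only: w_def mult_ac)
        ultimately show ?thesis by linarith
      qed
      have w_mono: "w (2 * \<rho>) \<le> w s" if "s \<in> {\<rho>..2 * \<rho>}" for s
        unfolding w_def
      proof (rule mult_mono)
        show "(2 * \<rho>) powr (\<gamma> - d - 1) \<le> s powr (\<gamma> - d - 1)"
          using that \<rho> \<gamma> d by (intro powr_mono2') auto
        show "(min h (1 / (2 * \<rho>)))\<^sup>2 \<le> (min h (1 / s))\<^sup>2"
          using that \<rho> h by (intro power_mono min.mono divide_left_mono) auto
      qed auto
      have "ennreal (c * (\<rho> powr (\<gamma> - d) * (min h (1 / \<rho>))\<^sup>2)) \<le> ennreal (w (2 * \<rho>) * \<rho>)"
        using w2 by (rule ennreal_leI)
      also have "\<dots> = ennreal (w (2 * \<rho>)) * emeasure lborel {\<rho>..2 * \<rho>}"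
        using \<rho> w0 by (simp add: ennreal_mult)
      also have "\<dots> = (\<integral>\<^sup>+s. ennreal (w (2 * \<rho>)) * indicator {\<rho>..2 * \<rho>} s \<partial>lborel)"
        by (subst nn_integral_cmult_indicator) auto
      also have "\<dots> \<le> (\<integral>\<^sup>+s. ennreal (w s) * indicator Z (\<xi>, s) \<partial>lborel)"
        using w_mono by (intro nn_integral_mono) (auto simp: Z_def \<rho>_def indicator_def ennreal_leI)
      finally have *: "ennreal (c * (\<rho> powr (\<gamma> - d) * (min h (1 / \<rho>))\<^sup>2)) \<le>
          (\<integral>\<^sup>+s. ennreal (w s) * indicator Z (\<xi>, s) \<partial>lborel)" .
      have "ennreal (\<rho> powr (\<gamma> - d) * (min h (1 / \<rho>))\<^sup>2) =
          ennreal (1 / c) * ennreal (c * (\<rho> powr (\<gamma> - d) * (min h (1 / \<rho>))\<^sup>2))"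
        using c by (simp add: ennreal_mult[symmetric])
      also have "\<dots> \<le> ennreal (1 / c) * (\<integral>\<^sup>+s. ennreal (w s) * indicator Z (\<xi>, s) \<partial>lborel)"
        by (intro mult_left_mono *) auto
      finally show ?thesis by (simp add: \<rho>_def)
    qed simp
    have ball: "(\<integral>\<^sup>+\<xi>. ennreal (w s) * indicator Z (\<xi>, s) \<partial>lborel) =
        ennreal V * ennreal (indicator {0..} s * (s powr (\<gamma> - 1) * (min h (1 / s))\<^sup>2))" for s
    proof -
      have "(\<integral>\<^sup>+\<xi>. ennreal (w s) * indicator Z (\<xi>, s) \<partial>lborel) =
          (\<integral>\<^sup>+\<xi>. ennreal (w s) * indicator (cball (0 :: 'a) s) \<xi> \<partial>lborel)"
        by (intro nn_integral_cong) (auto simp: Z_def indicator_def)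
      also have "\<dots> = ennreal (w s) * emeasure lborel (cball (0 :: 'a) s)"
        by (subst nn_integral_cmult_indicator) auto
      also have "\<dots> = ennreal V * ennreal (indicator {0..} s * (s powr (\<gamma> - 1) * (min h (1 / s))\<^sup>2))"
      proof (cases "0 < s")
        case True
        have "w s * s ^ DIM('a) = s powr (\<gamma> - 1) * (min h (1 / s))\<^sup>2"
        proof -
          have "s powr (\<gamma> - 1) = s powr ((\<gamma> - d - 1) + d)" by simp
          also have "\<dots> = s powr (\<gamma> - d - 1) * s ^ DIM('a)"
            using True by (subst powr_add) (simp add: d_def powr_realpow)
          finally show ?thesis by (simp add: w_def)
        qed
        then show ?thesis
          using True V w0[of s] by (simp add: emeasure_cball V_def[symmetric] d_def[symmetric] ennreal_mult[symmetric] mult_ac)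
      next
        case False
        then consider "s = 0" | "s < 0" by linarith
        then show ?thesis by cases (simp_all add: w_def)
      qed
      finally show ?thesis .
    qed
    have "(\<integral>\<^sup>+\<xi>. ennreal (norm \<xi> powr (\<gamma> - d) * (min h (1 / norm \<xi>))\<^sup>2) \<partial>(lborel :: 'a measure)) \<le>
        (\<integral>\<^sup>+\<xi>. ennreal (1 / c) * (\<integral>\<^sup>+s. ennreal (w s) * indicator Z (\<xi>, s) \<partial>lborel) \<partial>lborel)"
      by (intro nn_integral_mono lower)
    also have "\<dots> = ennreal (1 / c) * (\<integral>\<^sup>+\<xi>. \<integral>\<^sup>+s. ennreal (w s) * indicator Z (\<xi>, s) \<partial>lborel \<partial>lborel)"
      by (intro nn_integral_cmult) measurable
    also have "(\<integral>\<^sup>+\<xi>. \<integral>\<^sup>+s. ennreal (w s) * indicator Z (\<xi>, s) \<partial>lborel \<partial>lborel) =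
        (\<integral>\<^sup>+s. \<integral>\<^sup>+\<xi>. ennreal (w s) * indicator Z (\<xi>, s) \<partial>lborel \<partial>lborel)"
      by (intro lborel_pair.Fubini'[symmetric]) measurable
    also have "\<dots> = ennreal V * (\<integral>\<^sup>+s. ennreal (indicator {0..} s * (s powr (\<gamma> - 1) * (min h (1 / s))\<^sup>2)) \<partial>lborel)"
      unfolding ball by (intro nn_integral_cmult) measurable
    also have "ennreal (1 / c) * \<dots> \<le> ennreal (1 / c) * (ennreal V * ennreal (h powr (2 - \<gamma>) * (1 / \<gamma> + 1 / (2 - \<gamma>))))"
      by (intro mult_left_mono nn_integral_truncated_powr \<gamma> h) auto
    also have "\<dots> = ennreal (V / c * (1 / \<gamma> + 1 / (2 - \<gamma>)) * h powr (2 - \<gamma>))"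
      using V c \<gamma> by (simp add: ennreal_mult[symmetric] mult_ac)
    finally show ?thesis .
  qed
  moreover have "0 \<le> V / c * (1 / \<gamma> + 1 / (2 - \<gamma>))" using V c \<gamma> by simp
  ultimately show ?thesis unfolding d_def by blast
qed

lemma nn_integral_riesz_measure:
  assumes "f \<in> borel_measurable borel"
  shows "(\<integral>\<^sup>+\<xi>. f \<xi> \<partial>riesz_measure \<beta>) =
    (\<integral>\<^sup>+\<xi>. ennreal (norm \<xi> powr (- real DIM('a) + \<beta>)) * f \<xi> \<partial>(lborel :: 'a::euclidean_space measure))"
  unfolding riesz_measure_def using assms by (intro nn_integral_density) measurable

lemma sets_riesz_measure [simp, measurable_cong]: "sets (riesz_measure \<beta>) = sets borel"
  and space_riesz_measure [simp]: "space (riesz_measure \<beta>) = UNIV"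
  by (simp_all add: riesz_measure_def)

text \<open>Together with the density of the Riesz measure, the integrand is the radial one with
\<open>\<gamma> = \<beta> + 1 - 2 * H\<close>, and the two hypotheses on \<open>\<beta>\<close> say that \<open>0 < \<gamma> < 2\<close>.\<close>

lemma riesz_measure_increment_bound:
  assumes H: "1 / 2 < H" and \<beta>: "2 * H - 1 < \<beta>" "\<beta> < 2 * H + 1"
  shows "\<exists>K\<ge>0. \<forall>h>0. (\<integral>\<^sup>+\<xi>. ennreal (norm \<xi> powr (1 - 2 * H) * (min h (1 / norm \<xi>))\<^sup>2)
    \<partial>(riesz_measure \<beta> :: 'a::euclidean_space measure)) \<le> ennreal (K * h powr (2 * H + 1 - \<beta>))"
proof -
  have eq: "(\<integral>\<^sup>+\<xi>. ennreal (norm \<xi> powr (1 - 2 * H) * (min h (1 / norm \<xi>))\<^sup>2) \<partial>(riesz_measure \<beta> :: 'a measure)) =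
    (\<integral>\<^sup>+\<xi>. ennreal (norm \<xi> powr ((\<beta> + 1 - 2 * H) - real DIM('a)) * (min h (1 / norm \<xi>))\<^sup>2) \<partial>(lborel :: 'a measure))" for h
  proof (subst nn_integral_riesz_measure, measurable, intro nn_integral_cong)
    fix \<xi> :: 'a
    have "norm \<xi> powr ((\<beta> + 1 - 2 * H) - real DIM('a)) = norm \<xi> powr (- real DIM('a) + \<beta>) * norm \<xi> powr (1 - 2 * H)"
      by (subst powr_add[symmetric]) (simp add: algebra_simps)
    then show "ennreal (norm \<xi> powr (- real DIM('a) + \<beta>)) * ennreal (norm \<xi> powr (1 - 2 * H) * (min h (1 / norm \<xi>))\<^sup>2) =
        ennreal (norm \<xi> powr ((\<beta> + 1 - 2 * H) - real DIM('a)) * (min h (1 / norm \<xi>))\<^sup>2)"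
      by (simp add: ennreal_mult[symmetric] mult.assoc)
  qed
  show ?thesis
    unfolding eq using radial_integral_bound[of "\<beta> + 1 - 2 * H", where 'a = 'a] \<beta> by (simp add: algebra_simps)
qed

section \<open>Gaussians as test functions\<close>

lemma real_polynomial_function_growth:
  fixes p :: "'a::euclidean_space \<Rightarrow> real"
  assumes "real_polynomial_function p"
  shows "\<exists>C n. 0 \<le> C \<and> (\<forall>x. \<bar>p x\<bar> \<le> C * (1 + norm x) ^ n)"
  using assms
proof (induction rule: real_polynomial_function.induct)
  case (linear f)
  then obtain K where K: "\<And>x. norm (f x) \<le> norm x * K" "0 \<le> K"
    using bounded_linear.nonneg_bounded by blast
  then have "\<bar>f x\<bar> \<le> K * (1 + norm x) ^ 1" for x
  proof -
    have "norm x * K \<le> K * (1 + norm x) ^ 1" using K(2) by (simp add: algebra_simps)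
    then show ?thesis using K(1)[of x] by simp
  qed
  then show ?case using K(2) by blast
next
  case (const c)
  then show ?case by (intro exI[of _ "\<bar>c\<bar>"] exI[of _ 0]) auto
next
  case (add f g)
  then obtain C n D m where f: "0 \<le> C" "\<And>x. \<bar>f x\<bar> \<le> C * (1 + norm x) ^ n"
    and g: "0 \<le> D" "\<And>x. \<bar>g x\<bar> \<le> D * (1 + norm x) ^ m" by blast
  have "\<bar>f x + g x\<bar> \<le> (C + D) * (1 + norm x) ^ (n + m)" for x
  proof -
    have "(1 + norm x) ^ n \<le> (1 + norm x) ^ (n + m)" "(1 + norm x) ^ m \<le> (1 + norm x) ^ (n + m)"
      by (intro power_increasing; simp)+
    then have "C * (1 + norm x) ^ n \<le> C * (1 + norm x) ^ (n + m)" "D * (1 + norm x) ^ m \<le> D * (1 + norm x) ^ (n + m)"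
      using f g by (auto intro: mult_left_mono)
    then show ?thesis using f(2)[of x] g(2)[of x] by (simp add: distrib_right)
  qed
  then show ?case using f(1) g(1) by (intro exI[of _ "C + D"] exI[of _ "n + m"]) auto
next
  case (mult f g)
  then obtain C n D m where f: "0 \<le> C" "\<And>x. \<bar>f x\<bar> \<le> C * (1 + norm x) ^ n"
    and g: "0 \<le> D" "\<And>x. \<bar>g x\<bar> \<le> D * (1 + norm x) ^ m" by blast
  have "\<bar>f x * g x\<bar> \<le> (C * D) * (1 + norm x) ^ (n + m)" for x
  proof -
    have "\<bar>f x * g x\<bar> \<le> (C * (1 + norm x) ^ n) * (D * (1 + norm x) ^ m)"
      unfolding abs_mult using f g by (intro mult_mono) auto
    then show ?thesis by (simp add: power_add mult_ac)
  qed
  then show ?case using f(1) g(1) by (intro exI[of _ "C * D"] exI[of _ "n + m"]) auto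
qed

definition gaussian :: "real \<Rightarrow> 'a::euclidean_space \<Rightarrow> 'a \<Rightarrow> real" where
  "gaussian c a x = exp (- (c * (norm (x - a))\<^sup>2))"

lemma gaussian_nonneg [simp]: "0 \<le> gaussian c a x" by (simp add: gaussian_def)

text \<open>In terms of the distance to the centre \<open>a\<close> the claim is one-dimensional, since
\<open>norm x \<le> norm a + norm (x - a)\<close>.\<close>

lemma gaussian_decay:
  assumes c: "0 < c"
  shows "\<exists>B. \<forall>x. (1 + norm x) ^ n * gaussian c a x \<le> B"
proof -
  have lim: "((\<lambda>t. (1 + norm a + t) ^ n * exp (- (c * t\<^sup>2))) \<longlongrightarrow> 0) at_top"
    using c by real_asymp
  then have "\<forall>\<^sub>F t in at_top. (1 + norm a + t) ^ n * exp (- (c * t\<^sup>2)) < 1"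
    by (rule order_tendstoD(2)) simp
  then obtain t0 where t0: "\<And>t. t \<ge> t0 \<Longrightarrow> (1 + norm a + t) ^ n * exp (- (c * t\<^sup>2)) < 1"
    by (auto simp: eventually_at_top_linorder)
  have "(1 + norm x) ^ n * gaussian c a x \<le> 1 + (1 + norm a + \<bar>t0\<bar>) ^ n" for x
  proof -
    have nx: "norm x \<le> norm a + norm (x - a)" by (metis add.commute diff_add_cancel norm_triangle_ineq)
    have "(1 + norm x) ^ n * gaussian c a x \<le> (1 + norm a + norm (x - a)) ^ n * gaussian c a x"
      using nx by (intro mult_right_mono power_mono) auto
    also have "\<dots> \<le> 1 + (1 + norm a + \<bar>t0\<bar>) ^ n"
    proof (cases "t0 \<le> norm (x - a)")
      case True
      then have "(1 + norm a + norm (x - a)) ^ n * gaussian c a x < 1"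
        using t0 by (simp add: gaussian_def)
      moreover have "0 \<le> (1 + norm a + \<bar>t0\<bar>) ^ n" by simp
      ultimately show ?thesis by linarith
    next
      case False
      then have "(1 + norm a + norm (x - a)) ^ n * gaussian c a x \<le> (1 + norm a + \<bar>t0\<bar>) ^ n * 1"
        using c by (intro mult_mono power_mono) (auto simp: gaussian_def)
      then show ?thesis by simp
    qed
    finally show ?thesis .
  qed
  then show ?thesis by blast
qed

lemma real_polynomial_function_has_derivative:
  fixes p :: "'a::euclidean_space \<Rightarrow> real"
  assumes "real_polynomial_function p"
  shows "\<exists>p'. (\<forall>x. (p has_derivative p' x) (at x)) \<and> (\<forall>b. real_polynomial_function (\<lambda>x. p' x b))"
  using assms
proof (induction rule: real_polynomial_function.induct)
  case (linear f)
  then show ?case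
    by (intro exI[of _ "\<lambda>_. f"]) (auto intro: bounded_linear_imp_has_derivative real_polynomial_function.intros)
next
  case (const c)
  show ?case by (intro exI[of _ "\<lambda>_ _. 0"]) (auto intro: real_polynomial_function.intros)
next
  case (add f g)
  then obtain f' g' where "\<And>x. (f has_derivative f' x) (at x)" "\<And>b. real_polynomial_function (\<lambda>x. f' x b)"
    "\<And>x. (g has_derivative g' x) (at x)" "\<And>b. real_polynomial_function (\<lambda>x. g' x b)" by blast
  then show ?case
    by (intro exI[of _ "\<lambda>x b. f' x b + g' x b"])
      (auto intro: real_polynomial_function.intros has_derivative_add)
next
  case (mult f g)
  then obtain f' g' where *: "\<And>x. (f has_derivative f' x) (at x)" "\<And>b. real_polynomial_function (\<lambda>x. f' x b)"
    "\<And>x. (g has_derivative g' x) (at x)" "\<And>b. real_polynomial_function (\<lambda>x. g' x b)" by blast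
  have "\<And>x. ((\<lambda>x. f x * g x) has_derivative (\<lambda>b. f x * g' x b + f' x b * g x)) (at x)"
    by (intro has_derivative_mult *)
  then show ?case
    using * mult.hyps by (intro exI[of _ "\<lambda>x b. f x * g' x b + f' x b * g x"])
      (auto intro!: real_polynomial_function.intros(3) real_polynomial_function.intros(4))
qed

lemma gaussian_has_derivative:
  "(gaussian c a has_derivative (\<lambda>h. - (2 * c * ((x - a) \<bullet> h)) * gaussian c a x)) (at x)"
  unfolding gaussian_def[abs_def] power2_norm_eq_inner
  by (auto intro!: derivative_eq_intros simp: fun_eq_iff inner_commute algebra_simps)

text \<open>The products of a polynomial with a fixed Gaussian are rapidly decreasing and closed under partial
derivatives, so they form an invariant for the coinduction.\<close>

lemma schwartz_polynomial_gaussian: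
  fixes a :: "'a::euclidean_space"
  assumes c: "0 < c" and p: "real_polynomial_function p"
  shows "schwartz (\<lambda>x. complex_of_real (p x * gaussian c a x))"
proof -
  define X where "X \<phi> \<longleftrightarrow> (\<exists>p. real_polynomial_function p \<and> \<phi> = (\<lambda>x. complex_of_real (p x * gaussian c a x)))" for \<phi>
  have "X (\<lambda>x. complex_of_real (p x * gaussian c a x))" unfolding X_def using p by blast
  then show ?thesis
  proof (rule schwartz.coinduct)
    fix \<phi> assume "X \<phi>"
    then obtain p where p: "real_polynomial_function p" and \<phi>: "\<phi> = (\<lambda>x. complex_of_real (p x * gaussian c a x))"
      unfolding X_def by blast
    obtain p' where p': "\<And>x. (p has_derivative p' x) (at x)" "\<And>b. real_polynomial_function (\<lambda>x. p' x b)"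
      using real_polynomial_function_has_derivative[OF p] by blast
    define q where "q b x = p' x b + p x * - (2 * c * ((x - a) \<bullet> b))" for b x
    have der: "(\<phi> has_derivative (\<lambda>b. complex_of_real (q b x * gaussian c a x))) (at x)" for x
    proof -
      have "((\<lambda>x. p x * gaussian c a x) has_derivative
          (\<lambda>b. p x * (- (2 * c * ((x - a) \<bullet> b)) * gaussian c a x) + p' x b * gaussian c a x)) (at x)"
        by (intro has_derivative_mult p' gaussian_has_derivative)
      also have "(\<lambda>b. p x * (- (2 * c * ((x - a) \<bullet> b)) * gaussian c a x) + p' x b * gaussian c a x) =
          (\<lambda>b. q b x * gaussian c a x)"
        by (auto simp: q_def algebra_simps)
      finally show ?thesis unfolding \<phi> by (rule has_derivative_of_real)
    qed
    have "\<phi> differentiable (at x)" for x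
      using der by (rule differentiableI)
    moreover have "bounded (range (\<lambda>x. norm x ^ k *\<^sub>R \<phi> x))" for k
    proof -
      obtain C n where C: "0 \<le> C" "\<And>x. \<bar>p x\<bar> \<le> C * (1 + norm x) ^ n"
        using real_polynomial_function_growth[OF p] by blast
      obtain B where B: "\<And>x. (1 + norm x) ^ (k + n) * gaussian c a x \<le> B"
        using gaussian_decay[OF c] by blast
      have "norm (norm x ^ k *\<^sub>R \<phi> x) \<le> C * B" for x
      proof -
        have "norm (norm x ^ k *\<^sub>R \<phi> x) = norm x ^ k * \<bar>p x\<bar> * gaussian c a x"
          by (simp add: \<phi> norm_mult abs_mult)
        also have "\<dots> \<le> (1 + norm x) ^ k * (C * (1 + norm x) ^ n) * gaussian c a x"
          using C by (intro mult_right_mono mult_mono power_mono) auto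
        also have "\<dots> = C * ((1 + norm x) ^ (k + n) * gaussian c a x)"
          by (simp add: power_add mult_ac)
        also have "\<dots> \<le> C * B" using C B by (intro mult_left_mono) auto
        finally show ?thesis .
      qed
      then show ?thesis by (auto simp: bounded_iff)
    qed
    moreover have "X (\<lambda>x. frechet_derivative \<phi> (at x) b)" for b
    proof -
      have "(\<lambda>x. frechet_derivative \<phi> (at x) b) = (\<lambda>x. complex_of_real (q b x * gaussian c a x))"
        using frechet_derivative_at[OF der] by (metis (no_types, lifting))
      moreover have "real_polynomial_function (q b)"
      proof -
        have "real_polynomial_function (\<lambda>x. - (2 * c * ((x - a) \<bullet> b)))"
        proof -
          have "(\<lambda>x. - (2 * c * ((x - a) \<bullet> b))) = (\<lambda>x. - 2 * c * (x \<bullet> b) + 2 * c * (a \<bullet> b))"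
            by (auto simp: inner_diff_left algebra_simps)
          then show ?thesis
            by (simp only:) (intro real_polynomial_function.intros(3) real_polynomial_function.intros(4)
                real_polynomial_function.intros(2) real_polynomial_function.intros(1)[OF bounded_linear_inner_left])
        qed
        then show ?thesis
          unfolding q_def[abs_def] using p p'(2) by (intro real_polynomial_function.intros(3) real_polynomial_function.intros(4))
      qed
      ultimately show ?thesis unfolding X_def by blast
    qed
    ultimately show "\<exists>\<phi>'. \<phi> = \<phi>' \<and> (\<forall>x. \<phi>' differentiable at x) \<and>
        (\<forall>k. bounded (range (\<lambda>x. norm x ^ k *\<^sub>R \<phi>' x))) \<and>
        (\<forall>b. b \<in> Basis \<longrightarrow> X (\<lambda>x. frechet_derivative \<phi>' (at x) b) \<or>
          schwartz (\<lambda>x. frechet_derivative \<phi>' (at x) b))"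
      by blast
  qed
qed

lemma lborel_integral_affine:
  fixes f :: "'a::euclidean_space \<Rightarrow> 'b::{banach, second_countable_topology}"
  assumes [measurable]: "f \<in> borel_measurable borel" and c: "c \<noteq> 0"
  shows "integral\<^sup>L lborel f = \<bar>c\<bar> ^ DIM('a) *\<^sub>R (LINT x|lborel. f (t + c *\<^sub>R x))"
  by (subst lborel_affine[OF c, of t]) (simp add: integral_density integral_distr)

lemma lborel_integrable_affine:
  fixes f :: "'a::euclidean_space \<Rightarrow> 'b::{banach, second_countable_topology}"
  assumes f: "integrable lborel f" and c: "c \<noteq> 0"
  shows "integrable lborel (\<lambda>x. f (t + c *\<^sub>R x))"
proof -
  have [measurable]: "f \<in> borel_measurable borel" using borel_measurable_integrable[OF f] by simp
  have "integrable (density (distr lborel borel (\<lambda>x. t + c *\<^sub>R x)) (\<lambda>_. ennreal (\<bar>c\<bar> ^ DIM('a)))) f"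
    using f unfolding lborel_affine[OF c, of t, symmetric] .
  then have "integrable (distr lborel borel (\<lambda>x. t + c *\<^sub>R x)) (\<lambda>x. \<bar>c\<bar> ^ DIM('a) *\<^sub>R f x)"
    by (subst (asm) integrable_density) auto
  then have "integrable lborel (\<lambda>x. \<bar>c\<bar> ^ DIM('a) *\<^sub>R f (t + c *\<^sub>R x))"
    by (simp add: integrable_distr_eq)
  from integrable_scaleR_right[OF this, of "inverse (\<bar>c\<bar> ^ DIM('a))"] show ?thesis
    using c by simp
qed

lemma char_normal_density:
  assumes \<sigma>: "0 < \<sigma>"
  shows "(LINT x|lborel. exp (\<i> * of_real (t * x)) * of_real (normal_density 0 \<sigma> x)) =
    complex_of_real (exp (- (\<sigma> * t)\<^sup>2 / 2))"
proof -
  have "(LINT x|lborel. exp (\<i> * of_real (t * x)) * of_real (normal_density 0 \<sigma> x)) =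
      \<bar>\<sigma>\<bar> *\<^sub>R (LINT x|lborel. exp (\<i> * of_real (t * (0 + \<sigma> * x))) * of_real (normal_density 0 \<sigma> (0 + \<sigma> * x)))"
    using \<sigma> by (intro lborel_integral_real_affine) auto
  also have "\<dots> = (LINT x|lborel. \<bar>\<sigma>\<bar> *\<^sub>R (exp (\<i> * of_real (t * (0 + \<sigma> * x))) * of_real (normal_density 0 \<sigma> (0 + \<sigma> * x))))"
    by (rule integral_scaleR_right[symmetric])
  also have "\<dots> = (LINT x|lborel. std_normal_density x *\<^sub>R exp (\<i> * of_real ((\<sigma> * t) * x)))"
    using \<sigma> by (intro Bochner_Integration.integral_cong refl)
      (simp add: normal_density_def real_sqrt_mult power_mult_distrib scaleR_conv_of_real mult_ac)
  also have "\<dots> = char std_normal_distribution (\<sigma> * t)"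
    unfolding char_def by (subst integral_density) (auto simp: normal_density_nonneg)
  also have "\<dots> = complex_of_real (exp (- (\<sigma> * t)\<^sup>2 / 2))"
    by (simp add: char_std_normal_distribution)
  finally show ?thesis .
qed

definition gauss_density :: "real \<Rightarrow> 'a::euclidean_space \<Rightarrow> real" where
  "gauss_density \<sigma> x = (\<Prod>b\<in>Basis. normal_density 0 \<sigma> (x \<bullet> b))"

lemma gauss_density_measurable [measurable]: "gauss_density \<sigma> \<in> borel_measurable borel"
  unfolding gauss_density_def by measurable

lemma gauss_density_nonneg [simp]: "0 \<le> gauss_density \<sigma> x"
  by (auto simp: gauss_density_def intro!: prod_nonneg)

lemma gauss_density_eq_gaussian:
  fixes x a :: "'a::euclidean_space"
  shows "gauss_density \<sigma> (x - a) = (1 / sqrt (2 * pi * \<sigma>\<^sup>2)) ^ DIM('a) * gaussian (1 / (2 * \<sigma>\<^sup>2)) a x"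
proof -
  have "(\<Sum>b\<in>Basis. - ((x - a) \<bullet> b)\<^sup>2 / (2 * \<sigma>\<^sup>2)) = - (1 / (2 * \<sigma>\<^sup>2) * (norm (x - a))\<^sup>2)"
    unfolding power2_norm_eq_inner euclidean_inner[of "x - a" "x - a"]
    by (simp add: sum_distrib_left sum_negf[symmetric] power2_eq_square)
  moreover have "gauss_density \<sigma> (x - a) =
      (\<Prod>b\<in>(Basis :: 'a set). (1 / sqrt (2 * pi * \<sigma>\<^sup>2)) * exp (- ((x - a) \<bullet> b)\<^sup>2 / (2 * \<sigma>\<^sup>2)))"
    by (simp add: gauss_density_def normal_density_def)
  ultimately show ?thesis
    by (simp only: prod.distrib exp_sum[OF finite_Basis, symmetric] prod_constant gaussian_def)
qed

lemma gauss_density_scale: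
  fixes x :: "'a::euclidean_space"
  assumes "0 < \<sigma>"
  shows "\<sigma> ^ DIM('a) * gauss_density \<sigma> (\<sigma> *\<^sub>R x) = gauss_density 1 x"
proof -
  have "\<sigma> * normal_density 0 \<sigma> (\<sigma> * y) = normal_density 0 1 y" for y
    using assms by (simp add: normal_density_def real_sqrt_mult power_mult_distrib)
  then have "(\<Prod>b\<in>(Basis :: 'a set). \<sigma> * normal_density 0 \<sigma> (\<sigma> * (x \<bullet> b))) = (\<Prod>b\<in>Basis. normal_density 0 1 (x \<bullet> b))"
    by simp
  then show ?thesis by (simp add: gauss_density_def prod.distrib)
qed

text \<open>The density is a product over the coordinates and so is the character, which reduces the claim to the
characteristic function of the normal distribution on the line.\<close>

lemma char_gauss_density:
  fixes \<xi> :: "'a::euclidean_space"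
  assumes \<sigma>: "0 < \<sigma>"
  shows "integrable lborel (\<lambda>x. exp (\<i> * of_real (\<xi> \<bullet> x)) * complex_of_real (gauss_density \<sigma> x))"
    and "(LINT x|lborel. exp (\<i> * of_real (\<xi> \<bullet> x)) * of_real (gauss_density \<sigma> x)) =
      complex_of_real (exp (- \<sigma>\<^sup>2 * (norm \<xi>)\<^sup>2 / 2))"
proof -
  interpret P: product_sigma_finite "\<lambda>_ :: 'a. lborel :: real measure" by unfold_locales
  let ?P = "\<Pi>\<^sub>M b\<in>(Basis :: 'a set). (lborel :: real measure)"
  let ?s = "\<lambda>f :: 'a \<Rightarrow> real. \<Sum>b\<in>Basis. f b *\<^sub>R b"
  define F where "F x = exp (\<i> * of_real (\<xi> \<bullet> x)) * complex_of_real (gauss_density \<sigma> x)" for x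
  have F_meas [measurable]: "F \<in> borel_measurable borel" unfolding F_def by measurable
  define k where "k b y = exp (\<i> * of_real ((\<xi> \<bullet> b) * y)) * complex_of_real (normal_density 0 \<sigma> y)" for b y
  have k_int: "integrable lborel (k b)" for b
  proof -
    have "integrable lborel (\<lambda>y. normal_density 0 \<sigma> y)" using \<sigma> by simp
    then show ?thesis
    proof (rule Bochner_Integration.integrable_bound)
      show "k b \<in> borel_measurable lborel" unfolding k_def by measurable
    qed (simp add: k_def norm_mult)
  qed
  have inner_s: "?s f \<bullet> b = f b" if "b \<in> Basis" for f b
    using that by (simp add: inner_sum_left inner_Basis if_distrib sum.delta cong: if_cong)
  have F_prod: "F (?s f) = (\<Prod>b\<in>Basis. k b (f b))" for f
  proof -
    have "\<xi> \<bullet> ?s f = (\<Sum>b\<in>Basis. (\<xi> \<bullet> b) * f b)"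
      by (simp add: inner_sum_right mult.commute)
    then have "exp (\<i> * of_real (\<xi> \<bullet> ?s f)) = (\<Prod>b\<in>Basis. exp (\<i> * of_real ((\<xi> \<bullet> b) * f b)))"
      by (simp add: sum_distrib_left exp_sum)
    moreover have "gauss_density \<sigma> (?s f) = (\<Prod>b\<in>Basis. normal_density 0 \<sigma> (f b))"
      unfolding gauss_density_def by (intro prod.cong) (auto simp: inner_s)
    ultimately show ?thesis by (simp add: F_def k_def prod.distrib)
  qed
  have s_meas [measurable]: "?s \<in> measurable ?P borel" by measurable
  have "integrable ?P (\<lambda>f. F (?s f))"
    unfolding F_prod by (intro P.product_integrable_prod k_int) auto
  then have "integrable (distr ?P borel ?s) F"
    by (subst integrable_distr_eq) auto
  then show "integrable lborel (\<lambda>x. exp (\<i> * of_real (\<xi> \<bullet> x)) * complex_of_real (gauss_density \<sigma> x))"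
    unfolding F_def[abs_def] lborel_eq[symmetric] .
  have "integral\<^sup>L lborel F = integral\<^sup>L (distr ?P borel ?s) F"
    unfolding lborel_eq[symmetric] ..
  also have "\<dots> = (LINT f|?P. F (?s f))"
    by (intro integral_distr) auto
  also have "\<dots> = (\<Prod>b\<in>Basis. integral\<^sup>L lborel (k b))"
    unfolding F_prod by (intro P.product_integral_prod k_int) auto
  also have "\<dots> = (\<Prod>b\<in>Basis. complex_of_real (exp (- (\<sigma> * (\<xi> \<bullet> b))\<^sup>2 / 2)))"
    unfolding k_def char_normal_density[OF \<sigma>] ..
  also have "\<dots> = complex_of_real (exp (\<Sum>b\<in>(Basis :: 'a set). - (\<sigma> * (\<xi> \<bullet> b))\<^sup>2 / 2))"
    by (simp add: exp_sum del: of_real_exp)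
  also have "(\<Sum>b\<in>(Basis :: 'a set). - (\<sigma> * (\<xi> \<bullet> b))\<^sup>2 / 2) = - \<sigma>\<^sup>2 * (norm \<xi>)\<^sup>2 / 2"
    unfolding power2_norm_eq_inner euclidean_inner[of \<xi> \<xi>]
    by (simp add: sum_distrib_left sum_negf[symmetric] power2_eq_square sum_divide_distrib mult_ac)
  finally show "(LINT x|lborel. exp (\<i> * of_real (\<xi> \<bullet> x)) * of_real (gauss_density \<sigma> x)) =
      complex_of_real (exp (- \<sigma>\<^sup>2 * (norm \<xi>)\<^sup>2 / 2))"
    unfolding F_def .
qed

lemma gauss_density_integrable:
  assumes "0 < \<sigma>"
  shows "integrable lborel (gauss_density \<sigma> :: 'a::euclidean_space \<Rightarrow> real)"
    and "(LINT x|lborel. gauss_density \<sigma> (x :: 'a)) = 1"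
proof -
  show "integrable lborel (gauss_density \<sigma> :: 'a \<Rightarrow> real)"
    using char_gauss_density(1)[OF assms, of "0 :: 'a"] by (simp add: complex_of_real_integrable_eq)
  show "(LINT x|lborel. gauss_density \<sigma> (x :: 'a)) = 1"
    using char_gauss_density(2)[OF assms, of "0 :: 'a"] by (simp add: of_real_eq_1_iff)
qed

lemma gaussian_integrable:
  fixes a :: "'a::euclidean_space"
  assumes c: "0 < c"
  shows "integrable lborel (gaussian c a)"
proof -
  define \<sigma> where "\<sigma> = sqrt (1 / (2 * c))"
  have \<sigma>: "0 < \<sigma>" "1 / (2 * \<sigma>\<^sup>2) = c" using c by (auto simp: \<sigma>_def)
  have "integrable lborel (\<lambda>x. gauss_density \<sigma> (- a + 1 *\<^sub>R x))"
    by (intro lborel_integrable_affine gauss_density_integrable(1)[OF \<sigma>(1)]) simp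
  then have "integrable lborel (\<lambda>x. (1 / sqrt (2 * pi * \<sigma>\<^sup>2)) ^ DIM('a) * gaussian c a x)"
    using gauss_density_eq_gaussian[of \<sigma> _ a] \<sigma> by simp
  then show ?thesis using \<sigma>(1) by simp
qed

lemma fourier_gauss_density:
  fixes a \<xi> :: "'a::euclidean_space"
  assumes \<sigma>: "0 < \<sigma>"
  shows "fourier (\<lambda>x. of_real (gauss_density \<sigma> (x - a))) \<xi> =
    exp (- (\<i> * of_real (\<xi> \<bullet> a))) * of_real (exp (- \<sigma>\<^sup>2 * (norm \<xi>)\<^sup>2 / 2))"
proof -
  have "fourier (\<lambda>x. of_real (gauss_density \<sigma> (x - a))) \<xi> =
      (LINT x|lborel. exp (- (\<i> * of_real (\<xi> \<bullet> (a + 1 *\<^sub>R x)))) * of_real (gauss_density \<sigma> (a + 1 *\<^sub>R x - a)))"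
    unfolding fourier_def by (subst lborel_integral_affine[of _ 1 a]) auto
  also have "\<dots> = (LINT x|lborel. exp (- (\<i> * of_real (\<xi> \<bullet> a))) * (exp (\<i> * of_real ((- \<xi>) \<bullet> x)) * of_real (gauss_density \<sigma> x)))"
    by (intro Bochner_Integration.integral_cong) (auto simp: inner_add_right algebra_simps exp_add[symmetric])
  also have "\<dots> = exp (- (\<i> * of_real (\<xi> \<bullet> a))) * of_real (exp (- \<sigma>\<^sup>2 * (norm (- \<xi>))\<^sup>2 / 2))"
    unfolding integral_mult_right_zero char_gauss_density(2)[OF \<sigma>] ..
  finally show ?thesis by simp
qed

lemma schwartz_gauss_density:
  assumes \<sigma>: "0 < \<sigma>"
  shows "schwartz (\<lambda>x. complex_of_real (gauss_density \<sigma> (x - a)))"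
  unfolding gauss_density_eq_gaussian
  using \<sigma> by (intro schwartz_polynomial_gaussian real_polynomial_function.intros) auto

section \<open>Testing a tempered Fourier transform on smoothed functions\<close>

lemma sigma_finite_riesz_measure: "sigma_finite_measure (riesz_measure \<beta> :: 'a::euclidean_space measure)"
  unfolding riesz_measure_def
  by (subst sigma_finite_measure.sigma_finite_iff_density_finite[OF sigma_finite_lborel]) auto

text \<open>Integrability at the origin comes from \<open>\<beta> > 0\<close>. At infinity the Gaussian beats every power, so the integrand
is dominated by the radial integrand of the previous section with \<open>h = 1\<close> and an exponent
\<open>\<gamma> \<le> \<beta>\<close> below 2.\<close>

lemma gauss_integrable_riesz:
  assumes \<beta>: "0 < \<beta>" and c: "0 < c"
  shows "integrable (riesz_measure \<beta> :: 'a::euclidean_space measure) (\<lambda>\<xi>. exp (- c * (norm \<xi>)\<^sup>2))"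
proof (rule integrableI_bounded)
  define \<gamma> where "\<gamma> = min \<beta> 1"
  have \<gamma>: "0 < \<gamma>" "\<gamma> < 2" "\<gamma> \<le> \<beta>" using \<beta> by (auto simp: \<gamma>_def)
  define k where "k = max (\<beta> - \<gamma>) 0 + 2"
  have "((\<lambda>t. (1 + t) powr k * exp (- c * t\<^sup>2)) \<longlongrightarrow> 0) at_top"
    using c by real_asymp
  then have "\<forall>\<^sub>F t in at_top. (1 + t) powr k * exp (- c * t\<^sup>2) < 1"
    by (rule order_tendstoD(2)) simp
  then obtain t0 where t0: "\<And>t. t \<ge> t0 \<Longrightarrow> (1 + t) powr k * exp (- c * t\<^sup>2) < 1"
    by (auto simp: eventually_at_top_linorder)
  define B where "B = 1 + (1 + \<bar>t0\<bar>) powr k"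
  have B: "0 \<le> B" by (simp add: B_def add_nonneg_nonneg)
  have decay: "(1 + t) powr k * exp (- c * t\<^sup>2) \<le> B" if "0 \<le> t" for t
  proof (cases "t0 \<le> t")
    case True
    moreover have "0 \<le> (1 + \<bar>t0\<bar>) powr k" by simp
    ultimately show ?thesis using t0[of t] unfolding B_def by linarith
  next
    case False
    then have "(1 + t) powr k * exp (- c * t\<^sup>2) \<le> (1 + \<bar>t0\<bar>) powr k * 1"
      using that c by (intro mult_mono powr_mono2) (auto simp: k_def)
    then show ?thesis by (simp add: B_def)
  qed
  have pt: "t powr (- d + \<beta>) * exp (- c * t\<^sup>2) \<le> B * (t powr (\<gamma> - d) * (min 1 (1 / t))\<^sup>2)" if "0 \<le> t" for t d :: real
  proof (cases "t = 0")
    case False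
    then have t: "0 < t" using that by simp
    have "t powr (\<beta> - \<gamma>) \<le> (1 + t) powr (\<beta> - \<gamma>)" using t \<gamma> by (intro powr_mono2) auto
    moreover have "1 \<le> (1 + t)\<^sup>2 * (min 1 (1 / t))\<^sup>2"
    proof -
      have "1 \<le> (1 + t) * min 1 (1 / t)" using t by (auto simp: min_def field_simps)
      then have "1\<^sup>2 \<le> ((1 + t) * min 1 (1 / t))\<^sup>2" by (intro power_mono) auto
      then show ?thesis by (simp add: power_mult_distrib)
    qed
    ultimately have "t powr (\<beta> - \<gamma>) * 1 \<le> (1 + t) powr (\<beta> - \<gamma>) * ((1 + t)\<^sup>2 * (min 1 (1 / t))\<^sup>2)"
      by (intro mult_mono) auto
    also have "\<dots> = (1 + t) powr k * (min 1 (1 / t))\<^sup>2"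
    proof -
      have "(1 + t) powr k = (1 + t) powr (\<beta> - \<gamma>) * (1 + t) powr 2"
        using \<gamma> by (simp add: k_def powr_add)
      then show ?thesis using t by (simp add: powr_numeral)
    qed
    finally have "t powr (\<beta> - \<gamma>) * exp (- c * t\<^sup>2) \<le> (1 + t) powr k * (min 1 (1 / t))\<^sup>2 * exp (- c * t\<^sup>2)"
      by (intro mult_right_mono) auto
    also have "\<dots> = ((1 + t) powr k * exp (- c * t\<^sup>2)) * (min 1 (1 / t))\<^sup>2" by simp
    also have "\<dots> \<le> B * (min 1 (1 / t))\<^sup>2" using decay[of t] t by (intro mult_right_mono) auto
    finally have "t powr (\<gamma> - d) * (t powr (\<beta> - \<gamma>) * exp (- c * t\<^sup>2)) \<le> t powr (\<gamma> - d) * (B * (min 1 (1 / t))\<^sup>2)"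
      by (intro mult_left_mono) auto
    moreover have "t powr (- d + \<beta>) = t powr (\<gamma> - d) * t powr (\<beta> - \<gamma>)"
      by (simp add: powr_add[symmetric])
    ultimately show ?thesis by (simp add: mult_ac)
  qed simp
  obtain K where K: "(\<integral>\<^sup>+\<xi>. ennreal (norm \<xi> powr (\<gamma> - real DIM('a)) * (min 1 (1 / norm \<xi>))\<^sup>2)
    \<partial>(lborel :: 'a measure)) \<le> ennreal (K * 1 powr (2 - \<gamma>))"
    using radial_integral_bound[OF \<gamma>(1,2), where 'a = 'a] zero_less_one by blast
  have "(\<integral>\<^sup>+\<xi>. ennreal (norm (exp (- c * (norm \<xi>)\<^sup>2))) \<partial>(riesz_measure \<beta> :: 'a measure)) =
    (\<integral>\<^sup>+\<xi>. ennreal (norm \<xi> powr (- real DIM('a) + \<beta>)) * ennreal (norm (exp (- c * (norm \<xi>)\<^sup>2))) \<partial>(lborel :: 'a measure))"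
    by (rule nn_integral_riesz_measure) measurable
  also have "\<dots> \<le> (\<integral>\<^sup>+\<xi>. ennreal B * ennreal (norm \<xi> powr (\<gamma> - real DIM('a)) * (min 1 (1 / norm \<xi>))\<^sup>2) \<partial>(lborel :: 'a measure))"
  proof (rule nn_integral_mono)
    fix \<xi> :: 'a
    show "ennreal (norm \<xi> powr (- real DIM('a) + \<beta>)) * ennreal (norm (exp (- c * (norm \<xi>)\<^sup>2))) \<le>
        ennreal B * ennreal (norm \<xi> powr (\<gamma> - real DIM('a)) * (min 1 (1 / norm \<xi>))\<^sup>2)"
      using pt[of "norm \<xi>" "real DIM('a)"] B by (simp add: ennreal_mult[symmetric] ennreal_leI)
  qed
  also have "\<dots> = ennreal B * (\<integral>\<^sup>+\<xi>. ennreal (norm \<xi> powr (\<gamma> - real DIM('a)) * (min 1 (1 / norm \<xi>))\<^sup>2) \<partial>(lborel :: 'a measure))"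
    by (intro nn_integral_cmult) measurable
  also have "\<dots> \<le> ennreal B * ennreal (K * 1 powr (2 - \<gamma>))" by (intro mult_left_mono K) auto
  also have "\<dots> < \<infinity>" by (simp add: ennreal_mult_less_top)
  finally show "(\<integral>\<^sup>+\<xi>. ennreal (norm (exp (- c * (norm \<xi>)\<^sup>2))) \<partial>(riesz_measure \<beta> :: 'a measure)) < \<infinity>" .
qed measurable

lemma fourier_measurable [measurable]:
  assumes [measurable]: "h \<in> borel_measurable borel"
  shows "fourier h \<in> borel_measurable borel"
proof -
  have "(\<lambda>\<xi>. LINT x|lborel. (\<lambda>(\<xi>, x). exp (- (\<i> * of_real (\<xi> \<bullet> x))) * h x) (\<xi>, x)) \<in> borel_measurable borel"
    by (rule lborel.borel_measurable_lebesgue_integral) measurable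
  then show ?thesis by (simp add: fourier_def[abs_def])
qed

text \<open>A bound that is uniform over the centres in a ball, at the price of halving the rate.\<close>

lemma gaussian_shift_le:
  assumes "0 \<le> c" "norm a \<le> R"
  shows "gaussian c a z \<le> exp (c * R\<^sup>2) * gaussian (c / 2) 0 z"
proof -
  have "(norm z)\<^sup>2 \<le> (norm (z - a) + norm a)\<^sup>2"
    by (intro power_mono) (auto simp: norm_triangle_sub add.commute)
  also have "\<dots> \<le> 2 * (norm (z - a))\<^sup>2 + 2 * (norm a)\<^sup>2"
    using sum_squares_bound[of "norm (z - a)" "norm a"] by (simp add: power2_sum)
  also have "(norm a)\<^sup>2 \<le> R\<^sup>2" using assms by (intro power_mono) auto
  finally have "(norm z)\<^sup>2 / 2 \<le> (norm (z - a))\<^sup>2 + R\<^sup>2" by simp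
  from mult_left_mono[OF this assms(1)]
  have "- (c * (norm (z - a))\<^sup>2) \<le> c * R\<^sup>2 + - (c / 2 * (norm z)\<^sup>2)"
    by (simp add: algebra_simps)
  then show ?thesis by (simp add: gaussian_def exp_add[symmetric])
qed

locale tempered_fourier =
  fixes f :: "'a::euclidean_space \<Rightarrow> real" and \<beta> :: real
  assumes tf: "is_tempered_fourier_of f (riesz_measure \<beta>)" and \<beta>: "0 < \<beta>"
begin

abbreviation \<mu> :: "'a measure" where "\<mu> \<equiv> riesz_measure \<beta>"

sublocale \<mu>: sigma_finite_measure \<mu> by (rule sigma_finite_riesz_measure)

sublocale pair_sigma_finite "lborel :: 'a measure" \<mu> ..

lemma f_measurable [measurable]: "f \<in> borel_measurable borel"
  using tf by (simp add: is_tempered_fourier_of_def)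

lemma f_gauss:
  assumes \<sigma>: "0 < \<sigma>"
  shows "integrable lborel (\<lambda>z. f z * gauss_density \<sigma> (z - a))"
    and "complex_of_real (LINT z|lborel. f z * gauss_density \<sigma> (z - a)) =
      (LINT \<xi>|\<mu>. exp (- (\<i> * of_real (\<xi> \<bullet> a))) * of_real (exp (- \<sigma>\<^sup>2 * (norm \<xi>)\<^sup>2 / 2)))"
proof -
  have *: "integrable lborel (\<lambda>z. complex_of_real (f z) * complex_of_real (gauss_density \<sigma> (z - a)))"
    "(LINT z|lborel. complex_of_real (f z) * complex_of_real (gauss_density \<sigma> (z - a))) =
      (LINT \<xi>|\<mu>. fourier (\<lambda>x. of_real (gauss_density \<sigma> (x - a))) \<xi>)"
    using tf schwartz_gauss_density[OF \<sigma>, of a] by (auto simp: is_tempered_fourier_of_def)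
  show "integrable lborel (\<lambda>z. f z * gauss_density \<sigma> (z - a))"
    using *(1) by (simp only: of_real_mult[symmetric] complex_of_real_integrable_eq)
  show "complex_of_real (LINT z|lborel. f z * gauss_density \<sigma> (z - a)) =
      (LINT \<xi>|\<mu>. exp (- (\<i> * of_real (\<xi> \<bullet> a))) * of_real (exp (- \<sigma>\<^sup>2 * (norm \<xi>)\<^sup>2 / 2)))"
    using *(2) by (simp only: fourier_gauss_density[OF \<sigma>] of_real_mult[symmetric] integral_complex_of_real)
qed

lemma f_gaussian:
  assumes c: "0 < c"
  shows "integrable lborel (\<lambda>z. f z * gaussian c 0 z)"
proof -
  define \<sigma> where "\<sigma> = sqrt (1 / (2 * c))"
  have \<sigma>: "0 < \<sigma>" "1 / (2 * \<sigma>\<^sup>2) = c" using c by (auto simp: \<sigma>_def)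
  have "integrable lborel (\<lambda>z. (1 / sqrt (2 * pi * \<sigma>\<^sup>2)) ^ DIM('a) * (f z * gaussian c 0 z))"
    using f_gauss(1)[OF \<sigma>(1), of 0] unfolding gauss_density_eq_gaussian \<sigma>(2) by (simp add: mult_ac)
  then show ?thesis using \<sigma>(1) by simp
qed

text \<open>This is \<open>f_gauss\<close> integrated against \<open>h a\<close> over the centres \<open>a\<close>. On the spectral side the phases add up to the Fourier
transform of \<open>h\<close>; on the side of \<open>f\<close> the Gaussians add up to the convolution of \<open>h\<close> with a Gaussian, rescaled so that
the width \<open>\<sigma>\<close> enters through \<open>h\<close> only.\<close>

lemma smoothed_identity:
  fixes h :: "'a \<Rightarrow> real"
  assumes [measurable]: "h \<in> borel_measurable borel" and hb: "\<And>a. \<bar>h a\<bar> \<le> B"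
    and supp: "\<And>a. h a \<noteq> 0 \<Longrightarrow> norm a \<le> R" and \<sigma>: "0 < \<sigma>"
  shows "(LINT \<xi>|\<mu>. fourier (\<lambda>x. of_real (h x)) \<xi> * of_real (exp (- \<sigma>\<^sup>2 * (norm \<xi>)\<^sup>2 / 2))) =
    of_real (LINT z|lborel. f z * (LINT w|lborel. gauss_density 1 w * h (z - \<sigma> *\<^sub>R w)))"
proof -
  have h_int: "integrable lborel h"
  proof (rule Bochner_Integration.integrable_bound[of _ "\<lambda>a. B * indicator (cball 0 R) a"])
    show "AE a in lborel. norm (h a) \<le> norm (B * indicator (cball 0 R) a)"
    proof (intro AE_I2)
      fix a :: 'a show "norm (h a) \<le> norm (B * indicator (cball 0 R) a)"
        using hb[of a] supp[of a] by (cases "h a = 0") auto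
    qed
    have "emeasure lborel (cball (0 :: 'a) R) < \<infinity>" by (rule emeasure_bounded_finite) simp
    then show "integrable lborel (\<lambda>a :: 'a. B * indicator (cball 0 R) a)"
      by (intro integrable_mult_right) simp
  qed simp
  let ?e = "\<lambda>\<xi> :: 'a. exp (- \<sigma>\<^sup>2 * (norm \<xi>)\<^sup>2 / 2)"
  have e_int: "integrable \<mu> ?e"
    using gauss_integrable_riesz[OF \<beta>, of "\<sigma>\<^sup>2 / 2"] \<sigma> by (simp add: mult_ac)
  define F where "F = (\<lambda>(a, \<xi>). complex_of_real (h a) * (exp (- (\<i> * of_real (\<xi> \<bullet> a))) * of_real (?e \<xi>)))"
  have F_int: "integrable (lborel \<Otimes>\<^sub>M \<mu>) F"
  proof (rule Bochner_Integration.integrable_bound[OF integrable_pair_mult[OF h_int e_int]])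
    show "F \<in> borel_measurable (lborel \<Otimes>\<^sub>M \<mu>)" unfolding F_def by measurable
  qed (auto simp: F_def norm_mult)
  have "(LINT \<xi>|\<mu>. fourier (\<lambda>x. of_real (h x)) \<xi> * of_real (?e \<xi>)) = (LINT \<xi>|\<mu>. LINT a|lborel. F (a, \<xi>))"
    unfolding fourier_def integral_mult_left_zero[symmetric]
    by (intro Bochner_Integration.integral_cong) (auto simp: F_def mult_ac)
  also have "\<dots> = (LINT a|lborel. LINT \<xi>|\<mu>. F (a, \<xi>))"
    using Fubini_integral[of "\<lambda>a \<xi>. F (a, \<xi>)"] F_int by simp
  also have "\<dots> = (LINT a|lborel. of_real (LINT z|lborel. h a * (f z * gauss_density \<sigma> (z - a))))"
    unfolding F_def by (simp add: f_gauss(2)[OF \<sigma>])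
  also have "\<dots> = of_real (LINT a|lborel. LINT z|lborel. h a * (f z * gauss_density \<sigma> (z - a)))"
    by (rule integral_complex_of_real)
  also have "(LINT a|lborel. LINT z|lborel. h a * (f z * gauss_density \<sigma> (z - a))) =
      (LINT z|lborel. LINT a|lborel. h a * (f z * gauss_density \<sigma> (z - a)))"
  proof (rule lborel_pair.Fubini_integral[symmetric])
    define c where "c = 1 / (2 * \<sigma>\<^sup>2)"
    have c: "0 < c" using \<sigma> by (simp add: c_def)
    define Z where "Z = (1 / sqrt (2 * pi * \<sigma>\<^sup>2)) ^ DIM('a) * exp (c * R\<^sup>2)"
    have Z: "0 \<le> Z" by (simp add: Z_def)
    have "integrable lborel (\<lambda>z. Z * (f z * gaussian (c / 2) 0 z))"
      using f_gaussian[of "c / 2"] c by (intro integrable_mult_right) auto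
    from lborel_pair.integrable_pair_mult[OF h_int this]
    show "integrable (lborel \<Otimes>\<^sub>M lborel) (\<lambda>(a, z). h a * (f z * gauss_density \<sigma> (z - a)))"
    proof (rule Bochner_Integration.integrable_bound)
      show "(\<lambda>(a, z). h a * (f z * gauss_density \<sigma> (z - a))) \<in> borel_measurable (lborel \<Otimes>\<^sub>M lborel)"
        by measurable
      have "norm (h a * (f z * gauss_density \<sigma> (z - a))) \<le> norm (h a * (Z * (f z * gaussian (c / 2) 0 z)))" for a z
      proof (cases "h a = 0")
        case False
        then have "gauss_density \<sigma> (z - a) \<le> (1 / sqrt (2 * pi * \<sigma>\<^sup>2)) ^ DIM('a) * (exp (c * R\<^sup>2) * gaussian (c / 2) 0 z)"
          unfolding gauss_density_eq_gaussian c_def[symmetric]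
          using c supp[of a] by (intro mult_left_mono gaussian_shift_le) auto
        then have "\<bar>h a\<bar> * (\<bar>f z\<bar> * gauss_density \<sigma> (z - a)) \<le> \<bar>h a\<bar> * (\<bar>f z\<bar> * (Z * gaussian (c / 2) 0 z))"
          unfolding Z_def by (intro mult_left_mono) (auto simp: mult_ac)
        then show ?thesis using Z by (simp add: abs_mult mult_ac)
      qed simp
      then show "AE x in lborel \<Otimes>\<^sub>M lborel. norm (case x of (a, z) \<Rightarrow> h a * (f z * gauss_density \<sigma> (z - a))) \<le>
        norm (case x of (a, z) \<Rightarrow> h a * (Z * (f z * gaussian (c / 2) 0 z)))"
        by (intro AE_I2) (auto simp: split_paired_all)
    qed
  qed
  also have "\<dots> = (LINT z|lborel. f z * (LINT w|lborel. gauss_density 1 w * h (z - \<sigma> *\<^sub>R w)))"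
  proof (intro Bochner_Integration.integral_cong refl)
    fix z :: 'a
    have "(LINT a|lborel. h a * (f z * gauss_density \<sigma> (z - a))) = f z * (LINT a|lborel. gauss_density \<sigma> (z - a) * h a)"
      by (subst integral_mult_right_zero[symmetric]) (simp add: mult_ac)
    also have "(LINT a|lborel. gauss_density \<sigma> (z - a) * h a) =
        \<bar>- \<sigma>\<bar> ^ DIM('a) *\<^sub>R (LINT w|lborel. gauss_density \<sigma> (z - (z + (- \<sigma>) *\<^sub>R w)) * h (z + (- \<sigma>) *\<^sub>R w))"
      using \<sigma> by (intro lborel_integral_affine) auto
    also have "\<dots> = (LINT w|lborel. (\<sigma> ^ DIM('a) * gauss_density \<sigma> (\<sigma> *\<^sub>R w)) * h (z - \<sigma> *\<^sub>R w))"
      using \<sigma> by (subst integral_scaleR_right[symmetric]) (simp add: mult.assoc)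
    finally show "(LINT a|lborel. h a * (f z * gauss_density \<sigma> (z - a))) =
        f z * (LINT w|lborel. gauss_density 1 w * h (z - \<sigma> *\<^sub>R w))"
      unfolding gauss_density_scale[OF \<sigma>] .
  qed
  finally show ?thesis .
qed

text \<open>Dominated convergence on the product of the variables \<open>z\<close> and \<open>w\<close>. If \<open>h (z - \<sigma> w) \<noteq> 0\<close> with \<open>\<sigma> \<le> 1\<close>, then
\<open>norm z \<le> R + norm w\<close>, so a Gaussian decay in \<open>z\<close>, against which \<open>f\<close> is integrable, can be bought with a growth
\<open>exp ((norm w)\<^sup>2 / 4)\<close> in \<open>w\<close>, which the Gaussian density absorbs.\<close>

lemma smoothed_limit:
  fixes h :: "'a \<Rightarrow> real"
  assumes cont: "continuous_on UNIV h" and hb: "\<And>a. \<bar>h a\<bar> \<le> B"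
    and supp: "\<And>a. h a \<noteq> 0 \<Longrightarrow> norm a \<le> R"
  shows "(\<lambda>n. LINT \<xi>|\<mu>. fourier (\<lambda>x. of_real (h x)) \<xi> * of_real (exp (- (1 / real (Suc n))\<^sup>2 * (norm \<xi>)\<^sup>2 / 2)))
    \<longlonglongrightarrow> of_real (LINT z|lborel. f z * h z)"
proof -
  define \<sigma> where "\<sigma> n = 1 / real (Suc n)" for n
  have \<sigma>: "0 < \<sigma> n" "\<sigma> n \<le> 1" for n by (auto simp: \<sigma>_def)
  have \<sigma>_lim: "\<sigma> \<longlonglongrightarrow> 0" unfolding \<sigma>_def by real_asymp
  have [measurable]: "h \<in> borel_measurable borel"
    by (rule borel_measurable_continuous_onI[OF cont])
  have B: "0 \<le> B" using hb[of 0] by linarith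
  define D where "D = (\<lambda>(z, w :: 'a). B * exp (R\<^sup>2 / 4) * ((f z * gaussian (1 / 8) 0 z) * (gauss_density 1 w * exp ((norm w)\<^sup>2 / 4))))"
  define G where "G n = (\<lambda>(z, w). f z * (gauss_density 1 w * h (z - \<sigma> n *\<^sub>R w)))" for n
  have w_int: "integrable lborel (\<lambda>w :: 'a. gauss_density 1 w * exp ((norm w)\<^sup>2 / 4))"
  proof -
    have eq: "(\<lambda>w :: 'a. gauss_density 1 w * exp ((norm w)\<^sup>2 / 4)) = (\<lambda>w. (1 / sqrt (2 * pi)) ^ DIM('a) * gaussian (1 / 4) 0 w)"
    proof
      fix w :: 'a
      show "gauss_density 1 w * exp ((norm w)\<^sup>2 / 4) = (1 / sqrt (2 * pi)) ^ DIM('a) * gaussian (1 / 4) 0 w"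
        using gauss_density_eq_gaussian[of 1 w 0] by (simp add: gaussian_def exp_add[symmetric])
    qed
    show ?thesis
      unfolding eq by (intro integrable_mult_right gaussian_integrable) simp
  qed
  have D_int: "integrable (lborel \<Otimes>\<^sub>M lborel) D"
  proof -
    have "integrable (lborel \<Otimes>\<^sub>M lborel) (\<lambda>(z, w :: 'a). (f z * gaussian (1 / 8) 0 z) * (gauss_density 1 w * exp ((norm w)\<^sup>2 / 4)))"
      by (intro lborel_pair.integrable_pair_mult f_gaussian w_int) simp
    from integrable_mult_right[OF this, of "B * exp (R\<^sup>2 / 4)"]
    show ?thesis by (simp only: D_def case_prod_beta')
  qed
  have G_meas [measurable]: "G n \<in> borel_measurable (lborel \<Otimes>\<^sub>M lborel)" for n
    unfolding G_def by measurable
  have GD: "norm (G n (z, w)) \<le> norm (D (z, w))" for n z w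
  proof -
    have "\<bar>h (z - \<sigma> n *\<^sub>R w)\<bar> \<le> B * (exp (R\<^sup>2 / 4) * exp ((norm w)\<^sup>2 / 4) * gaussian (1 / 8) 0 z)"
    proof (cases "h (z - \<sigma> n *\<^sub>R w) = 0")
      case False
      then have "norm (z - \<sigma> n *\<^sub>R w) \<le> R" by (rule supp)
      moreover have "norm (\<sigma> n *\<^sub>R w) \<le> norm w"
        using \<sigma>[of n] mult_right_mono[of "\<sigma> n" 1 "norm w"] by simp
      moreover have "norm z \<le> norm (z - \<sigma> n *\<^sub>R w) + norm (\<sigma> n *\<^sub>R w)"
        by (metis diff_add_cancel norm_triangle_ineq)
      ultimately have nz: "norm z \<le> R + norm w" by linarith
      have "(norm z)\<^sup>2 \<le> (R + norm w)\<^sup>2" using nz by (intro power_mono) auto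
      also have "\<dots> \<le> 2 * R\<^sup>2 + 2 * (norm w)\<^sup>2"
        using sum_squares_bound[of R "norm w"] by (simp add: power2_sum)
      finally have "0 \<le> R\<^sup>2 / 4 + (norm w)\<^sup>2 / 4 + - (1 / 8 * (norm z)\<^sup>2)" by simp
      then have "1 \<le> exp (R\<^sup>2 / 4) * exp ((norm w)\<^sup>2 / 4) * gaussian (1 / 8) 0 z"
        unfolding gaussian_def exp_add[symmetric] by simp
      then have "B * 1 \<le> B * (exp (R\<^sup>2 / 4) * exp ((norm w)\<^sup>2 / 4) * gaussian (1 / 8) 0 z)"
        using B by (intro mult_left_mono)
      then show ?thesis using hb[of "z - \<sigma> n *\<^sub>R w"] by linarith
    qed (use B in simp)
    then have "\<bar>f z\<bar> * (gauss_density 1 w * \<bar>h (z - \<sigma> n *\<^sub>R w)\<bar>) \<le>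
        \<bar>f z\<bar> * (gauss_density 1 w * (B * (exp (R\<^sup>2 / 4) * exp ((norm w)\<^sup>2 / 4) * gaussian (1 / 8) 0 z)))"
      by (intro mult_left_mono) auto
    then show ?thesis using B by (simp add: G_def D_def abs_mult mult_ac)
  qed
  have G_int: "integrable (lborel \<Otimes>\<^sub>M lborel) (G n)" for n
    by (rule Bochner_Integration.integrable_bound[OF D_int]) (use GD in auto)
  have "(\<lambda>n. LINT x|(lborel \<Otimes>\<^sub>M lborel). G n x) \<longlonglongrightarrow> (LINT x|(lborel \<Otimes>\<^sub>M lborel). (case x of (z, w :: 'a) \<Rightarrow> f z * (gauss_density 1 w * h z)))"
  proof (rule integral_dominated_convergence[where w = "\<lambda>x. norm (D x)"])
    show "integrable (lborel \<Otimes>\<^sub>M lborel) (\<lambda>x. norm (D x))" using D_int by (rule integrable_norm)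
    have "(\<lambda>n. G n (z, w)) \<longlonglongrightarrow> f z * (gauss_density 1 w * h z)" for z w
    proof -
      have "(\<lambda>n. z - \<sigma> n *\<^sub>R w) \<longlonglongrightarrow> z - 0 *\<^sub>R w"
        by (intro tendsto_intros \<sigma>_lim)
      then have "(\<lambda>n. h (z - \<sigma> n *\<^sub>R w)) \<longlonglongrightarrow> h (z - 0 *\<^sub>R w)"
        using cont by (auto intro: continuous_on_tendsto_compose[OF cont])
      then show ?thesis unfolding G_def by (auto intro!: tendsto_intros)
    qed
    then show "AE x in lborel \<Otimes>\<^sub>M lborel. (\<lambda>n. G n x) \<longlonglongrightarrow> (case x of (z, w :: 'a) \<Rightarrow> f z * (gauss_density 1 w * h z))"
      by (intro AE_I2) (auto simp: split_paired_all)
    show "AE x in lborel \<Otimes>\<^sub>M lborel. norm (G n x) \<le> norm (D x)" for n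
      using GD by (intro AE_I2) (auto simp: split_paired_all)
  qed measurable
  moreover have "(LINT x|(lborel \<Otimes>\<^sub>M lborel). G n x) = (LINT z|lborel. f z * (LINT w|lborel. gauss_density 1 w * h (z - \<sigma> n *\<^sub>R w)))" for n
    unfolding lborel_pair.integral_fst'[OF G_int, symmetric] by (simp add: G_def)
  moreover have "(LINT x|(lborel \<Otimes>\<^sub>M lborel). (case x of (z, w :: 'a) \<Rightarrow> f z * (gauss_density 1 w * h z))) = (LINT z|lborel. f z * h z)"
  proof -
    have fh: "integrable lborel (\<lambda>z. f z * h z)"
    proof (rule Bochner_Integration.integrable_bound)
      show "integrable lborel (\<lambda>z. B * exp (R\<^sup>2 / 8) * (f z * gaussian (1 / 8) 0 z))"
        using f_gaussian[of "1 / 8"] by (intro integrable_mult_right) simp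
      show "AE z in lborel. norm (f z * h z) \<le> norm (B * exp (R\<^sup>2 / 8) * (f z * gaussian (1 / 8) 0 z))"
      proof (intro AE_I2)
        fix z
        have "\<bar>h z\<bar> \<le> B * (exp (R\<^sup>2 / 8) * gaussian (1 / 8) 0 z)"
        proof (cases "h z = 0")
          case False
          then have "(norm z)\<^sup>2 \<le> R\<^sup>2" using supp[of z] by (intro power_mono) auto
          then have "1 \<le> exp (R\<^sup>2 / 8) * gaussian (1 / 8) 0 z"
            unfolding gaussian_def exp_add[symmetric] by simp
          then have "B * 1 \<le> B * (exp (R\<^sup>2 / 8) * gaussian (1 / 8) 0 z)" using B by (intro mult_left_mono)
          then show ?thesis using hb[of z] by linarith
        qed (use B in simp)
        then have "\<bar>f z\<bar> * \<bar>h z\<bar> \<le> \<bar>f z\<bar> * (B * (exp (R\<^sup>2 / 8) * gaussian (1 / 8) 0 z))" by (intro mult_left_mono) auto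
        then show "norm (f z * h z) \<le> norm (B * exp (R\<^sup>2 / 8) * (f z * gaussian (1 / 8) 0 z))"
          using B by (simp add: abs_mult mult_ac)
      qed
    qed measurable
    have "(LINT x|(lborel \<Otimes>\<^sub>M lborel). (case x of (z, w :: 'a) \<Rightarrow> f z * (gauss_density 1 w * h z))) =
        (LINT x|(lborel \<Otimes>\<^sub>M lborel). (case x of (z, w) \<Rightarrow> (f z * h z) * gauss_density 1 (w :: 'a)))"
      by (intro Bochner_Integration.integral_cong) auto
    also have "\<dots> = (LINT z|lborel. f z * h z)"
      unfolding lborel_pair.integral_fst'[OF lborel_pair.integrable_pair_mult[OF fh gauss_density_integrable(1)[OF zero_less_one]], symmetric]
      by (simp add: gauss_density_integrable(2))
    finally show ?thesis .
  qed
  ultimately have "(\<lambda>n. LINT z|lborel. f z * (LINT w|lborel. gauss_density 1 w * h (z - \<sigma> n *\<^sub>R w))) \<longlonglongrightarrow> (LINT z|lborel. f z * h z)"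
    by simp
  then have "(\<lambda>n. complex_of_real (LINT z|lborel. f z * (LINT w|lborel. gauss_density 1 w * h (z - \<sigma> n *\<^sub>R w)))) \<longlonglongrightarrow>
      complex_of_real (LINT z|lborel. f z * h z)"
    by (rule tendsto_of_real)
  moreover have "(LINT \<xi>|\<mu>. fourier (\<lambda>x. of_real (h x)) \<xi> * of_real (exp (- (\<sigma> n)\<^sup>2 * (norm \<xi>)\<^sup>2 / 2))) =
      of_real (LINT z|lborel. f z * (LINT w|lborel. gauss_density 1 w * h (z - \<sigma> n *\<^sub>R w)))" for n
    using \<open>h \<in> borel_measurable borel\<close> hb supp \<sigma>(1) by (rule smoothed_identity)
  ultimately show ?thesis
    by (simp only: \<sigma>_def)
qed

end

section \<open>The energy of bounded Borel sets\<close>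

lemma nn_integral_translate:
  fixes g :: "'a::euclidean_space \<Rightarrow> ennreal"
  assumes [measurable]: "g \<in> borel_measurable borel"
  shows "(\<integral>\<^sup>+x. g (x - w) \<partial>lborel) = (\<integral>\<^sup>+x. g x \<partial>lborel)"
proof -
  have "(\<integral>\<^sup>+x. g x \<partial>lborel) = (\<integral>\<^sup>+x. g x \<partial>(distr lborel borel ((+) (- w))))"
    by (simp add: lborel_distr_plus)
  also have "\<dots> = (\<integral>\<^sup>+x. g (- w + x) \<partial>lborel)"
    by (rule nn_integral_distr) measurable
  finally show ?thesis by simp
qed

text \<open>Choose a compact \<open>K\<close> and an open \<open>U\<close> with \<open>K \<subseteq> A \<subseteq> U\<close> and \<open>U - K\<close> small. A translation that moves no
point of \<open>K\<close> out of \<open>U\<close> changes the indicator only where \<open>x\<close> or \<open>x - w\<close> lies in \<open>U - K\<close>.\<close>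

lemma indicator_translation_continuous:
  fixes A :: "'a::euclidean_space set"
  assumes A: "A \<in> sets borel" "bounded A" and e: "0 < e"
  shows "\<exists>d>0. \<forall>w. norm w < d \<longrightarrow>
    (\<integral>\<^sup>+x. ennreal \<bar>indicator A (x - w) - indicator A x\<bar> \<partial>lborel) \<le> ennreal e"
proof -
  have AL: "A \<in> sets lebesgue" using A by simp
  obtain U where U: "open U" "A \<subseteq> U" "U - A \<in> lmeasurable" "emeasure lebesgue (U - A) < ennreal (e / 4)"
    using sets_lebesgue_outer_open[OF AL, of "e / 4"] e by auto
  obtain K where K: "closed K" "K \<subseteq> A" "A - K \<in> lmeasurable" "emeasure lebesgue (A - K) < ennreal (e / 4)"
    using sets_lebesgue_inner_closed[OF AL, of "e / 4"] e by auto
  have "compact K" using K A bounded_subset compact_eq_bounded_closed by blast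
  then obtain d where d: "d > 0" "(\<Union>x\<in>K. ball x d) \<subseteq> U"
    using compact_subset_open_imp_ball_epsilon_subset[of K U] U K by blast
  have UB [measurable]: "U \<in> sets borel" "K \<in> sets borel" "A \<in> sets borel" using U K A by auto
  have UK: "emeasure lborel (U - K) \<le> ennreal (e / 2)"
  proof -
    have "emeasure lborel (U - K) \<le> emeasure lborel ((U - A) \<union> (A - K))"
      by (rule emeasure_mono) (use U K in auto)
    also have "\<dots> \<le> emeasure lborel (U - A) + emeasure lborel (A - K)"
      by (rule emeasure_subadditive) auto
    also have "\<dots> \<le> ennreal (e / 4) + ennreal (e / 4)"
      using U(4) K(4) by (intro add_mono) auto
    also have "\<dots> = ennreal (e / 2)" using e by (subst ennreal_plus[symmetric]) auto
    finally show ?thesis .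
  qed
  have "(\<integral>\<^sup>+x. ennreal \<bar>indicator A (x - w) - indicator A x\<bar> \<partial>lborel) \<le> ennreal e" if w: "norm w < d" for w
  proof -
    have near: "x - w \<in> U" if "x \<in> K" for x
    proof -
      have "x - w \<in> ball x d" using w by (simp add: dist_norm)
      then show ?thesis using d(2) that by blast
    qed
    have near': "x \<in> U" if "x - w \<in> K" for x
    proof -
      have "x \<in> ball (x - w) d" using w by (simp add: dist_norm)
      then show ?thesis using d(2) that by blast
    qed
    have "(\<integral>\<^sup>+x. ennreal \<bar>indicator A (x - w) - indicator A x\<bar> \<partial>lborel) \<le>
        (\<integral>\<^sup>+x. indicator (U - K) x + indicator (U - K) (x - w) \<partial>lborel)"
    proof (rule nn_integral_mono)
      fix x
      show "ennreal \<bar>indicator A (x - w) - indicator A x\<bar> \<le> indicator (U - K) x + indicator (U - K) (x - w)"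
        using near[of x] near'[of x] U(2) K(2)
        by (cases "x \<in> A"; cases "x - w \<in> A"; cases "x \<in> K"; cases "x - w \<in> K") (auto simp: indicator_def)
    qed
    also have "\<dots> = (\<integral>\<^sup>+x. indicator (U - K) x \<partial>lborel) + (\<integral>\<^sup>+x. indicator (U - K) (x - w) \<partial>lborel)"
      by (rule nn_integral_add) measurable
    also have "(\<integral>\<^sup>+x. indicator (U - K) (x - w) \<partial>lborel) = (\<integral>\<^sup>+x. indicator (U - K) x \<partial>lborel)"
      by (rule nn_integral_translate) measurable
    also have "(\<integral>\<^sup>+x. indicator (U - K) x \<partial>lborel) + (\<integral>\<^sup>+x. indicator (U - K) x \<partial>lborel) \<le> ennreal (e / 2) + ennreal (e / 2)"
      using UK by (intro add_mono) (auto simp: nn_integral_indicator)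
    also have "\<dots> = ennreal e" using e by (subst ennreal_plus[symmetric]) auto
    finally show ?thesis .
  qed
  then show ?thesis using d(1) by blast
qed

lemma bounded_borel_finite:
  fixes A :: "'a::euclidean_space set"
  assumes "A \<in> sets borel" "bounded A"
  shows "emeasure lborel A < \<infinity>" "integrable lborel (indicator A :: 'a \<Rightarrow> real)"
proof -
  show "emeasure lborel A < \<infinity>" by (rule emeasure_bounded_finite[OF assms(2)])
  then show "integrable lborel (indicator A :: 'a \<Rightarrow> real)" using assms by simp
qed

text \<open>The volume of \<open>A \<inter> (B + u)\<close>, that is, the cross-correlation of the two indicators. It is the bridge between
the two sides of the energy identity: it is continuous, integrals against it are integrals of \<open>k (x - y)\<close>
over \<open>A \<times> B\<close>, and its Fourier transform is the product of that of \<open>1\<^sub>A\<close> with the conjugate of that of \<open>1\<^sub>B\<close>.\<close>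

definition overlap :: "'a::euclidean_space set \<Rightarrow> 'a set \<Rightarrow> 'a \<Rightarrow> real" where
  "overlap A B u = (LINT x|lborel. indicator A x * indicator B (x - u))"

lemma overlap_integrable:
  fixes A B :: "'a::euclidean_space set"
  assumes "A \<in> sets borel" "bounded A" "B \<in> sets borel"
  shows "integrable lborel (\<lambda>x. indicator A x * indicator B (x - u) :: real)"
proof (rule Bochner_Integration.integrable_bound[OF bounded_borel_finite(2)[OF assms(1,2)]])
  note [measurable] = assms
  show "(\<lambda>x. indicator A x * indicator B (x - u) :: real) \<in> borel_measurable lborel" by measurable
qed (auto simp: indicator_def)

lemma overlap_bound:
  fixes A B :: "'a::euclidean_space set"
  assumes "A \<in> sets borel" "bounded A" "B \<in> sets borel"
  shows "\<bar>overlap A B u\<bar> \<le> measure lborel A"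
proof -
  have "\<bar>overlap A B u\<bar> \<le> (LINT x|lborel. indicator A x :: real)"
    unfolding overlap_def real_norm_def[symmetric]
    by (intro Bochner_Integration.integral_norm_bound_integral overlap_integrable bounded_borel_finite assms)
      (auto simp: indicator_def)
  then show ?thesis using assms by simp
qed

lemma overlap_support:
  assumes "\<And>x. x \<in> A \<Longrightarrow> norm x \<le> R" "\<And>x. x \<in> B \<Longrightarrow> norm x \<le> R" "overlap A B u \<noteq> 0"
  shows "norm u \<le> 2 * R"
proof -
  have "\<exists>x. x \<in> A \<and> x - u \<in> B"
  proof (rule ccontr)
    assume "\<not> (\<exists>x. x \<in> A \<and> x - u \<in> B)"
    then have "(\<lambda>x. indicator A x * indicator B (x - u) :: real) = (\<lambda>_. 0)" by (auto simp: indicator_def)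
    then show False using assms(3) by (simp add: overlap_def)
  qed
  then obtain x where "norm x \<le> R" "norm (x - u) \<le> R" using assms by blast
  moreover have "norm u \<le> norm x + norm (x - u)"
    using norm_triangle_ineq4[of x "x - u"] by simp
  ultimately show ?thesis by linarith
qed

lemma overlap_continuous:
  fixes A B :: "'a::euclidean_space set"
  assumes A: "A \<in> sets borel" "bounded A" and B: "B \<in> sets borel" "bounded B"
  shows "continuous_on UNIV (overlap A B)"
  unfolding continuous_on_iff
proof (intro ballI allI impI)
  fix u :: 'a and e :: real assume e: "0 < e"
  note [measurable] = A(1) B(1)
  obtain d where d: "0 < d" "\<And>w. norm w < d \<Longrightarrow>
      (\<integral>\<^sup>+x. ennreal \<bar>indicator B (x - w) - indicator B x\<bar> \<partial>lborel) \<le> ennreal (e / 2)"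
    using indicator_translation_continuous[OF B, of "e / 2"] e by auto
  have "dist (overlap A B u') (overlap A B u) < e" if u': "dist u' u < d" for u'
  proof -
    have "ennreal (norm (overlap A B u' - overlap A B u)) =
        ennreal (norm (LINT x|lborel. indicator A x * indicator B (x - u') - indicator A x * indicator B (x - u) :: real))"
      unfolding overlap_def using A B by (subst Bochner_Integration.integral_diff) (auto intro!: overlap_integrable)
    also have "\<dots> \<le> (\<integral>\<^sup>+x. ennreal (norm (indicator A x * indicator B (x - u') - indicator A x * indicator B (x - u) :: real)) \<partial>lborel)"
      using A B by (intro integral_norm_bound_ennreal Bochner_Integration.integrable_diff overlap_integrable)
    also have "\<dots> \<le> (\<integral>\<^sup>+x. ennreal \<bar>indicator B ((x - u) - (u' - u)) - indicator B (x - u)\<bar> \<partial>lborel)"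
      by (intro nn_integral_mono ennreal_leI) (auto simp: indicator_def)
    also have "\<dots> = (\<integral>\<^sup>+x. ennreal \<bar>indicator B (x - (u' - u)) - indicator B x\<bar> \<partial>lborel)"
      by (rule nn_integral_translate[of "\<lambda>x. ennreal \<bar>indicator B (x - (u' - u)) - indicator B x\<bar>"]) measurable
    also have "\<dots> \<le> ennreal (e / 2)" using u' by (intro d(2)) (simp add: dist_norm)
    finally have "norm (overlap A B u' - overlap A B u) \<le> e / 2" using e by simp
    then show ?thesis using e by (simp add: dist_norm)
  qed
  then show "\<exists>d>0. \<forall>x'\<in>UNIV. dist x' u < d \<longrightarrow> dist (overlap A B x') (overlap A B u) < e"
    using d(1) by blast
qed

lemma integral_overlap:
  fixes k :: "'a::euclidean_space \<Rightarrow> 'b::{banach, second_countable_topology}"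
  assumes A: "A \<in> sets borel" "\<And>x. x \<in> A \<Longrightarrow> norm x \<le> R"
    and B: "B \<in> sets borel" "\<And>x. x \<in> B \<Longrightarrow> norm x \<le> R"
    and k [measurable]: "k \<in> borel_measurable borel"
    and kint: "integrable lborel (\<lambda>u. indicator (cball 0 (2 * R)) u * norm (k u))"
  shows "(LINT u|lborel. overlap A B u *\<^sub>R k u) = (LINT x:A|lborel. LINT y:B|lborel. k (x - y))"
proof -
  note [measurable] = A(1) B(1)
  have bA: "bounded A" using A(2) by (auto simp: bounded_iff)
  define F where "F = (\<lambda>(u, x). (indicator A x * indicator B (x - u)) *\<^sub>R k u)"
  have "integrable (lborel \<Otimes>\<^sub>M lborel) F"
  proof (rule Bochner_Integration.integrable_bound[OF lborel_pair.integrable_pair_mult[OF kint bounded_borel_finite(2)[OF A(1) bA]]])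
    show "F \<in> borel_measurable (lborel \<Otimes>\<^sub>M lborel)" unfolding F_def by measurable
    have "norm (F (u, x)) \<le> norm (indicator (cball 0 (2 * R)) u * norm (k u) * indicator A x)" for u x
    proof (cases "x \<in> A \<and> x - u \<in> B")
      case True
      then have "norm x \<le> R" "norm (x - u) \<le> R" using A B by auto
      moreover have "norm u \<le> norm x + norm (x - u)"
        using norm_triangle_ineq4[of x "x - u"] by simp
      ultimately have "norm u \<le> 2 * R" by linarith
      then show ?thesis using True by (simp add: F_def)
    qed (auto simp: F_def)
    then show "AE z in lborel \<Otimes>\<^sub>M lborel. norm (F z) \<le>
        norm (case z of (u, x) \<Rightarrow> indicator (cball 0 (2 * R)) u * norm (k u) * indicator A x)"
      by (intro AE_I2) (auto simp: split_paired_all)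
  qed
  then have "(LINT x|lborel. LINT u|lborel. F (u, x)) = (LINT u|lborel. LINT x|lborel. F (u, x))"
    using lborel_pair.Fubini_integral[of "\<lambda>u x. F (u, x)"] by simp
  also have "\<dots> = (LINT u|lborel. overlap A B u *\<^sub>R k u)"
    unfolding F_def overlap_def using A B bA
    by (intro Bochner_Integration.integral_cong) (auto simp: overlap_integrable)
  also have "(LINT x|lborel. LINT u|lborel. F (u, x)) = (LINT x:A|lborel. LINT y:B|lborel. k (x - y))"
    unfolding set_lebesgue_integral_def
  proof (intro Bochner_Integration.integral_cong refl)
    fix x
    have "(LINT u|lborel. F (u, x)) = indicator A x *\<^sub>R (LINT u|lborel. indicator B (x - u) *\<^sub>R k u)"
      by (subst integral_scaleR_right[symmetric]) (simp add: F_def)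
    also have "(LINT u|lborel. indicator B (x - u) *\<^sub>R k u) =
        \<bar>- 1\<bar> ^ DIM('a) *\<^sub>R (LINT y|lborel. indicator B (x - (x + (- 1) *\<^sub>R y)) *\<^sub>R k (x + (- 1) *\<^sub>R y))"
      by (intro lborel_integral_affine) measurable
    finally show "(LINT u|lborel. F (u, x)) = indicator A x *\<^sub>R (LINT y|lborel. indicator B y *\<^sub>R k (x - y))"
      by simp
  qed
  finally show ?thesis by simp
qed

definition fourier_indicator :: "'a::euclidean_space set \<Rightarrow> 'a \<Rightarrow> complex" where
  "fourier_indicator A = fourier (\<lambda>x. of_real (indicator A x))"

lemma fourier_indicator_measurable [measurable]:
  "A \<in> sets borel \<Longrightarrow> fourier_indicator A \<in> borel_measurable borel"
proof -
  assume [measurable]: "A \<in> sets borel"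
  show ?thesis unfolding fourier_indicator_def by measurable
qed

lemma fourier_overlap:
  fixes A B :: "'a::euclidean_space set"
  assumes A: "A \<in> sets borel" "\<And>x. x \<in> A \<Longrightarrow> norm x \<le> R"
    and B: "B \<in> sets borel" "\<And>x. x \<in> B \<Longrightarrow> norm x \<le> R"
  shows "fourier (\<lambda>u. of_real (overlap A B u)) \<xi> = fourier_indicator A \<xi> * cnj (fourier_indicator B \<xi>)"
proof -
  define e where "e u = exp (- (\<i> * complex_of_real (\<xi> \<bullet> u)))" for u
  have [measurable]: "e \<in> borel_measurable borel" unfolding e_def by measurable
  have e_diff: "e (x - y) = e x * cnj (e y)" for x y
    by (simp add: e_def exp_cnj exp_add[symmetric] inner_diff_right algebra_simps)
  have FA: "fourier_indicator A \<xi> = (LINT x|lborel. indicator A x *\<^sub>R e x)" for A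
    unfolding fourier_indicator_def fourier_def e_def
    by (intro Bochner_Integration.integral_cong) (auto simp: indicator_def)
  have "fourier (\<lambda>u. of_real (overlap A B u)) \<xi> = (LINT u|lborel. overlap A B u *\<^sub>R e u)"
    unfolding fourier_def e_def by (intro Bochner_Integration.integral_cong) (auto simp: scaleR_conv_of_real mult.commute)
  also have "\<dots> = (LINT x:A|lborel. LINT y:B|lborel. e (x - y))"
  proof (rule integral_overlap[OF A B])
    have "integrable lborel (indicator (cball 0 (2 * R)) :: 'a \<Rightarrow> real)"
      by (rule bounded_borel_finite) auto
    then show "integrable lborel (\<lambda>u. indicator (cball 0 (2 * R)) u * norm (e u))"
      by (simp add: e_def)
  qed measurable
  also have "\<dots> = (LINT x|lborel. (indicator A x *\<^sub>R e x) * cnj (LINT y|lborel. indicator B y *\<^sub>R e y))"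
    unfolding set_lebesgue_integral_def
  proof (intro Bochner_Integration.integral_cong refl)
    fix x
    have "(LINT y|lborel. indicator B y *\<^sub>R e (x - y)) = (LINT y|lborel. e x * cnj (indicator B y *\<^sub>R e y))"
      by (intro Bochner_Integration.integral_cong) (auto simp: e_diff)
    also have "\<dots> = e x * cnj (LINT y|lborel. indicator B y *\<^sub>R e y)"
      by (simp only: integral_mult_right_zero Bochner_Integration.integral_cnj)
    finally show "indicator A x *\<^sub>R (LINT y|lborel. indicator B y *\<^sub>R e (x - y)) =
        (indicator A x *\<^sub>R e x) * cnj (LINT y|lborel. indicator B y *\<^sub>R e y)" by simp
  qed
  also have "\<dots> = fourier_indicator A \<xi> * cnj (fourier_indicator B \<xi>)"
    by (simp only: integral_mult_left_zero FA)
  finally show ?thesis .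
qed

context tempered_fourier begin

lemma f_local_integrable: "integrable lborel (\<lambda>u. indicator (cball 0 R) u * norm (f u))"
proof (rule Bochner_Integration.integrable_bound)
  show "integrable lborel (\<lambda>u. exp (R\<^sup>2) * (f u * gaussian 1 0 u))"
    using f_gaussian[of 1] by (intro integrable_mult_right) simp
  show "AE u in lborel. norm (indicator (cball 0 R) u * norm (f u)) \<le> norm (exp (R\<^sup>2) * (f u * gaussian 1 0 u))"
  proof (intro AE_I2)
    fix u :: 'a
    show "norm (indicator (cball 0 R) u * norm (f u)) \<le> norm (exp (R\<^sup>2) * (f u * gaussian 1 0 u))"
    proof (cases "norm u \<le> R")
      case True
      then have "(norm u)\<^sup>2 \<le> R\<^sup>2" by (intro power_mono) auto
      then have "1 \<le> exp (R\<^sup>2) * gaussian 1 0 u" unfolding gaussian_def exp_add[symmetric] by simp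
      then have "\<bar>f u\<bar> * 1 \<le> \<bar>f u\<bar> * (exp (R\<^sup>2) * gaussian 1 0 u)" by (intro mult_left_mono) auto
      then show ?thesis using True by (simp add: abs_mult mult_ac)
    qed simp
  qed
  have [measurable]: "cball (0 :: 'a) R \<in> sets borel" by simp
  show "(\<lambda>u. indicator (cball 0 R) u * norm (f u)) \<in> borel_measurable lborel" by measurable
qed

lemma smoothed_energy_limit:
  assumes A: "A \<in> sets borel" "bounded A" and B: "B \<in> sets borel" "bounded B"
  shows "(\<lambda>n. LINT \<xi>|\<mu>. fourier_indicator A \<xi> * cnj (fourier_indicator B \<xi>) *
      of_real (exp (- (1 / real (Suc n))\<^sup>2 * (norm \<xi>)\<^sup>2 / 2)))
    \<longlonglongrightarrow> of_real (LINT x:A|lborel. LINT y:B|lborel. f (x - y))"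
proof -
  have "bounded (A \<union> B)" using A B by simp
  then obtain R where "\<And>x. x \<in> A \<union> B \<Longrightarrow> norm x \<le> R" by (auto simp: bounded_iff)
  then have R: "\<And>x. x \<in> A \<Longrightarrow> norm x \<le> R" "\<And>x. x \<in> B \<Longrightarrow> norm x \<le> R" by auto
  have eq: "(LINT z|lborel. f z * overlap A B z) = (LINT x:A|lborel. LINT y:B|lborel. f (x - y))"
    using integral_overlap[OF A(1) R(1) B(1) R(2) f_measurable f_local_integrable]
    by (simp add: mult.commute)
  have "norm u \<le> 2 * R" if "overlap A B u \<noteq> 0" for u
    by (rule overlap_support[of A R B]) (use R that in auto)
  then have "(\<lambda>n. LINT \<xi>|\<mu>. fourier (\<lambda>x. of_real (overlap A B x)) \<xi> *
      of_real (exp (- (1 / real (Suc n))\<^sup>2 * (norm \<xi>)\<^sup>2 / 2))) \<longlonglongrightarrow> of_real (LINT z|lborel. f z * overlap A B z)"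
    by (rule smoothed_limit[OF overlap_continuous[OF A B] overlap_bound[OF A B(1)]])
  moreover have "fourier (\<lambda>x. of_real (overlap A B x)) \<xi> = fourier_indicator A \<xi> * cnj (fourier_indicator B \<xi>)" for \<xi>
    by (rule fourier_overlap[OF A(1) R(1) B(1) R(2)])
  ultimately show ?thesis by (simp only: eq)
qed

lemma fourier_indicator_bound:
  fixes A :: "'a set"
  assumes A: "A \<in> sets borel" "bounded A"
  shows "norm (fourier_indicator A \<xi>) \<le> measure lborel A"
proof -
  have "norm (fourier_indicator A \<xi>) \<le> (LINT x|lborel. indicator A x)"
    unfolding fourier_indicator_def fourier_def
  proof (rule Bochner_Integration.integral_norm_bound_integral)
    show i: "integrable lborel (indicator A :: 'a \<Rightarrow> real)" by (rule bounded_borel_finite[OF A])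
    note [measurable] = A(1)
    show "integrable lborel (\<lambda>x. exp (- (\<i> * complex_of_real (\<xi> \<bullet> x))) * complex_of_real (indicator A x))"
      by (rule Bochner_Integration.integrable_bound[OF i]) (auto simp: norm_mult)
  qed (auto simp: norm_mult)
  then show ?thesis using A by simp
qed

text \<open>For \<open>A = B\<close> the smoothed energies are integrals of nonnegative functions that increase to the
square of the Fourier transform, and they converge to a finite limit; Fatou's lemma concludes.\<close>

lemma fourier_indicator_square_integrable:
  assumes A: "A \<in> sets borel" "bounded A"
  shows "integrable \<mu> (\<lambda>\<xi>. (norm (fourier_indicator A \<xi>))\<^sup>2)"
proof (rule integrableI_bounded)
  note [measurable] = A(1)
  define e where "e n \<xi> = exp (- (1 / real (Suc n))\<^sup>2 * (norm \<xi>)\<^sup>2 / 2)" for n and \<xi> :: 'a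
  have [measurable]: "e n \<in> borel_measurable borel" for n unfolding e_def by measurable
  define I where "I = (LINT x:A|lborel. LINT y:A|lborel. f (x - y))"
  have e_int: "integrable \<mu> (e n)" for n
    using gauss_integrable_riesz[OF \<beta>, of "(1 / real (Suc n))\<^sup>2 / 2"] by (simp add: e_def[abs_def] mult_ac)
  have int: "integrable \<mu> (\<lambda>\<xi>. (norm (fourier_indicator A \<xi>))\<^sup>2 * e n \<xi>)" for n
  proof (rule Bochner_Integration.integrable_bound)
    show "integrable \<mu> (\<lambda>\<xi>. (measure lborel A)\<^sup>2 * e n \<xi>)" using e_int by (rule integrable_mult_right)
    show "AE \<xi> in \<mu>. norm ((norm (fourier_indicator A \<xi>))\<^sup>2 * e n \<xi>) \<le> norm ((measure lborel A)\<^sup>2 * e n \<xi>)"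
      using fourier_indicator_bound[OF A] by (intro AE_I2) (auto simp: e_def intro!: mult_right_mono power_mono)
  qed measurable
  have "(\<lambda>n. Re (LINT \<xi>|\<mu>. fourier_indicator A \<xi> * cnj (fourier_indicator A \<xi>) * of_real (e n \<xi>)))
    \<longlonglongrightarrow> Re (of_real I)"
    unfolding I_def e_def by (intro tendsto_Re smoothed_energy_limit A)
  moreover have "(LINT \<xi>|\<mu>. fourier_indicator A \<xi> * cnj (fourier_indicator A \<xi>) * of_real (e n \<xi>)) =
      of_real (LINT \<xi>|\<mu>. (norm (fourier_indicator A \<xi>))\<^sup>2 * e n \<xi>)" for n
    by (simp only: complex_norm_square[symmetric] of_real_power[symmetric] of_real_mult[symmetric] integral_complex_of_real)
  ultimately have lim: "(\<lambda>n. LINT \<xi>|\<mu>. (norm (fourier_indicator A \<xi>))\<^sup>2 * e n \<xi>) \<longlonglongrightarrow> I" by simp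
  have pt: "(\<lambda>n. ennreal ((norm (fourier_indicator A \<xi>))\<^sup>2 * e n \<xi>)) \<longlonglongrightarrow> ennreal ((norm (fourier_indicator A \<xi>))\<^sup>2)" for \<xi>
  proof -
    have "(\<lambda>n. e n \<xi>) \<longlonglongrightarrow> exp (- 0\<^sup>2 * (norm \<xi>)\<^sup>2 / 2)"
      unfolding e_def by (intro tendsto_intros) (real_asymp, simp)
    then have "(\<lambda>n. (norm (fourier_indicator A \<xi>))\<^sup>2 * e n \<xi>) \<longlonglongrightarrow> (norm (fourier_indicator A \<xi>))\<^sup>2 * 1"
      by (intro tendsto_intros) simp
    then show ?thesis by (intro tendsto_ennrealI) simp
  qed
  have "(\<integral>\<^sup>+\<xi>. ennreal (norm ((norm (fourier_indicator A \<xi>))\<^sup>2)) \<partial>\<mu>) =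
      (\<integral>\<^sup>+\<xi>. liminf (\<lambda>n. ennreal ((norm (fourier_indicator A \<xi>))\<^sup>2 * e n \<xi>)) \<partial>\<mu>)"
    using lim_imp_Liminf[OF _ pt] by (intro nn_integral_cong) auto
  also have "\<dots> \<le> liminf (\<lambda>n. \<integral>\<^sup>+\<xi>. ennreal ((norm (fourier_indicator A \<xi>))\<^sup>2 * e n \<xi>) \<partial>\<mu>)"
    by (rule nn_integral_liminf) measurable
  also have "(\<lambda>n. \<integral>\<^sup>+\<xi>. ennreal ((norm (fourier_indicator A \<xi>))\<^sup>2 * e n \<xi>) \<partial>\<mu>) =
      (\<lambda>n. ennreal (LINT \<xi>|\<mu>. (norm (fourier_indicator A \<xi>))\<^sup>2 * e n \<xi>))"
    using int by (intro ext nn_integral_eq_integral) (auto simp: e_def)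
  also have "liminf (\<lambda>n. ennreal (LINT \<xi>|\<mu>. (norm (fourier_indicator A \<xi>))\<^sup>2 * e n \<xi>)) = ennreal I"
    by (intro lim_imp_Liminf tendsto_ennrealI lim) simp
  also have "\<dots> < \<infinity>" by simp
  finally show "(\<integral>\<^sup>+\<xi>. ennreal (norm ((norm (fourier_indicator A \<xi>))\<^sup>2)) \<partial>\<mu>) < \<infinity>" .
qed (use A in measurable)

text \<open>Square integrability of both factors now supplies an integrable majorant, and the smoothing can be
removed by dominated convergence.\<close>

theorem fourier_energy_identity:
  assumes A: "A \<in> sets borel" "bounded A" and B: "B \<in> sets borel" "bounded B"
  shows "integrable \<mu> (\<lambda>\<xi>. fourier_indicator A \<xi> * cnj (fourier_indicator B \<xi>))"
    and "(LINT \<xi>|\<mu>. fourier_indicator A \<xi> * cnj (fourier_indicator B \<xi>)) =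
      of_real (LINT x:A|lborel. LINT y:B|lborel. f (x - y))"
proof -
  note [measurable] = A(1) B(1)
  have [measurable]: "cnj \<in> borel_measurable borel"
    by (intro borel_measurable_continuous_onI continuous_intros)
  show int: "integrable \<mu> (\<lambda>\<xi>. fourier_indicator A \<xi> * cnj (fourier_indicator B \<xi>))"
  proof (rule Bochner_Integration.integrable_bound)
    show "integrable \<mu> (\<lambda>\<xi>. (norm (fourier_indicator A \<xi>))\<^sup>2 + (norm (fourier_indicator B \<xi>))\<^sup>2)"
      by (intro Bochner_Integration.integrable_add fourier_indicator_square_integrable A B)
    show "AE \<xi> in \<mu>. norm (fourier_indicator A \<xi> * cnj (fourier_indicator B \<xi>)) \<le>
        norm ((norm (fourier_indicator A \<xi>))\<^sup>2 + (norm (fourier_indicator B \<xi>))\<^sup>2)"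
    proof (intro AE_I2)
      fix \<xi> :: 'a
      have "2 * norm (fourier_indicator A \<xi>) * norm (fourier_indicator B \<xi>) \<le>
          (norm (fourier_indicator A \<xi>))\<^sup>2 + (norm (fourier_indicator B \<xi>))\<^sup>2" by (rule sum_squares_bound)
      moreover have "0 \<le> norm (fourier_indicator A \<xi>) * norm (fourier_indicator B \<xi>)" by simp
      ultimately have "norm (fourier_indicator A \<xi>) * norm (fourier_indicator B \<xi>) \<le>
          (norm (fourier_indicator A \<xi>))\<^sup>2 + (norm (fourier_indicator B \<xi>))\<^sup>2" by linarith
      then show "norm (fourier_indicator A \<xi> * cnj (fourier_indicator B \<xi>)) \<le>
        norm ((norm (fourier_indicator A \<xi>))\<^sup>2 + (norm (fourier_indicator B \<xi>))\<^sup>2)" by (simp add: norm_mult)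
    qed
  qed measurable
  have "(\<lambda>n. LINT \<xi>|\<mu>. fourier_indicator A \<xi> * cnj (fourier_indicator B \<xi>) *
      of_real (exp (- (1 / real (Suc n))\<^sup>2 * (norm \<xi>)\<^sup>2 / 2)))
    \<longlonglongrightarrow> (LINT \<xi>|\<mu>. fourier_indicator A \<xi> * cnj (fourier_indicator B \<xi>))"
  proof (rule integral_dominated_convergence[where w = "\<lambda>\<xi>. norm (fourier_indicator A \<xi> * cnj (fourier_indicator B \<xi>))"])
    show "integrable \<mu> (\<lambda>\<xi>. norm (fourier_indicator A \<xi> * cnj (fourier_indicator B \<xi>)))"
      using int by (rule integrable_norm)
    have "(\<lambda>n. fourier_indicator A \<xi> * cnj (fourier_indicator B \<xi>) * of_real (exp (- (1 / real (Suc n))\<^sup>2 * (norm \<xi>)\<^sup>2 / 2)))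
        \<longlonglongrightarrow> fourier_indicator A \<xi> * cnj (fourier_indicator B \<xi>) * of_real (exp (- 0\<^sup>2 * (norm \<xi>)\<^sup>2 / 2))" for \<xi> :: 'a
      by (intro tendsto_intros) (real_asymp, simp)
    then show "AE \<xi> in \<mu>. (\<lambda>n. fourier_indicator A \<xi> * cnj (fourier_indicator B \<xi>) * of_real (exp (- (1 / real (Suc n))\<^sup>2 * (norm \<xi>)\<^sup>2 / 2)))
        \<longlonglongrightarrow> fourier_indicator A \<xi> * cnj (fourier_indicator B \<xi>)"
      by (intro AE_I2) simp
    show "AE \<xi> in \<mu>. norm (fourier_indicator A \<xi> * cnj (fourier_indicator B \<xi>) * of_real (exp (- (1 / real (Suc n))\<^sup>2 * (norm \<xi>)\<^sup>2 / 2)))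
        \<le> norm (fourier_indicator A \<xi> * cnj (fourier_indicator B \<xi>))" for n
      by (intro AE_I2) (simp add: norm_mult mult_left_le)
  qed measurable
  then show "(LINT \<xi>|\<mu>. fourier_indicator A \<xi> * cnj (fourier_indicator B \<xi>)) =
      of_real (LINT x:A|lborel. LINT y:B|lborel. f (x - y))"
    using smoothed_energy_limit[OF A B] by (rule LIMSEQ_unique)
qed

end

section \<open>Gaussian moments and elementary integrands\<close>

text \<open>The degenerate case obeys the same formula; for \<open>k = 0\<close> both sides are 1.\<close>

lemma centered_gaussian_moments:
  assumes "prob_space M" and X: "centered_gaussian M X"
  shows "integrable M (\<lambda>\<omega>. X \<omega> ^ (2 * k))"
    and "(LINT \<omega>|M. X \<omega> ^ (2 * k)) = fact (2 * k) / (2 ^ k * fact k) * (LINT \<omega>|M. (X \<omega>)\<^sup>2) ^ k"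
proof -
  interpret prob_space M by fact
  have X_meas [measurable]: "X \<in> borel_measurable M" using X by (simp add: centered_gaussian_def)
  have "integrable M (\<lambda>\<omega>. X \<omega> ^ (2 * k)) \<and>
      (LINT \<omega>|M. X \<omega> ^ (2 * k)) = fact (2 * k) / (2 ^ k * fact k) * (LINT \<omega>|M. (X \<omega>)\<^sup>2) ^ k"
  proof (cases "AE \<omega> in M. X \<omega> = 0")
    case True
    have eq: "integrable M (\<lambda>\<omega>. X \<omega> ^ (2 * j)) \<and> (LINT \<omega>|M. X \<omega> ^ (2 * j)) = 0 ^ (2 * j)" for j
    proof -
      have ae: "AE \<omega> in M. X \<omega> ^ (2 * j) = 0 ^ (2 * j)" using True by eventually_elim simp
      have "integrable M (\<lambda>\<omega>. X \<omega> ^ (2 * j)) \<longleftrightarrow> integrable M (\<lambda>\<omega>. 0 ^ (2 * j) :: real)"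
        by (rule integrable_cong_AE) (use ae in auto)
      moreover have "(LINT \<omega>|M. X \<omega> ^ (2 * j)) = (LINT \<omega>|M. 0 ^ (2 * j) :: real)"
        by (rule integral_cong_AE) (use ae in auto)
      ultimately show ?thesis by (simp add: prob_space)
    qed
    show ?thesis using eq[of k] eq[of 1] by (cases k) auto
  next
    case False
    then obtain \<sigma> where \<sigma>: "0 < \<sigma>" "distributed M lborel X (\<lambda>x. ennreal (normal_density 0 \<sigma> x))"
      using X by (auto simp: centered_gaussian_def)
    have mom: "has_bochner_integral lborel (\<lambda>x. normal_density 0 \<sigma> x * x ^ (2 * j)) (fact (2 * j) / ((2 / \<sigma>\<^sup>2) ^ j * fact j))" for j
      using normal_moment_even[OF \<sigma>(1), of 0 j] by simp
    have eq: "integrable M (\<lambda>\<omega>. X \<omega> ^ (2 * j)) \<and> (LINT \<omega>|M. X \<omega> ^ (2 * j)) = fact (2 * j) / ((2 / \<sigma>\<^sup>2) ^ j * fact j)" for j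
    proof
      show "integrable M (\<lambda>\<omega>. X \<omega> ^ (2 * j))"
        using distributed_integrable[OF \<sigma>(2), of "\<lambda>x. x ^ (2 * j)"] mom[of j] by (auto simp: has_bochner_integral_iff)
      show "(LINT \<omega>|M. X \<omega> ^ (2 * j)) = fact (2 * j) / ((2 / \<sigma>\<^sup>2) ^ j * fact j)"
        using distributed_integral[OF \<sigma>(2), of "\<lambda>x. x ^ (2 * j)"] mom[of j] by (auto simp: has_bochner_integral_iff)
    qed
    have "(LINT \<omega>|M. (X \<omega>)\<^sup>2) = \<sigma>\<^sup>2" using eq[of 1] by simp
    then show ?thesis using eq[of k] \<sigma>(1) by (simp add: power_divide)
  qed
  then show "integrable M (\<lambda>\<omega>. X \<omega> ^ (2 * k))"
    "(LINT \<omega>|M. X \<omega> ^ (2 * k)) = fact (2 * k) / (2 ^ k * fact k) * (LINT \<omega>|M. (X \<omega>)\<^sup>2) ^ k" by auto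
qed

lemma centered_gaussian_tail:
  assumes "prob_space M" and X: "centered_gaussian M X" and e: "0 < e"
    and Q: "(LINT \<omega>|M. (X \<omega>)\<^sup>2) \<le> Q"
  shows "emeasure M {\<omega> \<in> space M. e \<le> \<bar>X \<omega>\<bar>} \<le> ennreal (fact (2 * k) / (2 ^ k * fact k) * Q ^ k / e ^ (2 * k))"
proof -
  interpret prob_space M by fact
  have X_meas [measurable]: "X \<in> borel_measurable M" using X by (simp add: centered_gaussian_def)
  have "emeasure M {\<omega> \<in> space M. e \<le> \<bar>X \<omega>\<bar>} \<le> emeasure M {\<omega> \<in> space M. 1 \<le> ennreal (1 / e ^ (2 * k)) * ennreal (X \<omega> ^ (2 * k))}"
  proof (rule emeasure_mono)
    show "{\<omega> \<in> space M. e \<le> \<bar>X \<omega>\<bar>} \<subseteq> {\<omega> \<in> space M. 1 \<le> ennreal (1 / e ^ (2 * k)) * ennreal (X \<omega> ^ (2 * k))}"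
    proof safe
      fix \<omega> assume "e \<le> \<bar>X \<omega>\<bar>"
      then have "e ^ (2 * k) \<le> \<bar>X \<omega>\<bar> ^ (2 * k)" using e by (intro power_mono) auto
      then have "1 \<le> 1 / e ^ (2 * k) * X \<omega> ^ (2 * k)" using e by (simp add: power_even_abs field_simps)
      then show "1 \<le> ennreal (1 / e ^ (2 * k)) * ennreal (X \<omega> ^ (2 * k))"
        using e by (subst ennreal_mult[symmetric]) auto
    qed
  qed measurable
  also have "\<dots> \<le> ennreal (1 / e ^ (2 * k)) * (\<integral>\<^sup>+\<omega>. ennreal (X \<omega> ^ (2 * k)) * indicator (space M) \<omega> \<partial>M)"
    by (rule nn_integral_Markov_inequality) measurable
  also have "(\<integral>\<^sup>+\<omega>. ennreal (X \<omega> ^ (2 * k)) * indicator (space M) \<omega> \<partial>M) = (\<integral>\<^sup>+\<omega>. ennreal (X \<omega> ^ (2 * k)) \<partial>M)"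
    by (intro nn_integral_cong) auto
  also have "\<dots> = ennreal (LINT \<omega>|M. X \<omega> ^ (2 * k))"
    using centered_gaussian_moments(1)[OF assms(1,2)] by (intro nn_integral_eq_integral) auto
  also have "ennreal (1 / e ^ (2 * k)) * \<dots> \<le> ennreal (1 / e ^ (2 * k)) * ennreal (fact (2 * k) / (2 ^ k * fact k) * Q ^ k)"
    unfolding centered_gaussian_moments(2)[OF assms(1,2)] using Q
    by (intro mult_left_mono ennreal_leI power_mono) auto
  also have "\<dots> = ennreal (fact (2 * k) / (2 ^ k * fact k) * Q ^ k / e ^ (2 * k))"
  proof -
    have "0 \<le> (LINT \<omega>|M. (X \<omega>)\<^sup>2)" by simp
    then have "0 \<le> Q" using Q by linarith
    then show ?thesis using e by (subst ennreal_mult[symmetric]) (auto simp: mult_ac)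
  qed
  finally show ?thesis .
qed

lemma sum_list_triples:
  "(\<Sum>(c, t, A)\<leftarrow>es. F c t A) = (\<Sum>i<length es. F (fst (es ! i)) (fst (snd (es ! i))) (snd (snd (es ! i))))"
  for F :: "_ \<Rightarrow> _ \<Rightarrow> _ \<Rightarrow> 'b::comm_monoid_add"
  by (simp add: sum_list_sum_nth atLeast0LessThan case_prod_beta)

lemma valid_elem_nth:
  assumes "valid_elem es" "i < length es"
  shows "0 \<le> fst (snd (es ! i))" "snd (snd (es ! i)) \<in> sets borel" "bounded (snd (snd (es ! i)))"
proof -
  have "case es ! i of (c, t, A) \<Rightarrow> (t, A) \<in> noise_index"
    using assms(1) nth_mem[OF assms(2)] unfolding valid_elem_def by (rule bspec)
  then show "0 \<le> fst (snd (es ! i))" "snd (snd (es ! i)) \<in> sets borel" "bounded (snd (snd (es ! i)))"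
    by (auto simp: noise_index_def case_prod_beta)
qed

definition elem_diff :: "'a elem \<Rightarrow> 'a elem \<Rightarrow> 'a elem" where
  "elem_diff es es' = es @ map (\<lambda>(c, t, A). (- c, t, A)) es'"

lemma valid_elem_diff: "valid_elem es \<Longrightarrow> valid_elem es' \<Longrightarrow> valid_elem (elem_diff es es')"
  by (fastforce simp: valid_elem_def elem_diff_def)

lemma elem_integral_diff: "elem_integral W (elem_diff es es') \<omega> = elem_integral W es \<omega> - elem_integral W es' \<omega>"
proof -
  have "(\<Sum>(c, t, A)\<leftarrow>map (\<lambda>(c, t, A). (- c, t, A)) es'. c * W t A \<omega>) = - (\<Sum>(c, t, A)\<leftarrow>es'. c * W t A \<omega>)"
    by (induction es') auto
  then show ?thesis by (simp add: elem_integral_def elem_diff_def)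
qed

definition elem_fourier :: "'a::euclidean_space elem \<Rightarrow> real \<Rightarrow> 'a \<Rightarrow> complex" where
  "elem_fourier es r = fourier (\<lambda>x. of_real (elem_fun es r x))"

lemma elem_fourier_eq:
  fixes es :: "'a::euclidean_space elem"
  assumes es: "valid_elem es"
  shows "elem_fourier es r \<xi> = (\<Sum>i<length es. (of_real (fst (es ! i)) * fourier_indicator (snd (snd (es ! i))) \<xi>) *
    indicator {0..fst (snd (es ! i))} r)"
proof -
  define c t A where "c i = fst (es ! i)" and "t i = fst (snd (es ! i))" and "A i = snd (snd (es ! i))" for i
  have int: "integrable lborel (\<lambda>x. exp (- (\<i> * of_real (\<xi> \<bullet> x))) * complex_of_real (indicator (A i) x))"
    if i: "i < length es" for i
  proof (rule Bochner_Integration.integrable_bound)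
    show "integrable lborel (indicator (A i) :: 'a \<Rightarrow> real)"
      using valid_elem_nth[OF es i] by (intro bounded_borel_finite) (auto simp: A_def)
    have [measurable]: "A i \<in> sets borel" using valid_elem_nth[OF es i] by (auto simp: A_def)
    show "(\<lambda>x. exp (- (\<i> * of_real (\<xi> \<bullet> x))) * complex_of_real (indicator (A i) x)) \<in> borel_measurable lborel"
      by measurable
  qed (auto simp: norm_mult)
  have "elem_fourier es r \<xi> = (LINT x|lborel. (\<Sum>i<length es. (of_real (c i) * indicator {0..t i} r) *
      (exp (- (\<i> * of_real (\<xi> \<bullet> x))) * complex_of_real (indicator (A i) x))))"
    unfolding elem_fourier_def fourier_def elem_fun_def sum_list_triples of_real_sum sum_distrib_left c_def t_def A_def
    by (intro Bochner_Integration.integral_cong refl sum.cong) (auto simp: indicator_def)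
  also have "\<dots> = (\<Sum>i<length es. (LINT x|lborel. (of_real (c i) * indicator {0..t i} r) *
      (exp (- (\<i> * of_real (\<xi> \<bullet> x))) * complex_of_real (indicator (A i) x))))"
    using int by (intro Bochner_Integration.integral_sum) auto
  also have "\<dots> = (\<Sum>i<length es. (of_real (c i) * indicator {0..t i} r) * fourier_indicator (A i) \<xi>)"
    by (simp only: integral_mult_right_zero fourier_indicator_def fourier_def)
  finally show ?thesis by (simp add: c_def t_def A_def mult_ac)
qed

lemma elem_fourier_diff:
  assumes "valid_elem es" "valid_elem es'"
  shows "elem_fourier (elem_diff es es') r \<xi> = elem_fourier es r \<xi> - elem_fourier es' r \<xi>"
proof -
  have eq: "elem_fourier es r \<xi> = (\<Sum>(c, t, A)\<leftarrow>es. (of_real c * fourier_indicator A \<xi>) * indicator {0..t} r)"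
    if "valid_elem es" for es :: "'a elem"
    unfolding sum_list_triples elem_fourier_eq[OF that] ..
  have neg: "(\<Sum>(c, t, A)\<leftarrow>map (\<lambda>(c, t, A). (- c, t, A)) es'. (of_real c * fourier_indicator A \<xi>) * indicator {0..t} r) =
      - (\<Sum>(c, t, A)\<leftarrow>es'. (of_real c * fourier_indicator A \<xi>) * indicator {0..t} r :: complex)"
    by (induction es') auto
  show ?thesis
    unfolding eq[OF valid_elem_diff[OF assms]] eq[OF assms(1)] eq[OF assms(2)]
    using neg by (simp add: elem_diff_def)
qed

lemma bounded_supp_sum:
  "finite I \<Longrightarrow> (\<And>i. i \<in> I \<Longrightarrow> bounded_supp (g i)) \<Longrightarrow> bounded_supp (\<lambda>r. \<Sum>i\<in>I. g i r)"
  by (induction I rule: finite_induct) auto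

lemma bounded_supp_elem_fourier: "valid_elem es \<Longrightarrow> bounded_supp (\<lambda>r. elem_fourier es r \<xi>)"
  unfolding elem_fourier_eq by (intro bounded_supp_sum bounded_supp_scale bounded_supp_indicator) auto

lemma kernel_form_zero_left: "kernel_form p (\<lambda>_. 0) h = 0"
  and kernel_form_zero_right: "kernel_form p g (\<lambda>_. 0) = 0"
  by (simp_all add: kernel_form_def set_lebesgue_integral_def)

lemma kernel_form_sum_left:
  assumes p: "-1 < p" and h: "bounded_supp h"
  shows "finite I \<Longrightarrow> (\<And>i. i \<in> I \<Longrightarrow> bounded_supp (g i)) \<Longrightarrow>
    kernel_form p (\<lambda>r. \<Sum>i\<in>I. g i r) h = (\<Sum>i\<in>I. kernel_form p (g i) h)"
proof (induction I rule: finite_induct)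
  case (insert i I)
  have "kernel_form p (\<lambda>r. g i r + (\<Sum>i\<in>I. g i r)) h = kernel_form p (g i) h + kernel_form p (\<lambda>r. \<Sum>i\<in>I. g i r) h"
    using insert by (intro kernel_form_add_left p h bounded_supp_sum) auto
  then show ?case using insert by simp
qed (simp add: kernel_form_zero_left)

lemma kernel_form_sum_right:
  assumes p: "-1 < p" and g: "bounded_supp g"
  shows "finite I \<Longrightarrow> (\<And>i. i \<in> I \<Longrightarrow> bounded_supp (h i)) \<Longrightarrow>
    kernel_form p g (\<lambda>r. \<Sum>i\<in>I. h i r) = (\<Sum>i\<in>I. kernel_form p g (h i))"
proof (induction I rule: finite_induct)
  case (insert i I)
  have "kernel_form p g (\<lambda>r. h i r + (\<Sum>i\<in>I. h i r)) = kernel_form p g (h i) + kernel_form p g (\<lambda>r. \<Sum>i\<in>I. h i r)"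
    using insert by (intro kernel_form_add_right p g bounded_supp_sum) auto
  then show ?case using insert by simp
qed (simp add: kernel_form_zero_right)

text \<open>The form on indicators of intervals starting at 0 is the time covariance of the noise.\<close>

lemma kernel_form_indicators:
  assumes H: "1 / 2 < H" and "0 \<le> t" "0 \<le> s"
  shows "of_real (H * (2 * H - 1)) * kernel_form (2 * H - 2) (indicator {0..t}) (indicator {0..s}) =
    complex_of_real (fbm_cov H t s)"
proof -
  have "kernel_form (2 * H - 2) (indicator {0..t}) (indicator {0..s}) =
      (LINT v|lborel. complex_of_real (indicator {0..s} v *\<^sub>R (LINT r|lborel. indicator {0..t} r *\<^sub>R \<bar>r - v\<bar> powr (2 * H - 2))))"
    unfolding kernel_form_def set_lebesgue_integral_def
  proof (intro Bochner_Integration.integral_cong refl)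
    fix v :: real
    have "(LINT r|lborel. indicator {0..} r *\<^sub>R (indicator {0..t} r * cnj (indicator {0..s} v) * complex_of_real (\<bar>r - v\<bar> powr (2 * H - 2)))) =
        (LINT r|lborel. complex_of_real (indicator {0..s} v * (indicator {0..t} r *\<^sub>R \<bar>r - v\<bar> powr (2 * H - 2))))"
      by (intro Bochner_Integration.integral_cong) (auto simp: indicator_def)
    also have "\<dots> = complex_of_real (indicator {0..s} v * (LINT r|lborel. indicator {0..t} r *\<^sub>R \<bar>r - v\<bar> powr (2 * H - 2)))"
      by (simp only: integral_complex_of_real integral_mult_right_zero)
    finally show "indicator {0..} v *\<^sub>R (LINT r|lborel. indicator {0..} r *\<^sub>R (indicator {0..t} r * cnj (indicator {0..s} v) * complex_of_real (\<bar>r - v\<bar> powr (2 * H - 2)))) =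
        complex_of_real (indicator {0..s} v *\<^sub>R (LINT r|lborel. indicator {0..t} r *\<^sub>R \<bar>r - v\<bar> powr (2 * H - 2)))"
      by (auto simp: indicator_def)
  qed
  also have "\<dots> = complex_of_real (LINT v:{0..s}|lborel. LINT r:{0..t}|lborel. \<bar>r - v\<bar> powr (2 * H - 2))"
    unfolding integral_complex_of_real set_lebesgue_integral_def ..
  finally show ?thesis
    unfolding fbm_cov_integral[OF assms, symmetric] by simp
qed

lemma bounded_supp_wave_kernel: "bounded_supp (\<lambda>r. fourier_wave_kernel t x r \<xi>)"
proof (rule bounded_suppI[of _ "1 / norm \<xi>" t])
  show "(\<lambda>r. fourier_wave_kernel t x r \<xi>) \<in> borel_measurable borel"
    unfolding fourier_wave_kernel_def fourier_wave_def by measurable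
  show "norm (fourier_wave_kernel t x r \<xi>) \<le> 1 / norm \<xi> * indicator {0..t} r" for r
    by (auto simp: fourier_wave_kernel_def fourier_wave_def norm_mult norm_divide indicator_def
        intro!: divide_right_mono abs_sin_le_one)
qed

lemma hp_density_kernel_form: "hp_density H \<Phi> \<Psi> \<xi> = kernel_form (2 * H - 2) (\<lambda>r. \<Phi> r \<xi>) (\<lambda>r. \<Psi> r \<xi>)"
  by (simp add: hp_density_def kernel_form_def)

locale colored_noise = tempered_fourier f \<beta> + prob_space M
  for f :: "'a::euclidean_space \<Rightarrow> real" and \<beta> :: real and M :: "'w measure" +
  fixes H :: real and W :: "real \<Rightarrow> 'a set \<Rightarrow> 'w \<Rightarrow> real"
  assumes H: "1 / 2 < H" "H < 1" and noise: "fractional_colored_noise M H f W"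
begin

lemma elem_integral_gaussian:
  assumes "valid_elem es"
  shows "centered_gaussian M (elem_integral W es)"
proof -
  \<comment> \<open>an index may occur several times in the list, so its coefficients are collected first\<close>
  define coef where "coef es i = (\<Sum>(c, t, A)\<leftarrow>es. if (t, A) = i then c else 0)" for es :: "'a elem" and i
  have list: "(\<Sum>i\<in>J. coef es i * X i) = (\<Sum>(c, t, A)\<leftarrow>es. c * X (t, A))"
    if "finite J" "snd ` set es \<subseteq> J" for es J and X :: "real \<times> 'a set \<Rightarrow> real"
    using that(2)
  proof (induction es)
    case (Cons e es)
    obtain c t A where e: "e = (c, t, A)" by (cases e)
    have "(\<Sum>i\<in>J. coef (e # es) i * X i) = (\<Sum>i\<in>J. (if (t, A) = i then c * X i else 0)) + (\<Sum>i\<in>J. coef es i * X i)"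
      by (subst sum.distrib[symmetric]) (auto simp: coef_def e distrib_right intro!: sum.cong)
    also have "(\<Sum>i\<in>J. (if (t, A) = i then c * X i else 0)) = c * X (t, A)"
      using Cons.prems that(1) by (subst sum.delta') (auto simp: e)
    finally show ?case using Cons by (simp add: e)
  qed (simp add: coef_def)
  have "snd ` set es \<subseteq> noise_index"
    using assms by (fastforce simp: valid_elem_def)
  moreover have "centered_gaussian_family M noise_index (\<lambda>(t, A). W t A)"
    using noise by (simp only: fractional_colored_noise_def)
  ultimately have "centered_gaussian M (\<lambda>\<omega>. \<Sum>i\<in>snd ` set es. coef es i * (\<lambda>(t, A). W t A) i \<omega>)"
    unfolding centered_gaussian_family_def by simp
  moreover have "(\<lambda>\<omega>. \<Sum>i\<in>snd ` set es. coef es i * (\<lambda>(t, A). W t A) i \<omega>) = elem_integral W es"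
  proof
    fix \<omega>
    show "(\<Sum>i\<in>snd ` set es. coef es i * (\<lambda>(t, A). W t A) i \<omega>) = elem_integral W es \<omega>"
      using list[of "snd ` set es" es "\<lambda>i. (\<lambda>(t, A). W t A) i \<omega>"] by (simp add: elem_integral_def)
  qed
  ultimately show ?thesis by simp
qed

lemma noise_gaussian: "0 \<le> t \<Longrightarrow> A \<in> sets borel \<Longrightarrow> bounded A \<Longrightarrow> centered_gaussian M (W t A)"
  using elem_integral_gaussian[of "[(1, t, A)]"]
  by (simp add: valid_elem_def noise_index_def elem_integral_def[abs_def])

lemma noise_product_integrable:
  assumes "0 \<le> t" "A \<in> sets borel" "bounded A" "0 \<le> s" "B \<in> sets borel" "bounded B"
  shows "integrable M (\<lambda>\<omega>. W t A \<omega> * W s B \<omega>)"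
proof (rule Bochner_Integration.integrable_bound)
  note g = noise_gaussian[OF assms(1-3)] noise_gaussian[OF assms(4-6)]
  show "integrable M (\<lambda>\<omega>. (W t A \<omega>)\<^sup>2 + (W s B \<omega>)\<^sup>2)"
    using centered_gaussian_moments(1)[OF prob_space_axioms g(1), of 1] centered_gaussian_moments(1)[OF prob_space_axioms g(2), of 1]
    by simp
  have [measurable]: "W t A \<in> borel_measurable M" "W s B \<in> borel_measurable M"
    using g by (auto simp: centered_gaussian_def)
  show "(\<lambda>\<omega>. W t A \<omega> * W s B \<omega>) \<in> borel_measurable M" by measurable
  show "AE \<omega> in M. norm (W t A \<omega> * W s B \<omega>) \<le> norm ((W t A \<omega>)\<^sup>2 + (W s B \<omega>)\<^sup>2)"
  proof (intro AE_I2)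
    fix \<omega>
    have "2 * \<bar>W t A \<omega>\<bar> * \<bar>W s B \<omega>\<bar> \<le> \<bar>W t A \<omega>\<bar>\<^sup>2 + \<bar>W s B \<omega>\<bar>\<^sup>2" by (rule sum_squares_bound)
    moreover have "0 \<le> \<bar>W t A \<omega>\<bar> * \<bar>W s B \<omega>\<bar>" by simp
    ultimately have "\<bar>W t A \<omega>\<bar> * \<bar>W s B \<omega>\<bar> \<le> (W t A \<omega>)\<^sup>2 + (W s B \<omega>)\<^sup>2" unfolding power2_abs by linarith
    then show "norm (W t A \<omega> * W s B \<omega>) \<le> norm ((W t A \<omega>)\<^sup>2 + (W s B \<omega>)\<^sup>2)" by (simp add: abs_mult)
  qed
qed

section \<open>The isometry on elementary integrands\<close>

text \<open>Both sides are the same quadratic form in the coefficients: \<open>kernel_form_indicators\<close> turns the time integrals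
into the covariance of fractional Brownian motion, and \<open>fourier_energy_identity\<close> turns the integrals over the
frequencies into the spatial covariance.\<close>

theorem elementary_isometry:
  assumes es: "valid_elem es"
  shows "integrable \<mu> (\<lambda>\<xi>. hp_density H (elem_fourier es) (elem_fourier es) \<xi>)"
    and "H * (2 * H - 1) * (LINT \<xi>|\<mu>. Re (hp_density H (elem_fourier es) (elem_fourier es) \<xi>)) =
      (LINT \<omega>|M. (elem_integral W es \<omega>)\<^sup>2)"
proof -
  define n where "n = length es"
  define c t A where "c i = fst (es ! i)" and "t i = fst (snd (es ! i))" and "A i = snd (snd (es ! i))" for i
  have ok: "0 \<le> t i" "A i \<in> sets borel" "bounded (A i)" if "i < n" for i
    using valid_elem_nth[OF es, of i] that by (auto simp: t_def A_def n_def)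
  define \<alpha> where "\<alpha> = H * (2 * H - 1)"
  have \<alpha>: "0 < \<alpha>" using H by (auto simp: \<alpha>_def)
  have p: "-1 < 2 * H - 2" using H by simp
  let ?F = "\<lambda>i. fourier_indicator (A i)"
  define I where "I i j = (LINT x:A i|lborel. LINT y:A j|lborel. f (x - y))" for i j
  have dens: "of_real \<alpha> * hp_density H (elem_fourier es) (elem_fourier es) \<xi> =
      (\<Sum>i<n. \<Sum>j<n. of_real (c i * c j * fbm_cov H (t i) (t j)) * (?F i \<xi> * cnj (?F j \<xi>)))" for \<xi>
  proof -
    define a where "a i = complex_of_real (c i) * ?F i \<xi>" for i
    define g where "g i = (\<lambda>r. a i * indicator {0..t i} r)" for i
    define k where "k i j = kernel_form (2 * H - 2) (indicator {0..t i}) (indicator {0..t j})" for i j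
    have bg: "bounded_supp (g i)" for i
      unfolding g_def by (intro bounded_supp_scale bounded_supp_indicator)
    have kg: "kernel_form (2 * H - 2) (g i) (g j) = a i * (cnj (a j) * k i j)" for i j
    proof -
      have "kernel_form (2 * H - 2) (g i) (g j) = a i * kernel_form (2 * H - 2) (indicator {0..t i}) (g j)"
        unfolding g_def[of i] by (rule kernel_form_scale_left[OF p bounded_supp_indicator bg])
      also have "kernel_form (2 * H - 2) (indicator {0..t i}) (g j) = cnj (a j) * k i j"
        unfolding g_def k_def by (rule kernel_form_scale_right[OF p bounded_supp_indicator bounded_supp_indicator])
      finally show ?thesis .
    qed
    have ka: "of_real \<alpha> * k i j = complex_of_real (fbm_cov H (t i) (t j))" if "i < n" "j < n" for i j
      unfolding k_def \<alpha>_def by (rule kernel_form_indicators[OF H(1) ok(1)[OF that(1)] ok(1)[OF that(2)]])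
    have "(\<lambda>r. elem_fourier es r \<xi>) = (\<lambda>r. \<Sum>i<n. g i r)"
      unfolding elem_fourier_eq[OF es] g_def a_def c_def t_def A_def n_def ..
    then have "hp_density H (elem_fourier es) (elem_fourier es) \<xi> =
        kernel_form (2 * H - 2) (\<lambda>r. \<Sum>i<n. g i r) (\<lambda>r. \<Sum>j<n. g j r)"
      unfolding hp_density_kernel_form by (simp only:)
    also have "\<dots> = (\<Sum>i<n. kernel_form (2 * H - 2) (g i) (\<lambda>r. \<Sum>j<n. g j r))"
      by (intro kernel_form_sum_left p bounded_supp_sum bg finite_lessThan)
    also have "\<dots> = (\<Sum>i<n. \<Sum>j<n. kernel_form (2 * H - 2) (g i) (g j))"
      by (intro sum.cong refl kernel_form_sum_right p bg finite_lessThan)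
    finally have "of_real \<alpha> * hp_density H (elem_fourier es) (elem_fourier es) \<xi> =
      (\<Sum>i<n. \<Sum>j<n. of_real \<alpha> * (a i * (cnj (a j) * k i j)))"
      by (simp only: sum_distrib_left kg)
    also have "\<dots> = (\<Sum>i<n. \<Sum>j<n. of_real (c i * c j * fbm_cov H (t i) (t j)) * (?F i \<xi> * cnj (?F j \<xi>)))"
    proof (intro sum.cong refl)
      fix i j assume "i \<in> {..<n}" "j \<in> {..<n}"
      then have "of_real \<alpha> * k i j = complex_of_real (fbm_cov H (t i) (t j))" by (intro ka) auto
      moreover have "of_real \<alpha> * (a i * (cnj (a j) * k i j)) = a i * cnj (a j) * (of_real \<alpha> * k i j)"
        by (simp only: mult_ac)
      ultimately show "of_real \<alpha> * (a i * (cnj (a j) * k i j)) =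
          of_real (c i * c j * fbm_cov H (t i) (t j)) * (?F i \<xi> * cnj (?F j \<xi>))"
        by (simp add: a_def)
    qed
    finally show ?thesis .
  qed
  have int: "integrable \<mu> (\<lambda>\<xi>. of_real \<alpha> * hp_density H (elem_fourier es) (elem_fourier es) \<xi>)"
    unfolding dens
    by (intro Bochner_Integration.integrable_sum integrable_mult_right fourier_energy_identity(1)) (simp_all add: ok)
  from integrable_mult_right[OF this, of "of_real (1 / \<alpha>)"]
  show int': "integrable \<mu> (\<lambda>\<xi>. hp_density H (elem_fourier es) (elem_fourier es) \<xi>)"
    using \<alpha> by (simp add: mult.assoc[symmetric] of_real_mult[symmetric] del: of_real_mult)
  have "complex_of_real \<alpha> * (LINT \<xi>|\<mu>. hp_density H (elem_fourier es) (elem_fourier es) \<xi>) =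
      (LINT \<xi>|\<mu>. of_real \<alpha> * hp_density H (elem_fourier es) (elem_fourier es) \<xi>)"
    by simp
  also have "\<dots> = (\<Sum>i<n. \<Sum>j<n. of_real (c i * c j * fbm_cov H (t i) (t j)) * (LINT \<xi>|\<mu>. ?F i \<xi> * cnj (?F j \<xi>)))"
  proof -
    let ?G = "\<lambda>i j \<xi>. complex_of_real (c i * c j * fbm_cov H (t i) (t j)) * (?F i \<xi> * cnj (?F j \<xi>))"
    have i1: "integrable \<mu> (?G i j)" if "i < n" "j < n" for i j
      using ok[OF that(1)] ok[OF that(2)] by (intro integrable_mult_right fourier_energy_identity(1))
    have "(LINT \<xi>|\<mu>. (\<Sum>i<n. \<Sum>j<n. ?G i j \<xi>)) = (\<Sum>i<n. (LINT \<xi>|\<mu>. (\<Sum>j<n. ?G i j \<xi>)))"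
      using i1 by (intro Bochner_Integration.integral_sum Bochner_Integration.integrable_sum) auto
    also have "\<dots> = (\<Sum>i<n. \<Sum>j<n. (LINT \<xi>|\<mu>. ?G i j \<xi>))"
      using i1 by (intro sum.cong refl Bochner_Integration.integral_sum) auto
    finally show ?thesis unfolding dens by (simp only: integral_mult_right_zero)
  qed
  also have "\<dots> = (\<Sum>i<n. \<Sum>j<n. of_real (c i * c j * fbm_cov H (t i) (t j)) * of_real (I i j))"
    using ok by (intro sum.cong refl) (simp add: fourier_energy_identity(2) I_def)
  also have "\<dots> = complex_of_real (\<Sum>i<n. \<Sum>j<n. c i * c j * fbm_cov H (t i) (t j) * I i j)" by simp
  finally have "Re (complex_of_real \<alpha> * (LINT \<xi>|\<mu>. hp_density H (elem_fourier es) (elem_fourier es) \<xi>)) =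
      Re (complex_of_real (\<Sum>i<n. \<Sum>j<n. c i * c j * fbm_cov H (t i) (t j) * I i j))"
    by (rule arg_cong)
  then have left: "\<alpha> * Re (LINT \<xi>|\<mu>. hp_density H (elem_fourier es) (elem_fourier es) \<xi>) =
      (\<Sum>i<n. \<Sum>j<n. c i * c j * fbm_cov H (t i) (t j) * I i j)"
    by (simp only: Re_complex_of_real) simp
  have cov: "(LINT \<omega>|M. W (t i) (A i) \<omega> * W (t j) (A j) \<omega>) = fbm_cov H (t i) (t j) * I i j" if "i < n" "j < n" for i j
    using noise ok[OF that(1)] ok[OF that(2)]
    by (auto simp: fractional_colored_noise_def noise_index_def I_def)
  have "(elem_integral W es \<omega>)\<^sup>2 = (\<Sum>i<n. \<Sum>j<n. c i * c j * (W (t i) (A i) \<omega> * W (t j) (A j) \<omega>))" for \<omega>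
  proof -
    have "elem_integral W es \<omega> = (\<Sum>i<n. c i * W (t i) (A i) \<omega>)"
      unfolding elem_integral_def sum_list_triples c_def t_def A_def n_def ..
    then show ?thesis by (simp add: power2_eq_square sum_product mult_ac)
  qed
  then have "(LINT \<omega>|M. (elem_integral W es \<omega>)\<^sup>2) = (LINT \<omega>|M. (\<Sum>i<n. \<Sum>j<n. c i * c j * (W (t i) (A i) \<omega> * W (t j) (A j) \<omega>)))"
    by simp
  also have "\<dots> = (\<Sum>i<n. \<Sum>j<n. c i * c j * (LINT \<omega>|M. W (t i) (A i) \<omega> * W (t j) (A j) \<omega>))"
  proof -
    have i1: "integrable M (\<lambda>\<omega>. c i * c j * (W (t i) (A i) \<omega> * W (t j) (A j) \<omega>))" if "i < n" "j < n" for i j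
      using ok[OF that(1)] ok[OF that(2)] by (intro integrable_mult_right noise_product_integrable)
    have "(LINT \<omega>|M. (\<Sum>i<n. \<Sum>j<n. c i * c j * (W (t i) (A i) \<omega> * W (t j) (A j) \<omega>))) =
        (\<Sum>i<n. (LINT \<omega>|M. (\<Sum>j<n. c i * c j * (W (t i) (A i) \<omega> * W (t j) (A j) \<omega>))))"
      using i1 by (intro Bochner_Integration.integral_sum Bochner_Integration.integrable_sum) auto
    also have "\<dots> = (\<Sum>i<n. \<Sum>j<n. (LINT \<omega>|M. c i * c j * (W (t i) (A i) \<omega> * W (t j) (A j) \<omega>)))"
      using i1 by (intro sum.cong refl Bochner_Integration.integral_sum) auto
    finally show ?thesis by (simp only: integral_mult_right_zero)
  qed
  also have "\<dots> = (\<Sum>i<n. \<Sum>j<n. c i * c j * fbm_cov H (t i) (t j) * I i j)"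
    by (intro sum.cong refl) (simp add: cov)
  finally show "H * (2 * H - 1) * (LINT \<xi>|\<mu>. Re (hp_density H (elem_fourier es) (elem_fourier es) \<xi>)) =
      (LINT \<omega>|M. (elem_integral W es \<omega>)\<^sup>2)"
    using left int' by (simp add: \<alpha>_def)
qed

section \<open>Increments of the solution\<close>

definition alpha_H :: real where "alpha_H = H * (2 * H - 1)"

lemma alpha_H_pos: "0 < alpha_H" using H by (simp add: alpha_H_def)

abbreviation approx_error :: "real \<Rightarrow> 'a \<Rightarrow> 'a elem \<Rightarrow> real \<Rightarrow> 'a \<Rightarrow> complex" where
  "approx_error t x es \<equiv> \<lambda>r \<xi>. elem_fourier es r \<xi> - fourier_wave_kernel t x r \<xi>"

text \<open>The isometry gives the variance as the value of the form at the difference of the two elementary integrands. This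
difference splits into the increment of the wave kernels and the two approximation errors, and
\<open>kernel_form_diff_le\<close> applied twice separates the three at the cost of the factors 2, 4 and 4.\<close>

lemma elementary_increment_moment:
  fixes x :: 'a
  assumes es: "valid_elem es" and es': "valid_elem es'"
    and st: "0 \<le> s" "s < t" "t \<le> T"
    and int: "integrable \<mu> (hp_density H (approx_error t x es) (approx_error t x es))"
    and int': "integrable \<mu> (hp_density H (approx_error s x es') (approx_error s x es'))"
    and K: "0 \<le> K" "(\<integral>\<^sup>+\<xi>. ennreal (norm \<xi> powr (1 - 2 * H) * (min (t - s) (1 / norm \<xi>))\<^sup>2) \<partial>\<mu>) \<le>
        ennreal (K * (t - s) powr (2 * H + 1 - \<beta>))"
  shows "(LINT \<omega>|M. (elem_integral W es \<omega> - elem_integral W es' \<omega>)\<^sup>2) \<le>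
    2 * Re (hp_inner H \<beta> (approx_error t x es) (approx_error t x es)) +
    4 * Re (hp_inner H \<beta> (approx_error s x es') (approx_error s x es')) +
    4 * alpha_H * (6 * (2 / (2 * H - 1) + 8) * T) * K * (t - s) powr (2 * H + 1 - \<beta>)"
proof -
  define p where "p = 2 * H - 2"
  have p: "-1 < p" "p < 0" using H by (auto simp: p_def)
  define C where "C = 6 * (2 / (2 * H - 1) + 8) * T"
  have C: "0 \<le> C" using H st by (auto simp: C_def)
  define D where "D \<xi> = kernel_form p (\<lambda>r. elem_fourier es r \<xi> - fourier_wave_kernel t x r \<xi>)
      (\<lambda>r. elem_fourier es r \<xi> - fourier_wave_kernel t x r \<xi>)" for \<xi>
  define D' where "D' \<xi> = kernel_form p (\<lambda>r. elem_fourier es' r \<xi> - fourier_wave_kernel s x r \<xi>)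
      (\<lambda>r. elem_fourier es' r \<xi> - fourier_wave_kernel s x r \<xi>)" for \<xi>
  define E where "E \<xi> = norm \<xi> powr (1 - 2 * H) * (min (t - s) (1 / norm \<xi>))\<^sup>2" for \<xi> :: 'a
  have D: "hp_density H (approx_error t x es) (approx_error t x es) = D"
    by (auto simp: fun_eq_iff hp_density_kernel_form D_def p_def)
  have D': "hp_density H (approx_error s x es') (approx_error s x es') = D'"
    by (auto simp: fun_eq_iff hp_density_kernel_form D'_def p_def)
  have int_D: "integrable \<mu> D" "integrable \<mu> D'" using int int' unfolding D D' by auto
  have E0: "0 \<le> E \<xi>" for \<xi> by (simp add: E_def)
  have E_int: "integrable \<mu> E" and E_le: "(LINT \<xi>|\<mu>. E \<xi>) \<le> K * (t - s) powr (2 * H + 1 - \<beta>)"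
  proof -
    have [measurable]: "E \<in> borel_measurable borel" unfolding E_def by measurable
    have nn: "(\<integral>\<^sup>+\<xi>. ennreal (E \<xi>) \<partial>\<mu>) \<le> ennreal (K * (t - s) powr (2 * H + 1 - \<beta>))"
      using K(2) by (simp only: E_def)
    show i: "integrable \<mu> E"
    proof (rule integrableI_nonneg)
      show "(\<integral>\<^sup>+\<xi>. ennreal (E \<xi>) \<partial>\<mu>) < \<infinity>" using nn by (rule le_less_trans) simp
    qed (use E0 in auto)
    have "ennreal (LINT \<xi>|\<mu>. E \<xi>) \<le> ennreal (K * (t - s) powr (2 * H + 1 - \<beta>))"
      using nn_integral_eq_integral[OF i] E0 nn by simp
    then show "(LINT \<xi>|\<mu>. E \<xi>) \<le> K * (t - s) powr (2 * H + 1 - \<beta>)"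
      using K(1) by (simp add: ennreal_le_iff)
  qed
  have pt: "Re (hp_density H (elem_fourier (elem_diff es es')) (elem_fourier (elem_diff es es')) \<xi>) \<le>
      2 * Re (D \<xi>) + 4 * Re (D' \<xi>) + 4 * C * E \<xi>" for \<xi>
  proof -
    let ?e = "\<lambda>r. elem_fourier es r \<xi>" and ?e' = "\<lambda>r. elem_fourier es' r \<xi>"
    let ?t = "\<lambda>r. fourier_wave_kernel t x r \<xi>" and ?s = "\<lambda>r. fourier_wave_kernel s x r \<xi>"
    note b = bounded_supp_elem_fourier[OF es, of \<xi>] bounded_supp_elem_fourier[OF es', of \<xi>]
      bounded_supp_wave_kernel[of t x \<xi>] bounded_supp_wave_kernel[of s x \<xi>]
    have "hp_density H (elem_fourier (elem_diff es es')) (elem_fourier (elem_diff es es')) \<xi> =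
        kernel_form p (\<lambda>r. (?e r - ?t r) - (?e' r - ?t r)) (\<lambda>r. (?e r - ?t r) - (?e' r - ?t r))"
      by (simp add: hp_density_kernel_form elem_fourier_diff[OF es es'] p_def)
    moreover have "Re (kernel_form p (\<lambda>r. (?e r - ?t r) - (?e' r - ?t r)) (\<lambda>r. (?e r - ?t r) - (?e' r - ?t r))) \<le>
        2 * Re (D \<xi>) + 2 * Re (kernel_form p (\<lambda>r. ?e' r - ?t r) (\<lambda>r. ?e' r - ?t r))"
      unfolding D_def by (intro kernel_form_diff_le p bounded_supp_diff b)
    moreover have "(\<lambda>r. ?e' r - ?t r) = (\<lambda>r. (?e' r - ?s r) - (?t r - ?s r))" by auto
    moreover have "Re (kernel_form p (\<lambda>r. (?e' r - ?s r) - (?t r - ?s r)) (\<lambda>r. (?e' r - ?s r) - (?t r - ?s r))) \<le>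
        2 * Re (D' \<xi>) + 2 * Re (kernel_form p (\<lambda>r. ?t r - ?s r) (\<lambda>r. ?t r - ?s r))"
      unfolding D'_def by (intro kernel_form_diff_le p bounded_supp_diff b)
    moreover have "Re (kernel_form p (\<lambda>r. ?t r - ?s r) (\<lambda>r. ?t r - ?s r)) \<le> C * E \<xi>"
    proof (cases "\<xi> = 0")
      case True
      then have "fourier_wave_kernel t x r \<xi> = 0" for t r
        by (simp add: fourier_wave_kernel_def fourier_wave_def)
      then show ?thesis using C E0[of \<xi>] by (simp add: kernel_form_zero_left)
    next
      case False
      have "Re (kernel_form p (\<lambda>r. ?t r - ?s r) (\<lambda>r. ?t r - ?s r)) \<le>
          norm (kernel_form p (\<lambda>r. ?t r - ?s r) (\<lambda>r. ?t r - ?s r))" by (rule complex_Re_le_cmod)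
      also have "\<dots> \<le> 6 * (2 / (2 * H - 1) + 8) * t * norm \<xi> powr (1 - 2 * H) * (min (t - s) (1 / norm \<xi>))\<^sup>2"
        unfolding p_def using st False by (intro wave_increment_bound H) auto
      also have "\<dots> = (6 * (2 / (2 * H - 1) + 8) * t) * E \<xi>" by (simp only: E_def mult.assoc)
      also have "\<dots> \<le> C * E \<xi>"
        unfolding C_def using H st E0 by (intro mult_right_mono mult_left_mono) auto
      finally show ?thesis .
    qed
    ultimately show ?thesis by (simp only:)
  qed
  have inner: "Re (hp_inner H \<beta> \<Phi> \<Phi>) = alpha_H * (LINT \<xi>|\<mu>. Re (hp_density H \<Phi> \<Phi> \<xi>))"
    if "integrable \<mu> (hp_density H \<Phi> \<Phi>)" for \<Phi>
    using that unfolding hp_inner_def alpha_H_def by simp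
  have "(LINT \<omega>|M. (elem_integral W es \<omega> - elem_integral W es' \<omega>)\<^sup>2) =
      alpha_H * (LINT \<xi>|\<mu>. Re (hp_density H (elem_fourier (elem_diff es es')) (elem_fourier (elem_diff es es')) \<xi>))"
    using elementary_isometry(2)[OF valid_elem_diff[OF es es']] unfolding alpha_H_def elem_integral_diff by simp
  also have "\<dots> \<le> alpha_H * (LINT \<xi>|\<mu>. 2 * Re (D \<xi>) + 4 * Re (D' \<xi>) + 4 * C * E \<xi>)"
    using alpha_H_pos int_D E_int elementary_isometry(1)[OF valid_elem_diff[OF es es']]
    by (intro mult_left_mono integral_mono pt) auto
  also have "(LINT \<xi>|\<mu>. 2 * Re (D \<xi>) + 4 * Re (D' \<xi>) + 4 * C * E \<xi>) =
      2 * (LINT \<xi>|\<mu>. Re (D \<xi>)) + 4 * (LINT \<xi>|\<mu>. Re (D' \<xi>)) + 4 * C * (LINT \<xi>|\<mu>. E \<xi>)"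
    using int_D E_int by simp
  also have "alpha_H * \<dots> = 2 * (alpha_H * (LINT \<xi>|\<mu>. Re (D \<xi>))) + 4 * (alpha_H * (LINT \<xi>|\<mu>. Re (D' \<xi>))) + 4 * alpha_H * C * (LINT \<xi>|\<mu>. E \<xi>)"
    by (simp add: algebra_simps)
  also have "\<dots> \<le> 2 * (alpha_H * (LINT \<xi>|\<mu>. Re (D \<xi>))) + 4 * (alpha_H * (LINT \<xi>|\<mu>. Re (D' \<xi>))) +
      4 * alpha_H * C * (K * (t - s) powr (2 * H + 1 - \<beta>))"
    using alpha_H_pos C by (intro add_left_mono mult_left_mono E_le) auto
  finally show ?thesis
    unfolding inner[OF int] inner[OF int'] D D' C_def[symmetric] by (simp only: mult.assoc)
qed

lemma second_moment_tail:
  assumes [measurable]: "X \<in> borel_measurable M" and e: "0 < e"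
  shows "emeasure M {\<omega> \<in> space M. e \<le> \<bar>X \<omega>\<bar>} \<le> ennreal (1 / e\<^sup>2) * (\<integral>\<^sup>+\<omega>. ennreal ((X \<omega>)\<^sup>2) \<partial>M)"
proof -
  have "emeasure M {\<omega> \<in> space M. e \<le> \<bar>X \<omega>\<bar>} \<le> emeasure M {\<omega> \<in> space M. 1 \<le> ennreal (1 / e\<^sup>2) * ennreal ((X \<omega>)\<^sup>2)}"
  proof (rule emeasure_mono)
    show "{\<omega> \<in> space M. e \<le> \<bar>X \<omega>\<bar>} \<subseteq> {\<omega> \<in> space M. 1 \<le> ennreal (1 / e\<^sup>2) * ennreal ((X \<omega>)\<^sup>2)}"
    proof safe
      fix \<omega> assume "e \<le> \<bar>X \<omega>\<bar>"
      then have "e\<^sup>2 \<le> \<bar>X \<omega>\<bar>\<^sup>2" using e by (intro power_mono) auto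
      then have "1 \<le> 1 / e\<^sup>2 * (X \<omega>)\<^sup>2" using e by (simp add: field_simps)
      then show "1 \<le> ennreal (1 / e\<^sup>2) * ennreal ((X \<omega>)\<^sup>2)"
        by (subst ennreal_mult[symmetric]) auto
    qed
  qed measurable
  also have "\<dots> \<le> ennreal (1 / e\<^sup>2) * (\<integral>\<^sup>+\<omega>. ennreal ((X \<omega>)\<^sup>2) * indicator (space M) \<omega> \<partial>M)"
    by (rule nn_integral_Markov_inequality) measurable
  also have "(\<integral>\<^sup>+\<omega>. ennreal ((X \<omega>)\<^sup>2) * indicator (space M) \<omega> \<partial>M) = (\<integral>\<^sup>+\<omega>. ennreal ((X \<omega>)\<^sup>2) \<partial>M)"
    by (intro nn_integral_cong) auto
  finally show ?thesis .
qed

text \<open>The elementary approximants of the increment are Gaussian with variance at most \<open>q n\<close>, which tends to the desired bound \<open>Q\<close>.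
Their tail bounds pass to the limit because the approximants converge in mean square and hence in
probability: the threshold \<open>e\<close> is divided into \<open>e / 2\<close> for the approximant and \<open>e / 4\<close> for each of the two errors.\<close>

lemma wave_increment_tail:
  fixes u :: "real \<Rightarrow> 'w \<Rightarrow> real" and x :: 'a
  assumes u: "is_wiener_integral M H \<beta> W (fourier_wave_kernel t x) (u t)"
    "is_wiener_integral M H \<beta> W (fourier_wave_kernel s x) (u s)"
    and st: "0 \<le> s" "s < t" "t \<le> T"
    and K: "0 \<le> K" "(\<integral>\<^sup>+\<xi>. ennreal (norm \<xi> powr (1 - 2 * H) * (min (t - s) (1 / norm \<xi>))\<^sup>2) \<partial>\<mu>) \<le>
        ennreal (K * (t - s) powr (2 * H + 1 - \<beta>))"
    and e: "0 < e"
  shows "emeasure M {\<omega> \<in> space M. e \<le> \<bar>u t \<omega> - u s \<omega>\<bar>} \<le>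
    ennreal (fact (2 * k) / (2 ^ k * fact k) *
      (4 * alpha_H * (6 * (2 / (2 * H - 1) + 8) * T) * K * (t - s) powr (2 * H + 1 - \<beta>)) ^ k / (e / 2) ^ (2 * k))"
proof -
  have [measurable]: "u t \<in> borel_measurable M" "u s \<in> borel_measurable M"
    using u by (auto simp: is_wiener_integral_def)
  have ex: "\<exists>es. (\<forall>n. valid_elem (es n)) \<and> (\<forall>n. integrable \<mu> (hp_density H (approx_error t x (es n)) (approx_error t x (es n)))) \<and>
      (\<lambda>n. hp_inner H \<beta> (approx_error t x (es n)) (approx_error t x (es n))) \<longlonglongrightarrow> 0 \<and>
      (\<lambda>n. \<integral>\<^sup>+\<omega>. ennreal ((elem_integral W (es n) \<omega> - u t \<omega>)\<^sup>2) \<partial>M) \<longlonglongrightarrow> 0"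
    if "is_wiener_integral M H \<beta> W (fourier_wave_kernel t x) (u t)" for t
    using that unfolding is_wiener_integral_def hp_tendsto_def elem_fourier_def[symmetric]
    by blast
  obtain es where es: "\<And>n. valid_elem (es n)" "\<And>n. integrable \<mu> (hp_density H (approx_error t x (es n)) (approx_error t x (es n)))"
      "(\<lambda>n. hp_inner H \<beta> (approx_error t x (es n)) (approx_error t x (es n))) \<longlonglongrightarrow> 0"
      "(\<lambda>n. \<integral>\<^sup>+\<omega>. ennreal ((elem_integral W (es n) \<omega> - u t \<omega>)\<^sup>2) \<partial>M) \<longlonglongrightarrow> 0"
    using ex[OF u(1)] by blast
  obtain es' where es': "\<And>n. valid_elem (es' n)" "\<And>n. integrable \<mu> (hp_density H (approx_error s x (es' n)) (approx_error s x (es' n)))"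
      "(\<lambda>n. hp_inner H \<beta> (approx_error s x (es' n)) (approx_error s x (es' n))) \<longlonglongrightarrow> 0"
      "(\<lambda>n. \<integral>\<^sup>+\<omega>. ennreal ((elem_integral W (es' n) \<omega> - u s \<omega>)\<^sup>2) \<partial>M) \<longlonglongrightarrow> 0"
    using ex[OF u(2)] by blast
  define Q where "Q = 4 * alpha_H * (6 * (2 / (2 * H - 1) + 8) * T) * K * (t - s) powr (2 * H + 1 - \<beta>)"
  define q where "q n = 2 * Re (hp_inner H \<beta> (approx_error t x (es n)) (approx_error t x (es n))) +
      4 * Re (hp_inner H \<beta> (approx_error s x (es' n)) (approx_error s x (es' n))) + Q" for n
  have q_lim: "q \<longlonglongrightarrow> Q"
  proof -
    have "q \<longlonglongrightarrow> 2 * Re 0 + 4 * Re 0 + Q"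
      unfolding q_def by (intro tendsto_intros es(3) es'(3))
    then show ?thesis by simp
  qed
  define X where "X n = elem_integral W (elem_diff (es n) (es' n))" for n
  have X_eq: "X n \<omega> = elem_integral W (es n) \<omega> - elem_integral W (es' n) \<omega>" for n \<omega>
    by (simp add: X_def elem_integral_diff)
  have X_gauss: "centered_gaussian M (X n)" for n
    unfolding X_def by (intro elem_integral_gaussian valid_elem_diff es es')
  have [measurable]: "X n \<in> borel_measurable M" "elem_integral W (es n) \<in> borel_measurable M"
      "elem_integral W (es' n) \<in> borel_measurable M" for n
    using X_gauss[of n] elem_integral_gaussian[OF es(1), of n] elem_integral_gaussian[OF es'(1), of n]
    by (auto simp: centered_gaussian_def)
  have q_bound: "(LINT \<omega>|M. (X n \<omega>)\<^sup>2) \<le> q n" for n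
    using elementary_increment_moment[OF es(1) es'(1) st _ _ K] es(2)[of n] es'(2)[of n]
    unfolding X_eq q_def Q_def by blast
  let ?c = "fact (2 * k) / (2 ^ k * fact k) :: real"
  define a where "a n = (\<integral>\<^sup>+\<omega>. ennreal ((elem_integral W (es n) \<omega> - u t \<omega>)\<^sup>2) \<partial>M)" for n
  define b where "b n = (\<integral>\<^sup>+\<omega>. ennreal ((elem_integral W (es' n) \<omega> - u s \<omega>)\<^sup>2) \<partial>M)" for n
  have bound: "emeasure M {\<omega> \<in> space M. e \<le> \<bar>u t \<omega> - u s \<omega>\<bar>} \<le>
      ennreal (?c * q n ^ k / (e / 2) ^ (2 * k)) + (ennreal (1 / (e / 4)\<^sup>2) * a n + ennreal (1 / (e / 4)\<^sup>2) * b n)" for n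
  proof -
    let ?S1 = "{\<omega> \<in> space M. e / 2 \<le> \<bar>X n \<omega>\<bar>}"
    let ?S2 = "{\<omega> \<in> space M. e / 4 \<le> \<bar>elem_integral W (es n) \<omega> - u t \<omega>\<bar>}"
    let ?S3 = "{\<omega> \<in> space M. e / 4 \<le> \<bar>elem_integral W (es' n) \<omega> - u s \<omega>\<bar>}"
    have "{\<omega> \<in> space M. e \<le> \<bar>u t \<omega> - u s \<omega>\<bar>} \<subseteq> ?S1 \<union> (?S2 \<union> ?S3)"
    proof
      fix \<omega> assume \<omega>: "\<omega> \<in> {\<omega> \<in> space M. e \<le> \<bar>u t \<omega> - u s \<omega>\<bar>}"
      then have "e / 2 \<le> \<bar>X n \<omega>\<bar> \<or> e / 4 \<le> \<bar>elem_integral W (es n) \<omega> - u t \<omega>\<bar> \<or>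
          e / 4 \<le> \<bar>elem_integral W (es' n) \<omega> - u s \<omega>\<bar>"
        unfolding X_eq by (simp only: mem_Collect_eq) linarith
      then show "\<omega> \<in> ?S1 \<union> (?S2 \<union> ?S3)" using \<omega> by blast
    qed
    then have "emeasure M {\<omega> \<in> space M. e \<le> \<bar>u t \<omega> - u s \<omega>\<bar>} \<le> emeasure M (?S1 \<union> (?S2 \<union> ?S3))"
      by (rule emeasure_mono) measurable
    also have "\<dots> \<le> emeasure M ?S1 + emeasure M (?S2 \<union> ?S3)"
      by (rule emeasure_subadditive) measurable
    also have "\<dots> \<le> emeasure M ?S1 + (emeasure M ?S2 + emeasure M ?S3)"
      by (intro add_left_mono emeasure_subadditive) measurable
    also have "\<dots> \<le> ennreal (?c * q n ^ k / (e / 2) ^ (2 * k)) + (ennreal (1 / (e / 4)\<^sup>2) * a n + ennreal (1 / (e / 4)\<^sup>2) * b n)"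
      unfolding a_def b_def using e
      by (intro add_mono centered_gaussian_tail[OF prob_space_axioms X_gauss _ q_bound] second_moment_tail) auto
    finally show ?thesis .
  qed
  have "(\<lambda>n. ennreal (?c * q n ^ k / (e / 2) ^ (2 * k)) + (ennreal (1 / (e / 4)\<^sup>2) * a n + ennreal (1 / (e / 4)\<^sup>2) * b n)) \<longlonglongrightarrow>
      ennreal (?c * Q ^ k / (e / 2) ^ (2 * k)) + (ennreal (1 / (e / 4)\<^sup>2) * 0 + ennreal (1 / (e / 4)\<^sup>2) * 0)"
    using e unfolding a_def b_def
    by (intro tendsto_add tendsto_ennrealI tendsto_divide tendsto_mult tendsto_power tendsto_const q_lim
        ennreal_tendsto_cmult es(4) es'(4)) auto
  then have "(\<lambda>n. ennreal (?c * q n ^ k / (e / 2) ^ (2 * k)) + (ennreal (1 / (e / 4)\<^sup>2) * a n + ennreal (1 / (e / 4)\<^sup>2) * b n)) \<longlonglongrightarrow>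
      ennreal (?c * Q ^ k / (e / 2) ^ (2 * k))" by simp
  then show ?thesis
    unfolding Q_def[symmetric] by (rule LIMSEQ_le_const) (use bound in blast)
qed

end

theorem corollary1:
  fixes M :: "'w measure"
    and H T \<beta> :: real
    and f :: "'a::euclidean_space \<Rightarrow> real"
    and W :: "real \<Rightarrow> 'a set \<Rightarrow> 'w \<Rightarrow> real"
    and u :: "real \<Rightarrow> 'a \<Rightarrow> 'w \<Rightarrow> real"
  assumes "prob_space M"
    and "1 / 2 < H" and "H < 1"
    and "0 < T"
    and "2 * H - 1 < \<beta>" and "\<beta> < min (real DIM('a)) (2 * H + 1)"
    and "is_tempered_fourier_of f (riesz_measure \<beta>)"
    and "fractional_colored_noise M H f W"
    and "is_mild_wave_solution M H \<beta> T W u"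
  shows "\<forall>x. \<forall>\<delta>\<in>{0 <..< (2 * H + 1 - \<beta>) / 2}.
           \<exists>v. is_modification M {0..T} v (\<lambda>t. u t x) \<and>
               (AE \<omega> in M. hoelder_on \<delta> {0..T} (\<lambda>t. v t \<omega>))"
proof (intro allI ballI)
  fix x :: 'a and \<delta> :: real assume \<delta>: "\<delta> \<in> {0 <..< (2 * H + 1 - \<beta>) / 2}"
  interpret prob_space M by fact
  interpret colored_noise f \<beta> M H W
    using assms by unfold_locales auto
  obtain K where K: "0 \<le> K" "\<And>h. 0 < h \<Longrightarrow> (\<integral>\<^sup>+\<xi>. ennreal (norm \<xi> powr (1 - 2 * H) * (min h (1 / norm \<xi>))\<^sup>2)
      \<partial>(riesz_measure \<beta> :: 'a measure)) \<le> ennreal (K * h powr (2 * H + 1 - \<beta>))"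
    using riesz_measure_increment_bound[of H \<beta>, where 'a = 'a] assms by auto
  define a where "a = 2 * H + 1 - \<beta>"
  have a: "0 < a - 2 * \<delta>" using \<delta> by (simp add: a_def)
  \<comment> \<open>the moment order for which the exponent gained exceeds the \<open>1 + 2 * k * \<delta>\<close> consumed by chaining\<close>
  obtain k :: nat where "1 / (a - 2 * \<delta>) < real k" using reals_Archimedean2 by blast
  then have k: "1 < real k * (a - 2 * \<delta>)" "0 < k"
    using a by (auto simp: field_simps intro!: Nat.gr0I)
  define Q where "Q = 4 * alpha_H * (6 * (2 / (2 * H - 1) + 8) * T) * K"
  have Q: "0 \<le> Q" using alpha_H_pos K(1) assms by (simp add: Q_def)
  define C where "C = fact (2 * k) / (2 ^ k * fact k) * Q ^ k * 2 ^ (2 * k)"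
  have C: "0 \<le> C" using Q by (simp add: C_def)
  have wi: "is_wiener_integral M H \<beta> W (fourier_wave_kernel t x) (u t x)" if "t \<in> {0..T}" for t
    using assms(9) that by (auto simp: is_mild_wave_solution_def)
  have ordered: "measure M {\<omega> \<in> space M. e \<le> \<bar>u t x \<omega> - u s x \<omega>\<bar>} \<le> C * \<bar>t - s\<bar> powr (real k * a) / e powr real (2 * k)"
    if st: "s \<in> {0..T}" "t \<in> {0..T}" "s < t" and e: "0 < e" for s t e
  proof -
    have "emeasure M {\<omega> \<in> space M. e \<le> \<bar>u t x \<omega> - u s x \<omega>\<bar>} \<le>
        ennreal (fact (2 * k) / (2 ^ k * fact k) * (Q * (t - s) powr a) ^ k / (e / 2) ^ (2 * k))"
      unfolding Q_def a_def
      using st K(1) K(2)[of "t - s"] e wave_increment_tail[where u = "\<lambda>t. u t x", OF wi[OF st(2)] wi[OF st(1)]] by auto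
    also have "fact (2 * k) / (2 ^ k * fact k) * (Q * (t - s) powr a) ^ k / (e / 2) ^ (2 * k) =
        C * \<bar>t - s\<bar> powr (real k * a) / e powr real (2 * k)"
    proof -
      have "((t - s) powr a) ^ k = \<bar>t - s\<bar> powr (real k * a)"
        using st by (simp add: powr_power mult.commute)
      moreover have "e powr real (2 * k) = e ^ (2 * k)" using e by (rule powr_realpow)
      ultimately show ?thesis by (simp add: C_def power_mult_distrib power_divide)
    qed
    finally show ?thesis
      using C by (simp add: emeasure_eq_measure)
  qed
  show "\<exists>v. is_modification M {0..T} v (\<lambda>t. u t x) \<and> (AE \<omega> in M. hoelder_on \<delta> {0..T} (\<lambda>t. v t \<omega>))"
  proof (rule kolmogorov_chentsov_weak_type[OF prob_space_axioms \<open>0 < T\<close> _ C])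
    show "0 < \<delta>" using \<delta> by simp
    show "0 < real (2 * k)" using k by simp
    show "1 + real (2 * k) * \<delta> < real k * a" using k(1) by (simp add: algebra_simps)
    show "u t x \<in> borel_measurable M" if "t \<in> {0..T}" for t
      using wi[OF that] by (simp add: is_wiener_integral_def)
    show "measure M {\<omega> \<in> space M. e \<le> \<bar>u t x \<omega> - u s x \<omega>\<bar>} \<le> C * \<bar>t - s\<bar> powr (real k * a) / e powr real (2 * k)"
      if st: "s \<in> {0..T}" "t \<in> {0..T}" "0 < e" for s t e
    proof -
      consider "s < t" | "t < s" | "s = t" by linarith
      then show ?thesis
      proof cases
        case 1
        then show ?thesis using ordered st by blast
      next
        case 2
        then show ?thesis using ordered[OF st(2,1)] st(3) by (simp add: abs_minus_commute)
      next
        case 3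
        then show ?thesis using st C by simp
      qed
    qed
  qed
qed

end
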